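(* Let $T$ be a $(d_0,d_1)$-biregular tree with $d_0,d_1\ge 3$. Let $G$ be a non-compact, closed, topologically simple subgroup of $\operatorname{Aut}(T)$ acting transitively on $\partial T$ and satisfying Tits' independence property, and let $\Gamma\le G$ be a lattice, $X=G/\Gamma$. Let $\xi\in\partial T$, let $a\in G$ be a hyperbolic element with attracting fixed point $\xi$, and let $x\in X$ be such that its orbit $G^0_\xi x$ is compact. Then the sequence of compact orbits $G^0_\xi a^i x$ equidistributes to $m_X$ as $i\to+\infty$; that is, denoting by $m_i$ the $G^0_\xi$-invariant Borel probability measure on $G^0_\xi a^i x$, for every $\theta\in C_c(X)$ one has $\int_X\theta\,dm_i\to\int_X\theta\,dm_X$ as $i\to+\infty$.
   Context: $\operatorname{Aut}(T)$ denotes the group of automorphisms of $T$ acting without edge inversion; when $d_0=d_1$ this means the group of type-preserving automorphisms (those preserving the bipartition of the vertices). It carries the topology of pointwise convergence on vertices. For a subgraph $D$ of $T$, $G_D$ is the pointwise stabilizer of $D$ in $G$. For an oriented edge $[x,y]$, $T_{[x,y]}$ is the unique maximal subtree of $T$ that contains the edge $[x,y]$ but contains no neighbor of $x$ other than $y$. $G$ has Tits' independence property if $G_{[x,y]}=G_{T_{[x,y]}}G_{T_{[y,x]}}$ for every edge $[x,y]$ of $T$. $G^0_\xi=\{g\in G: g\xi=\xi,\ g\text{ elliptic}\}$, where elliptic means fixing a vertex of $T$. $m_X$ is the $G$-invariant Borel probability measure on $X$. The element $a$ normalizes $G^0_\xi$, so $G^0_\xi a^i x=a^iG^0_\xi x$.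 *)

theory Defs
  imports "HOL-Probability.Probability" "HOL-Algebra.Left_Coset"
begin

section \<open>Trees\<close>

text \<open>
  A graph is given by an adjacency relation whose vertex set is the whole type.
\<close>

definition is_tree :: "('v \<Rightarrow> 'v \<Rightarrow> bool) \<Rightarrow> bool" where
  "is_tree adj \<longleftrightarrow>
     symp adj \<and> irreflp adj \<and>
     (\<forall>x y. adj\<^sup>*\<^sup>* x y) \<and>
     (\<nexists>c. length c \<ge> 3 \<and> distinct c \<and> successively adj c \<and> adj (last c) (hd c))"

definition bipartition :: "('v \<Rightarrow> 'v \<Rightarrow> bool) \<Rightarrow> 'v set \<Rightarrow> bool" where
  "bipartition adj V0 \<longleftrightarrow> (\<forall>x y. adj x y \<longrightarrow> (x \<in> V0 \<longleftrightarrow> y \<notin> V0))"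

definition biregular :: "('v \<Rightarrow> 'v \<Rightarrow> bool) \<Rightarrow> nat \<Rightarrow> nat \<Rightarrow> bool" where
  "biregular adj d0 d1 \<longleftrightarrow>
     (\<exists>V0. bipartition adj V0 \<and>
       (\<forall>x\<in>V0. finite {y. adj x y} \<and> card {y. adj x y} = d0) \<and>
       (\<forall>x\<in>- V0. finite {y. adj x y} \<and> card {y. adj x y} = d1))"

text \<open>
  A subtree of a tree is determined by its vertex set: a nonempty set in which any two
  vertices are joined by a walk inside the set.
\<close>

definition subtree :: "('v \<Rightarrow> 'v \<Rightarrow> bool) \<Rightarrow> 'v set \<Rightarrow> bool" where
  "subtree adj S \<longleftrightarrow>
     S \<noteq> {} \<and> (\<forall>u\<in>S. \<forall>v\<in>S. (\<lambda>p q. p \<in> S \<and> q \<in> S \<and> adj p q)\<^sup>*\<^sup>* u v)"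

definition edge_subtree :: "('v \<Rightarrow> 'v \<Rightarrow> bool) \<Rightarrow> 'v \<Rightarrow> 'v \<Rightarrow> 'v set \<Rightarrow> bool" where
  "edge_subtree adj x y S \<longleftrightarrow>
     subtree adj S \<and> x \<in> S \<and> y \<in> S \<and> (\<forall>z\<in>S. adj x z \<longrightarrow> z = y)"

definition half_tree :: "('v \<Rightarrow> 'v \<Rightarrow> bool) \<Rightarrow> 'v \<Rightarrow> 'v \<Rightarrow> 'v set" where
  "half_tree adj x y =
     (THE S. edge_subtree adj x y S \<and> (\<forall>S'. edge_subtree adj x y S' \<and> S \<subseteq> S' \<longrightarrow> S' = S))"

lemma edge_subtree_Union:
  assumes "symp adj" "irreflp adj" "adj x y"
  shows "edge_subtree adj x y (\<Union>{S. edge_subtree adj x y S})"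
proof -
  let ?U = "\<Union>{S. edge_subtree adj x y S}"
  let ?R = "\<lambda>S p q. p \<in> S \<and> q \<in> S \<and> adj p q"
  have mono: "(?R ?U)\<^sup>*\<^sup>* u v" if "edge_subtree adj x y S" "(?R S)\<^sup>*\<^sup>* u v" for S u v
    using that(2)
  proof (induction rule: rtranclp_induct)
    case (step p q)
    have "S \<subseteq> ?U" using that(1) by (intro Union_upper CollectI)
    then have "?R ?U p q" using step.hyps(2) by (simp only: subset_iff simp_thms)
    with step.IH show ?case by (rule rtranclp.rtrancl_into_rtrancl)
  qed (rule rtranclp.rtrancl_refl)
  have base: "edge_subtree adj x y {x, y}"
  proof -
    have "(?R {x, y})\<^sup>*\<^sup>* u v" if "u \<in> {x, y}" "v \<in> {x, y}" for u v
      using that assms by (auto dest: sympD intro: r_into_rtranclp)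
    then show ?thesis
      using assms by (auto simp: edge_subtree_def subtree_def dest: irreflpD)
  qed
  have conn: "(?R ?U)\<^sup>*\<^sup>* u v" if "u \<in> ?U" "v \<in> ?U" for u v
  proof -
    from that(1) obtain S where S: "edge_subtree adj x y S" "u \<in> S" by blast
    from that(2) obtain S' where S': "edge_subtree adj x y S'" "v \<in> S'" by blast
    have "(?R S)\<^sup>*\<^sup>* u x" "(?R S')\<^sup>*\<^sup>* x v"
      using S S' by (auto simp: edge_subtree_def subtree_def)
    then show ?thesis using mono[OF S(1)] mono[OF S'(1)] by (meson rtranclp_trans)
  qed
  have mem: "x \<in> ?U" "y \<in> ?U" using base by blast+
  then have "subtree adj ?U" using conn unfolding subtree_def by blast
  moreover have "z = y" if "z \<in> ?U" "adj x z" for z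
    using that unfolding edge_subtree_def by blast
  ultimately show ?thesis using mem by (subst edge_subtree_def) blast
qed

lemma half_tree_eq_Union:
  assumes "symp adj" "irreflp adj" "adj x y"
  shows "half_tree adj x y = \<Union>{S. edge_subtree adj x y S}"
proof -
  let ?U = "\<Union>{S. edge_subtree adj x y S}"
  have le: "S \<subseteq> ?U" if "edge_subtree adj x y S" for S
    using that by (intro Union_upper CollectI)
  have U: "edge_subtree adj x y ?U" by (rule edge_subtree_Union[OF assms])
  show ?thesis
    unfolding half_tree_def
  proof (rule the_equality, intro conjI allI impI; (elim conjE)?)
    show "edge_subtree adj x y ?U" by (rule U)
    show "S' = ?U" if "edge_subtree adj x y S'" "?U \<subseteq> S'" for S'
      using le[OF that(1)] that(2) by (rule subset_antisym)
    show "S = ?U" if "edge_subtree adj x y S"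
        "\<forall>S'. edge_subtree adj x y S' \<and> S \<subseteq> S' \<longrightarrow> S' = S" for S
      using that(2)[rule_format, OF conjI, OF U le[OF that(1)]] by (rule sym)
  qed
qed


section \<open>The automorphism group\<close>

text \<open>
  Automorphisms preserving the bipartition of the vertices.  If the two degrees differ, then every
  automorphism does so; if they agree, this is the meaning given to acting without edge inversion.
\<close>

definition tree_aut :: "('v \<Rightarrow> 'v \<Rightarrow> bool) \<Rightarrow> ('v \<Rightarrow> 'v) monoid" where
  "tree_aut adj =
     \<lparr>carrier = {g. bij g \<and> (\<forall>x y. adj (g x) (g y) \<longleftrightarrow> adj x y) \<and>
                    (\<forall>V0. bipartition adj V0 \<longrightarrow> g ` V0 = V0)},
      mult = (\<circ>), one = id\<rparr>"

lemma group_tree_aut: "group (tree_aut adj)"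
proof (rule groupI)
  fix g assume g: "g \<in> carrier (tree_aut adj)"
  then have bij: "bij g" by (simp add: tree_aut_def)
  let ?h = "inv_into UNIV g"
  have "?h \<in> carrier (tree_aut adj)"
  proof -
    have "adj (?h x) (?h y) \<longleftrightarrow> adj x y" for x y
      using g bij by (simp add: tree_aut_def) (metis bij_inv_eq_iff)
    moreover have "?h ` V0 = V0" if "bipartition adj V0" for V0
    proof -
      have "g ` V0 = V0" using g that by (simp add: tree_aut_def)
      then show ?thesis using bij by (metis bij_is_inj image_inv_f_f)
    qed
    ultimately show ?thesis using bij by (simp add: tree_aut_def bij_imp_bij_inv)
  qed
  moreover have "?h \<circ> g = id" using bij by (simp add: bij_is_inj)
  ultimately show "\<exists>h\<in>carrier (tree_aut adj). h \<otimes>\<^bsub>tree_aut adj\<^esub> g = \<one>\<^bsub>tree_aut adj\<^esub>"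
    by (auto simp: tree_aut_def)
next
  fix g h assume g: "g \<in> carrier (tree_aut adj)" and h: "h \<in> carrier (tree_aut adj)"
  have "(g \<circ> h) ` V0 = V0" if "bipartition adj V0" for V0
    unfolding image_comp[symmetric] using g h that by (simp add: tree_aut_def)
  then show "g \<otimes>\<^bsub>tree_aut adj\<^esub> h \<in> carrier (tree_aut adj)"
    using g h by (simp add: tree_aut_def bij_comp)
qed (auto simp: tree_aut_def)

text \<open>Pointwise convergence on the (discrete) set of vertices.\<close>

definition aut_topology :: "('v \<Rightarrow> 'v \<Rightarrow> bool) \<Rightarrow> ('v \<Rightarrow> 'v) topology" where
  "aut_topology adj =
     subtopology (product_topology (\<lambda>_. discrete_topology UNIV) UNIV) (carrier (tree_aut adj))"

definition topologically_simple ::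
    "('a, 'b) monoid_scheme \<Rightarrow> 'a topology \<Rightarrow> 'a set \<Rightarrow> bool" where
  "topologically_simple A \<tau> G \<longleftrightarrow>
     G \<noteq> {\<one>\<^bsub>A\<^esub>} \<and>
     (\<forall>N. N \<lhd> A\<lparr>carrier := G\<rparr> \<and> closedin (subtopology \<tau> G) N \<longrightarrow> N = {\<one>\<^bsub>A\<^esub>} \<or> N = G)"

definition fixer :: "('v \<Rightarrow> 'v) set \<Rightarrow> 'v set \<Rightarrow> ('v \<Rightarrow> 'v) set" where
  "fixer G D = {g \<in> G. \<forall>v\<in>D. g v = v}"

definition tits_independent :: "('v \<Rightarrow> 'v \<Rightarrow> bool) \<Rightarrow> ('v \<Rightarrow> 'v) set \<Rightarrow> bool" where
  "tits_independent adj G \<longleftrightarrow>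
     (\<forall>x y. adj x y \<longrightarrow>
        fixer G {x, y} =
          fixer G (half_tree adj x y) <#>\<^bsub>tree_aut adj\<^esub> fixer G (half_tree adj y x))"


section \<open>The boundary\<close>

text \<open>
  In a tree an injective infinite path is a geodesic ray; ends are geodesic rays modulo
  eventual coincidence.
\<close>

definition rays :: "('v \<Rightarrow> 'v \<Rightarrow> bool) \<Rightarrow> (nat \<Rightarrow> 'v) set" where
  "rays adj = {r. inj r \<and> (\<forall>n. adj (r n) (r (Suc n)))}"

definition cofinal_rays :: "('v \<Rightarrow> 'v \<Rightarrow> bool) \<Rightarrow> ((nat \<Rightarrow> 'v) \<times> (nat \<Rightarrow> 'v)) set" where
  "cofinal_rays adj =
     {(r, s). r \<in> rays adj \<and> s \<in> rays adj \<and> (\<exists>m n. \<forall>k. r (m + k) = s (n + k))}"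

definition tree_boundary :: "('v \<Rightarrow> 'v \<Rightarrow> bool) \<Rightarrow> (nat \<Rightarrow> 'v) set set" where
  "tree_boundary adj = rays adj // cofinal_rays adj"

definition end_act :: "('v \<Rightarrow> 'v) \<Rightarrow> (nat \<Rightarrow> 'v) set \<Rightarrow> (nat \<Rightarrow> 'v) set" where
  "end_act g \<xi> = (\<lambda>r. g \<circ> r) ` \<xi>"

definition transitive_on_boundary :: "('v \<Rightarrow> 'v \<Rightarrow> bool) \<Rightarrow> ('v \<Rightarrow> 'v) set \<Rightarrow> bool" where
  "transitive_on_boundary adj G \<longleftrightarrow>
     (\<forall>\<xi>\<in>tree_boundary adj. \<forall>\<eta>\<in>tree_boundary adj. \<exists>g\<in>G. end_act g \<xi> = \<eta>)"

definition elliptic :: "('v \<Rightarrow> 'v) \<Rightarrow> bool" where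
  "elliptic g \<longleftrightarrow> (\<exists>v. g v = v)"

text \<open>The automorphism translates the bi-infinite geodesic by a positive amount.\<close>

definition translates_along :: "('v \<Rightarrow> 'v \<Rightarrow> bool) \<Rightarrow> ('v \<Rightarrow> 'v) \<Rightarrow> (int \<Rightarrow> 'v) \<Rightarrow> bool" where
  "translates_along adj g l \<longleftrightarrow>
     inj l \<and> (\<forall>i. adj (l i) (l (i + 1))) \<and> (\<exists>k>0. \<forall>i. g (l i) = l (i + k))"

definition hyperbolic :: "('v \<Rightarrow> 'v \<Rightarrow> bool) \<Rightarrow> ('v \<Rightarrow> 'v) \<Rightarrow> bool" where
  "hyperbolic adj g \<longleftrightarrow> (\<exists>l. translates_along adj g l)"

definition attracting_end :: "('v \<Rightarrow> 'v \<Rightarrow> bool) \<Rightarrow> ('v \<Rightarrow> 'v) \<Rightarrow> (nat \<Rightarrow> 'v) set \<Rightarrow> bool" where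
  "attracting_end adj g \<xi> \<longleftrightarrow>
     \<xi> \<in> tree_boundary adj \<and> (\<exists>l. translates_along adj g l \<and> (\<lambda>n. l (int n)) \<in> \<xi>)"

definition horo_stabilizer ::
    "('v \<Rightarrow> 'v) set \<Rightarrow> (nat \<Rightarrow> 'v) set \<Rightarrow> ('v \<Rightarrow> 'v) set" where
  "horo_stabilizer G \<xi> = {g \<in> G. end_act g \<xi> = \<xi> \<and> elliptic g}"


section \<open>Homogeneous spaces and invariant measures\<close>

definition quotient_topology :: "'a topology \<Rightarrow> ('a \<Rightarrow> 'b) \<Rightarrow> 'b topology" where
  "quotient_topology \<tau> f =
     topology (\<lambda>U. U \<subseteq> f ` topspace \<tau> \<and> openin \<tau> {x \<in> topspace \<tau>. f x \<in> U})"

lemma openin_quotient_topology: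
  "openin (quotient_topology \<tau> f) U \<longleftrightarrow>
     U \<subseteq> f ` topspace \<tau> \<and> openin \<tau> {x \<in> topspace \<tau>. f x \<in> U}"
proof -
  have "istopology (\<lambda>U. U \<subseteq> f ` topspace \<tau> \<and> openin \<tau> {x \<in> topspace \<tau>. f x \<in> U})"
    unfolding istopology_def
  proof (intro conjI allI impI; (elim conjE)?)
    fix S T assume *: "openin \<tau> {x \<in> topspace \<tau>. f x \<in> S}" "openin \<tau> {x \<in> topspace \<tau>. f x \<in> T}"
    have "{x \<in> topspace \<tau>. f x \<in> S \<inter> T} =
        {x \<in> topspace \<tau>. f x \<in> S} \<inter> {x \<in> topspace \<tau>. f x \<in> T}" by blast
    then show "openin \<tau> {x \<in> topspace \<tau>. f x \<in> S \<inter> T}" using * by (simp add: openin_Int)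
  next
    fix \<K> assume *: "\<forall>K\<in>\<K>. K \<subseteq> f ` topspace \<tau> \<and> openin \<tau> {x \<in> topspace \<tau>. f x \<in> K}"
    have "{x \<in> topspace \<tau>. f x \<in> \<Union>\<K>} = (\<Union>K\<in>\<K>. {x \<in> topspace \<tau>. f x \<in> K})" by blast
    moreover have "openin \<tau> (\<Union>K\<in>\<K>. {x \<in> topspace \<tau>. f x \<in> K})"
      using * by (intro openin_Union) blast
    ultimately show "openin \<tau> {x \<in> topspace \<tau>. f x \<in> \<Union>\<K>}" by (rule ssubst)
  qed blast+
  then show ?thesis by (simp add: quotient_topology_def topology_inverse')
qed

lemma topspace_quotient_topology [simp]:
  "topspace (quotient_topology \<tau> f) = f ` topspace \<tau>"
proof (rule antisym)
  show "topspace (quotient_topology \<tau> f) \<subseteq> f ` topspace \<tau>"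
    using openin_topspace[of "quotient_topology \<tau> f"]
    unfolding openin_quotient_topology by (rule conjunct1)
  have "{x \<in> topspace \<tau>. f x \<in> f ` topspace \<tau>} = topspace \<tau>" by blast
  then have "openin (quotient_topology \<tau> f) (f ` topspace \<tau>)"
    by (simp only: openin_quotient_topology openin_topspace subset_refl simp_thms)
  then show "f ` topspace \<tau> \<subseteq> topspace (quotient_topology \<tau> f)" by (rule openin_subset)
qed

lemma quotient_map_quotient_topology: "quotient_map \<tau> (quotient_topology \<tau> f) f"
  by (simp add: quotient_map_def openin_quotient_topology)

text \<open>
  The space of left cosets with its quotient topology; a group element acts on it by
  left translation of cosets.
\<close>

definition coset_space ::
    "('v \<Rightarrow> 'v \<Rightarrow> bool) \<Rightarrow> ('v \<Rightarrow> 'v) set \<Rightarrow> ('v \<Rightarrow> 'v) set \<Rightarrow> ('v \<Rightarrow> 'v) set topology" where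
  "coset_space adj G \<Gamma> =
     quotient_topology (subtopology (aut_topology adj) G) (\<lambda>g. g <#\<^bsub>tree_aut adj\<^esub> \<Gamma>)"

lemma topspace_coset_space:
  assumes "G \<subseteq> carrier (tree_aut adj)"
  shows "topspace (coset_space adj G \<Gamma>) = lcosets\<^bsub>(tree_aut adj)\<lparr>carrier := G\<rparr>\<^esub> \<Gamma>"
  using assms by (auto simp: coset_space_def aut_topology_def LCOSETS_def l_coset_def)

definition coset_orbit ::
    "('a, 'b) monoid_scheme \<Rightarrow> 'a set \<Rightarrow> 'a set \<Rightarrow> 'a set set" where
  "coset_orbit A H y = (\<lambda>g. g <#\<^bsub>A\<^esub> y) ` H"

definition invariant_borel_prob ::
    "('a, 'b) monoid_scheme \<Rightarrow> 'a set \<Rightarrow> 'a set topology \<Rightarrow> 'a set measure \<Rightarrow> bool" where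
  "invariant_borel_prob A H \<tau> \<mu> \<longleftrightarrow>
     prob_space \<mu> \<and>
     sets \<mu> = sets (sigma (topspace \<tau>) {U. openin \<tau> U}) \<and>
     (\<forall>g\<in>H. \<forall>B\<in>sets \<mu>. emeasure \<mu> ((\<lambda>C. g <#\<^bsub>A\<^esub> C) ` B) = emeasure \<mu> B)"

text \<open>
  Finite covolume is expressed by a finite invariant Borel measure on the coset space, normalised
  to total mass one.
\<close>

definition lattice_in ::
    "('v \<Rightarrow> 'v \<Rightarrow> bool) \<Rightarrow> ('v \<Rightarrow> 'v) set \<Rightarrow> ('v \<Rightarrow> 'v) set \<Rightarrow> bool" where
  "lattice_in adj G \<Gamma> \<longleftrightarrow>
     subgroup \<Gamma> ((tree_aut adj)\<lparr>carrier := G\<rparr>) \<and>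
     subtopology (aut_topology adj) \<Gamma> = discrete_topology \<Gamma> \<and>
     (\<exists>\<mu>. invariant_borel_prob (tree_aut adj) G (coset_space adj G \<Gamma>) \<mu>)"

definition Cc :: "'a topology \<Rightarrow> ('a \<Rightarrow> complex) set" where
  "Cc \<tau> = {\<theta>. continuous_map \<tau> euclidean \<theta> \<and>
              compactin \<tau> (Abstract_Topology.closure_of \<tau> {y \<in> topspace \<tau>. \<theta> y \<noteq> 0})}"

end

theory Submission
  imports Defs "HOL-Complex_Analysis.Great_Picard"
begin

text \<open>
  Let \<open>U\<close> be the stabilizer of an edge on the axis of \<open>a\<close>. By Tits' independence property,
  \<open>U = U\<^sub>- U\<^sub>+\<close> with \<open>U\<^sub>+ \<subseteq> G\<^sup>0\<^sub>\<xi>\<close> and \<open>U\<^sub>-\<close> contracted by \<open>a\<close>. Hence, for a locally constant \<open>f\<close>,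
  the \<open>U\<close>-average of \<open>f(a\<^sup>i y)\<close> is, for large \<open>i\<close>, the \<open>i\<close>-th iterate of a Markov operator on the
  countable set of \<open>U\<close>-orbits in \<open>X\<close>, and the integral of \<open>f\<close> against \<open>m\<^sub>i\<close> is an average of values
  of this iterate on the compact orbit, which meets finitely many \<open>U\<close>-orbits. The iterates
  converge pointwise to the mean of \<open>f\<close>: a subsequential limit \<open>h\<close> cannot lose \<open>L\<^sup>2\<close>-norm under
  further averaging, so all \<open>h(a\<^sup>j y)\<close> with \<open>j \<in> \<int>\<close> are \<open>U\<close>-invariant, and the conjugates
  of \<open>U\<close> by powers of \<open>a\<close> generate \<open>G\<close>.
\<close>

section \<open>Trees and half-trees\<close>

text \<open>No Haar measure, unitary representation or spectral gap enters. Averaging over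
  \<open>U\<close> has two incarnations: a conditional expectation for the partition into
  \<open>U\<close>-orbits, which supplies the \<open>L^2\<close> geometry, and a finite mean over
  elements of \<open>U\<close>, available because a function invariant under an open subgroup has
  finitely many \<open>U\<close>-translates. The second form explains the Markov property. Once the
  factors in U_- have dropped out, F_i = avg (f o a^i) is a finite mean of translates by elements of
  U_+; since a^-1 U_+ a lies in U, these translations are absorbed by the next averaging, so F_(i+1)
  = avg (F_i o a). Conjugated by a^i, they are also invisible to m_i. Every \<open>U\<close>-orbit
  has positive mass because countably many translates of it cover X; hence almost sure identities
  between functions of the \<open>U\<close>-orbit hold at every point, as is needed on a compact
  orbit that may itself be null. That conjugates of \<open>U\<close> generate G is where
  transitivity on the boundary enters: it forces the group to turn the axis freely at each of its
  vertices, in both directions.\<close>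

lemma rtranclp_distinct_path:
  assumes "R\<^sup>*\<^sup>* y z"
  obtains xs where "xs \<noteq> []" "hd xs = y" "last xs = z" "distinct xs" "successively R xs"
    "\<forall>w\<in>set xs. R\<^sup>*\<^sup>* y w"
proof -
  have "\<exists>xs. xs \<noteq> [] \<and> hd xs = y \<and> last xs = z \<and> distinct xs \<and> successively R xs \<and>
      (\<forall>w\<in>set xs. R\<^sup>*\<^sup>* y w)"
    using assms
  proof (induction rule: rtranclp_induct)
    case base
    show ?case by (rule exI[of _ "[y]"]) simp
  next
    case (step p q)
    then obtain xs where xs: "xs \<noteq> []" "hd xs = y" "last xs = p" "distinct xs" "successively R xs"
      "\<forall>w\<in>set xs. R\<^sup>*\<^sup>* y w" by blast
    show ?case
    proof (cases "q \<in> set xs")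
      case True
      \<comment> \<open>Loop erasure: on returning to a visited vertex the path is cut back to that
        vertex.\<close>
      then obtain us vs where us: "xs = us @ q # vs" by (meson split_list)
      show ?thesis
        using xs us by (intro exI[of _ "us @ [q]"]) (auto simp: successively_append_iff hd_append)
    next
      case False
      show ?thesis
        using xs False step
        by (intro exI[of _ "xs @ [q]"]) (auto simp: successively_append_iff)
    qed
  qed
  then show thesis using that by blast
qed

text \<open>Lying in one component of the tree with \<open>x\<close> removed, provided the starting
  point differs from \<open>x\<close>; the relation is reflexive at \<open>x\<close> as well. It
  describes half-trees without distances or geodesics.\<close>

definition avoiding :: "('v \<Rightarrow> 'v \<Rightarrow> bool) \<Rightarrow> 'v \<Rightarrow> 'v \<Rightarrow> 'v \<Rightarrow> bool" where
  "avoiding adj x = (\<lambda>p q. adj p q \<and> p \<noteq> x \<and> q \<noteq> x)\<^sup>*\<^sup>*"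

lemma avoiding_refl [simp]: "avoiding adj x y y"
  by (simp add: avoiding_def)

lemma avoiding_step: "avoiding adj x y p \<Longrightarrow> adj p q \<Longrightarrow> p \<noteq> x \<Longrightarrow> q \<noteq> x \<Longrightarrow> avoiding adj x y q"
  unfolding avoiding_def by (rule rtranclp.rtrancl_into_rtrancl) auto

lemma avoiding_trans: "avoiding adj x y p \<Longrightarrow> avoiding adj x p q \<Longrightarrow> avoiding adj x y q"
  unfolding avoiding_def by (rule rtranclp_trans)

lemma avoiding_induct [consumes 1, case_names base step]:
  assumes "avoiding adj x y z" "P y"
    "\<And>p q. avoiding adj x y p \<Longrightarrow> adj p q \<Longrightarrow> p \<noteq> x \<Longrightarrow> q \<noteq> x \<Longrightarrow> P p \<Longrightarrow> P q"
  shows "P z"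
  using assms(1) unfolding avoiding_def
  by (induction rule: rtranclp_induct) (use assms(2,3) in \<open>auto simp: avoiding_def\<close>)

lemma avoiding_neq: "avoiding adj x y z \<Longrightarrow> y \<noteq> x \<Longrightarrow> z \<noteq> x"
  by (induction rule: avoiding_induct) auto

lemma avoiding_image:
  assumes "avoiding adj x y z" "inj g" "\<And>p q. adj p q \<Longrightarrow> adj (g p) (g q)"
  shows "avoiding adj (g x) (g y) (g z)"
  using assms(1)
proof (induction rule: avoiding_induct)
  case (step p q)
  then show ?case using assms(2,3) by (intro avoiding_step[OF step.IH]) (auto dest: injD)
qed simp

locale tree =
  fixes adj :: "'v \<Rightarrow> 'v \<Rightarrow> bool"
  assumes tree: "is_tree adj"
begin

lemma adj_sym: "adj x y \<Longrightarrow> adj y x"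
  using tree by (auto simp: is_tree_def dest: sympD)

lemma adj_irrefl [simp]: "\<not> adj x x"
  using tree by (auto simp: is_tree_def dest: irreflpD)

lemma symp_adj: "symp adj" and irreflp_adj: "irreflp adj"
  using tree by (auto simp: is_tree_def)

lemma connected: "adj\<^sup>*\<^sup>* x y"
  using tree by (auto simp: is_tree_def)

lemma acyclic:
  "length c \<ge> 3 \<Longrightarrow> distinct c \<Longrightarrow> successively adj c \<Longrightarrow> \<not> adj (last c) (hd c)"
  using tree by (auto simp: is_tree_def)

text \<open>A loop-free path from \<open>y\<close> to \<open>z\<close> missing \<open>x\<close>
  would close up through \<open>x\<close> to a cycle.\<close>

lemma neighbours_separated:
  assumes "adj x y" "adj x z" "avoiding adj x y z"
  shows "y = z"
proof (rule ccontr)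
  assume "y \<noteq> z"
  obtain xs where xs: "xs \<noteq> []" "hd xs = y" "last xs = z" "distinct xs"
    "successively (\<lambda>p q. adj p q \<and> p \<noteq> x \<and> q \<noteq> x) xs"
    "\<forall>w\<in>set xs. avoiding adj x y w"
    using assms(3) unfolding avoiding_def by (rule rtranclp_distinct_path)
  have "x \<notin> set xs" using xs(6) assms(1) avoiding_neq by fastforce
  moreover have "successively adj xs" using xs(5) by (rule successively_mono) auto
  moreover have "length xs \<ge> 2"
    using \<open>y \<noteq> z\<close> xs(1-3) by (cases xs rule: list.exhaust; cases "tl xs") auto
  ultimately show False
    using acyclic[of "x # xs"] xs(1-4) assms(1,2)
    by (auto simp: successively_Cons adj_sym)
qed

text \<open>The right-hand set is an edge subtree by \<open>neighbours_separated\<close>. It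
  contains every other one, because a walk from \<open>x\<close> inside an edge subtree can leave
  \<open>x\<close> only through \<open>y\<close>.\<close>

lemma half_tree_eq:
  assumes xy: "adj x y"
  shows "half_tree adj x y = insert x {z. avoiding adj x y z}"
proof -
  let ?B = "insert x {z. avoiding adj x y z}"
  let ?R = "\<lambda>S p q. p \<in> S \<and> q \<in> S \<and> adj p q"
  have xney: "x \<noteq> y" using xy by auto
  have to: "(?R ?B)\<^sup>*\<^sup>* y z \<and> (?R ?B)\<^sup>*\<^sup>* z y" if "avoiding adj x y z" for z
    using that
  proof (induction rule: avoiding_induct)
    case (step p q)
    then have "p \<in> ?B" "q \<in> ?B" using avoiding_step[of adj x y p q] by auto
    with step have "?R ?B p q" "?R ?B q p" using adj_sym by blast+
    with step.IH show ?case
      by (metis (no_types, lifting) rtranclp.rtrancl_into_rtrancl converse_rtranclp_into_rtranclp)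
  qed simp
  have yx: "(?R ?B)\<^sup>*\<^sup>* y x" "(?R ?B)\<^sup>*\<^sup>* x y"
    using xy by (auto intro!: r_into_rtranclp adj_sym)
  have "(?R ?B)\<^sup>*\<^sup>* u v" if "u \<in> ?B" "v \<in> ?B" for u v
  proof -
    have "(?R ?B)\<^sup>*\<^sup>* u y" using that(1) to yx by blast
    moreover have "(?R ?B)\<^sup>*\<^sup>* y v" using that(2) to yx by blast
    ultimately show ?thesis by (rule rtranclp_trans)
  qed
  then have "edge_subtree adj x y ?B"
    unfolding edge_subtree_def subtree_def
    using neighbours_separated[OF xy] by auto
  moreover have "S \<subseteq> ?B" if S: "edge_subtree adj x y S" for S
  proof
    fix z assume "z \<in> S"
    then have "(?R S)\<^sup>*\<^sup>* x z" using S by (auto simp: edge_subtree_def subtree_def)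
    then show "z \<in> ?B"
    proof (induction rule: rtranclp_induct)
      case (step p q)
      show ?case
      proof (cases "p = x")
        case True
        then have "q = y" using step S by (auto simp: edge_subtree_def)
        then show ?thesis by simp
      next
        case False
        then show ?thesis using step avoiding_step[of adj x y p q] by auto
      qed
    qed simp
  qed
  ultimately show ?thesis
    unfolding half_tree_eq_Union[OF symp_adj irreflp_adj xy] by blast
qed

lemma half_tree_image:
  assumes "adj x y" "inj g" "\<And>p q. adj p q \<Longrightarrow> adj (g p) (g q)" "z \<in> half_tree adj x y"
  shows "g z \<in> half_tree adj (g x) (g y)"
  using assms avoiding_image[of adj x y z g] by (auto simp: half_tree_eq)

text \<open>A coincidence with the smallest gap would be a cycle. Gap 1 is excluded by irreflexivity
  and gap 2 by the second hypothesis, so this cycle has length at least 3.\<close>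

lemma nonbacktracking_inj:
  fixes r :: "nat \<Rightarrow> 'v"
  assumes "\<And>n. adj (r n) (r (Suc n))" "\<And>n. r n \<noteq> r (Suc (Suc n))"
  shows "inj r"
proof -
  have "r i \<noteq> r (i + Suc d)" for d i
  proof (induction d arbitrary: i rule: less_induct)
    case (less d)
    show ?case
    proof
      assume eq: "r i = r (i + Suc d)"
      have "d \<noteq> 0" using eq assms(1)[of i] by (intro notI) simp
      moreover have "d \<noteq> 1" using eq assms(2)[of i] by auto
      ultimately have d: "d \<ge> 2" by simp
      have ne: "r m \<noteq> r m'" if "i \<le> m" "m < m'" "m' \<le> i + d" for m m'
        using less[of "m' - m - 1" m] that by force
      let ?c = "map r [i..<i + Suc d]"
      have "distinct ?c"
        unfolding distinct_map
      proof (intro conjI inj_onI)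
        fix m m' assume "m \<in> set [i..<i + Suc d]" "m' \<in> set [i..<i + Suc d]" "r m = r m'"
        then show "m = m'" using ne[of m m'] ne[of m' m] by (cases m m' rule: linorder_cases) auto
      qed simp
      moreover have "successively adj ?c"
        using assms(1) by (simp add: successively_conv_nth del: upt_Suc)
      moreover have "adj (last ?c) (hd ?c)"
        using eq d assms(1)[of "i + d"] by (simp add: last_map hd_map hd_append)
      ultimately show False using acyclic[of ?c] d by simp
    qed
  qed
  then show ?thesis
    by (intro injI) (metis less_imp_Suc_add linorder_neqE_nat add_Suc_right)
qed

end

section \<open>Half-trees along a bi-infinite geodesic\<close>

locale tree_axis = tree adj for adj :: "'v \<Rightarrow> 'v \<Rightarrow> bool" +
  fixes l :: "int \<Rightarrow> 'v"
  assumes inj_l: "inj l" and adj_l: "\<And>i. adj (l i) (l (i + 1))"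
begin

lemma l_eq [simp]: "l i = l j \<longleftrightarrow> i = j"
  using inj_l by (auto dest: injD)

lemma adj_l': "adj (l (i + 1)) (l i)" "adj (l i) (l (i - 1))" "adj (l (i - 1)) (l i)"
  using adj_l[of i] adj_l[of "i - 1"] by (auto intro: adj_sym)

lemma avoiding_up:
  "m < n \<Longrightarrow> avoiding adj (l m) (l n) (l (n + int d))"
proof (induction d)
  case (Suc d)
  then show ?case
    using adj_l[of "n + int d"] avoiding_step[of adj "l m" "l n" "l (n + int d)"]
    by (auto simp: algebra_simps)
qed simp

lemma avoiding_down:
  "n < m \<Longrightarrow> avoiding adj (l m) (l n) (l (n - int d))"
proof (induction d)
  case (Suc d)
  then show ?case
    using adj_l'(2)[of "n - int d"] avoiding_step[of adj "l m" "l n" "l (n - int d)"]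
    by (auto simp: algebra_simps)
qed simp

text \<open>The two half-trees at the axis edge from \<open>l n\<close> to \<open>l (n + 1)\<close>;
  each contains both endpoints. \<open>Tp n\<close> holds the positive end of the axis and shrinks
  as \<open>n\<close> grows, \<open>Tm n\<close> holds the negative end and grows.\<close>

abbreviation "Tp n \<equiv> half_tree adj (l n) (l (n + 1))"
abbreviation "Tm n \<equiv> half_tree adj (l (n + 1)) (l n)"

lemma axis_in_Tp: "m \<ge> n \<Longrightarrow> l m \<in> Tp n"
proof -
  assume "m \<ge> n"
  then consider "m = n" | d where "m = n + 1 + int d"
    by (metis add.commute order_le_less zless_imp_add1_zle zle_iff_zadd)
  then show ?thesis
    using avoiding_up[of n "n+1"] by cases (auto simp: half_tree_eq[OF adj_l])
qed

lemma axis_in_Tm: "m \<le> n + 1 \<Longrightarrow> l m \<in> Tm n"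
proof -
  assume "m \<le> n + 1"
  then consider "m = n + 1" | d where "m = n - int d"
    by (metis add.commute diff_add_cancel add_diff_cancel_left' order_le_less zle_add1_eq_le zle_iff_zadd)
  then show ?thesis
    using avoiding_down[of n "n+1"] by cases (auto simp: half_tree_eq[OF adj_l'(1)])
qed

text \<open>A walk from \<open>l 0\<close> to \<open>v\<close> visits finitely many vertices, so it
  misses \<open>l (n + 1)\<close> for all large \<open>n\<close>. This is the source of contraction:
  an element fixing \<open>Tm n\<close> with \<open>n\<close> large fixes any prescribed finite
  set.\<close>

lemma Tm_exhaust: "\<exists>n0. \<forall>n\<ge>n0. v \<in> Tm n"
proof -
  have "\<exists>n0\<ge>0. \<forall>n\<ge>n0. avoiding adj (l (n + 1)) (l 0) v"
    using connected[of "l 0" v]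
  proof (induction rule: rtranclp_induct)
    case base
    show ?case by (rule exI[of _ 0]) simp
  next
    case (step p q)
    then obtain n0 where n0: "n0 \<ge> 0" "\<forall>n\<ge>n0. avoiding adj (l (n + 1)) (l 0) p" by blast
    obtain n1 where n1: "\<forall>n\<ge>n1. l (n + 1) \<noteq> q"
    proof (cases "\<exists>m. q = l m")
      case True
      then obtain m where "q = l m" by blast
      then show thesis using that[of m] by simp
    qed (use that in metis)
    show ?case
    proof (intro exI[of _ "max n0 n1"] conjI allI impI)
      fix n assume n: "max n0 n1 \<le> n"
      have "p \<noteq> l (n + 1)" using avoiding_neq[of adj "l (n+1)" "l 0" p] n0 n by auto
      then show "avoiding adj (l (n + 1)) (l 0) q"
        using n0 n1 n step(2) avoiding_step[of adj "l (n+1)" "l 0" p q] by auto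
    qed (use n0 in simp)
  qed
  then obtain n0 where n0: "n0 \<ge> 0" "\<forall>n\<ge>n0. avoiding adj (l (n + 1)) (l 0) v" by blast
  have "v \<in> Tm n" if "n \<ge> n0" for n
  proof -
    have "avoiding adj (l (n + 1)) (l n) (l 0)"
      using avoiding_down[of n "n+1" "nat n"] that n0 by simp
    then have "avoiding adj (l (n + 1)) (l n) v" using n0 that avoiding_trans by fastforce
    then show ?thesis by (simp add: half_tree_eq[OF adj_l'(1)])
  qed
  then show ?thesis by blast
qed

end

section \<open>Groups acting on a tree and its boundary\<close>

abbreviation finv :: "('v \<Rightarrow> 'v) \<Rightarrow> 'v \<Rightarrow> 'v" where
  "finv \<equiv> inv_into UNIV"

lemma tree_aut_simps [simp]:
  "x \<otimes>\<^bsub>tree_aut adj\<^esub> y = x \<circ> y" "\<one>\<^bsub>tree_aut adj\<^esub> = id"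
  by (simp_all add: tree_aut_def)

lemma tree_aut_inv:
  assumes "g \<in> carrier (tree_aut adj)"
  shows "inv\<^bsub>tree_aut adj\<^esub> g = finv g"
proof -
  have "inv\<^bsub>tree_aut adj\<^esub> g \<circ> g = id"
    using group.l_inv[OF group_tree_aut assms] by simp
  moreover have "bij g" using assms by (simp add: tree_aut_def)
  ultimately show ?thesis
    by (metis bij_is_surj comp_assoc comp_id id_comp surj_iff)
qed

lemma tree_aut_pow: "g [^]\<^bsub>tree_aut adj\<^esub> (n::nat) = g ^^ n"
  by (induction n) (auto simp: funpow_swap1 fun_eq_iff)

lemma equiv_cofinal_rays: "equiv (rays adj) (cofinal_rays adj)"
proof (rule equivI)
  show "cofinal_rays adj \<subseteq> rays adj \<times> rays adj" "refl_on (rays adj) (cofinal_rays adj)"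
    by (auto simp: cofinal_rays_def refl_on_def)
  show "sym (cofinal_rays adj)"
    by (auto simp: cofinal_rays_def sym_def) metis
  show "trans (cofinal_rays adj)"
  proof (rule transI)
    fix r s t assume "(r, s) \<in> cofinal_rays adj" "(s, t) \<in> cofinal_rays adj"
    then obtain m n m' n' where *: "r \<in> rays adj" "t \<in> rays adj"
      "\<forall>k. r (m + k) = s (n + k)" "\<forall>k. s (m' + k) = t (n' + k)"
      by (auto simp: cofinal_rays_def)
    have "r ((m + m') + k) = t ((n' + n) + k)" for k
      using *(3)[rule_format, of "m' + k"] *(4)[rule_format, of "n + k"] by (simp add: ac_simps)
    then show "(r, t) \<in> cofinal_rays adj"
      using * unfolding cofinal_rays_def by blast
  qed
qed

lemma tree_boundary_class: "r \<in> rays adj \<Longrightarrow> cofinal_rays adj `` {r} \<in> tree_boundary adj"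
  by (auto simp: tree_boundary_def quotient_def)

lemma tree_boundaryD:
  assumes "\<xi> \<in> tree_boundary adj" "r \<in> \<xi>"
  shows "\<xi> = cofinal_rays adj `` {r}" "r \<in> rays adj"
proof -
  obtain s where "s \<in> rays adj" "\<xi> = cofinal_rays adj `` {s}"
    using assms by (auto simp: tree_boundary_def quotient_def)
  then show "\<xi> = cofinal_rays adj `` {r}" "r \<in> rays adj"
    using assms(2) equiv_class_eq[OF equiv_cofinal_rays, of s r adj]
    by (auto simp: cofinal_rays_def)
qed

lemma rays_step: "r \<in> rays adj \<Longrightarrow> adj (r n) (r (Suc n))"
  by (simp add: rays_def)

locale tree_group = tree adj for adj :: "'v \<Rightarrow> 'v \<Rightarrow> bool" +
  fixes G :: "('v \<Rightarrow> 'v) set"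
  assumes subgroup_G: "subgroup G (tree_aut adj)"
begin

lemma G_sub: "g \<in> G \<Longrightarrow> g \<in> carrier (tree_aut adj)"
  using subgroup.subset[OF subgroup_G] by auto

lemma G_bij: "g \<in> G \<Longrightarrow> bij g" and G_adj [simp]: "g \<in> G \<Longrightarrow> adj (g x) (g y) \<longleftrightarrow> adj x y"
  and G_parts: "g \<in> G \<Longrightarrow> bipartition adj V0 \<Longrightarrow> g ` V0 = V0"
  using G_sub by (auto simp: tree_aut_def)

lemma G_inj: "g \<in> G \<Longrightarrow> inj g"
  by (rule bij_is_inj[OF G_bij])

lemma G_eq [simp]: "g \<in> G \<Longrightarrow> g x = g y \<longleftrightarrow> x = y"
  using G_bij by (auto dest: bij_is_inj injD)

lemma G_comp [intro]: "g \<in> G \<Longrightarrow> h \<in> G \<Longrightarrow> g \<circ> h \<in> G"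
  using subgroup.m_closed[OF subgroup_G] by simp

lemma G_id [intro, simp]: "id \<in> G"
  using subgroup.one_closed[OF subgroup_G] by simp

lemma G_inv [intro]: "g \<in> G \<Longrightarrow> finv g \<in> G"
  using subgroup.m_inv_closed[OF subgroup_G] tree_aut_inv[OF G_sub] by metis

lemma G_pow [intro]: "g \<in> G \<Longrightarrow> g ^^ n \<in> G"
  by (induction n) auto

lemma inv_app [simp]: "g \<in> G \<Longrightarrow> finv g (g x) = x" "g \<in> G \<Longrightarrow> g (finv g x) = x"
  using G_bij by (simp_all add: bij_is_inj bij_is_surj surj_f_inv_f)

lemma inv_comp_id [simp]: "g \<in> G \<Longrightarrow> finv g \<circ> g = id" "g \<in> G \<Longrightarrow> g \<circ> finv g = id"
  by (auto simp: fun_eq_iff)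

lemma inv_eq_iff: "g \<in> G \<Longrightarrow> finv g x = y \<longleftrightarrow> g y = x"
  by auto

lemma rays_image: "g \<in> G \<Longrightarrow> r \<in> rays adj \<Longrightarrow> g \<circ> r \<in> rays adj"
  by (auto simp: rays_def intro: inj_compose[OF G_inj])

lemma end_act_class:
  assumes g: "g \<in> G"
  shows "end_act g (cofinal_rays adj `` {r}) = cofinal_rays adj `` {g \<circ> r}"
proof
  show "end_act g (cofinal_rays adj `` {r}) \<subseteq> cofinal_rays adj `` {g \<circ> r}"
    using rays_image[OF g] by (auto simp: end_act_def cofinal_rays_def) metis
  show "cofinal_rays adj `` {g \<circ> r} \<subseteq> end_act g (cofinal_rays adj `` {r})"
  proof
    fix s assume "s \<in> cofinal_rays adj `` {g \<circ> r}"
    then obtain m n where s: "g \<circ> r \<in> rays adj" "s \<in> rays adj" "\<forall>k. g (r (m + k)) = s (n + k)"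
      by (auto simp: cofinal_rays_def)
    have "finv g \<circ> (g \<circ> r) \<in> rays adj" "finv g \<circ> s \<in> rays adj"
      using s rays_image[of "finv g"] g by auto
    moreover have "finv g \<circ> (g \<circ> r) = r" using g by (auto simp: fun_eq_iff)
    moreover have "r (m + k) = (finv g \<circ> s) (n + k)" for k
      using s(3) g by (metis comp_apply inv_app(1))
    ultimately have "finv g \<circ> s \<in> cofinal_rays adj `` {r}" by (auto simp: cofinal_rays_def)
    moreover have "s = g \<circ> (finv g \<circ> s)" using g by (auto simp: fun_eq_iff)
    ultimately show "s \<in> end_act g (cofinal_rays adj `` {r})" unfolding end_act_def by blast
  qed
qed

end

section \<open>Local transitivity and generation along the axis of a translation\<close>

locale translation = tree_group adj G + tree_axis adj l
  for adj :: "'v \<Rightarrow> 'v \<Rightarrow> bool" and G l +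
  fixes a :: "'v \<Rightarrow> 'v" and t :: int
  assumes three_neighbours: "\<And>x u v. \<exists>y. adj x y \<and> y \<noteq> u \<and> y \<noteq> v"
    and transitive: "transitive_on_boundary adj G"
    and a_in: "a \<in> G" and t_pos: "t > 0" and a_l: "\<And>i. a (l i) = l (i + t)"
begin

lemma a_pow_l: "(a ^^ n) (l i) = l (i + int n * t)"
  by (induction n) (auto simp: a_l algebra_simps)

lemma inv_a_pow_l: "finv (a ^^ n) (l i) = l (i - int n * t)"
  using a_pow_l[of n "i - int n * t"] inv_eq_iff[of "a ^^ n"] a_in by auto

lemma axis_rays: "(\<lambda>n. l (c + int n)) \<in> rays adj" "(\<lambda>n. l (c - int n)) \<in> rays adj"
  using adj_l[of "c + int n" for n] adj_l'(2)[of "c - int n" for n]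
  by (auto simp: rays_def inj_def ac_simps diff_diff_eq)

text \<open>Boundary transitivity carries the positive end of the axis to the end of
  \<open>r\<close>; cofinality then matches tails.\<close>

lemma ray_eventually_axis:
  assumes "r \<in> rays adj"
  obtains g m c where "g \<in> G" "\<And>j. r (m + j) = g (l (c + int j))"
proof -
  let ?s = "\<lambda>n. l (0 + int n)"
  have "cofinal_rays adj `` {?s} \<in> tree_boundary adj" "cofinal_rays adj `` {r} \<in> tree_boundary adj"
    using assms axis_rays(1) tree_boundary_class by blast+
  then obtain g where g: "g \<in> G"
    "end_act g (cofinal_rays adj `` {?s}) = cofinal_rays adj `` {r}"
    using transitive unfolding transitive_on_boundary_def by blast
  have "r \<in> cofinal_rays adj `` {r}"
    using assms equiv_cofinal_rays by (meson equiv_class_self)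
  then have "r \<in> cofinal_rays adj `` {g \<circ> ?s}"
    using g(2) end_act_class[OF g(1)] by simp
  then obtain m n where "\<forall>k. g (?s (n + k)) = r (m + k)"
    by (auto simp: cofinal_rays_def)
  then show thesis using that[OF g(1), of m "int n"] by simp
qed

text \<open>There are no leaves, so after any turn that does not backtrack the path can be continued
  forever without backtracking, and \<open>nonbacktracking_inj\<close> makes it a ray.\<close>

lemma extend_ray:
  assumes r: "r \<in> rays adj" and y: "adj (r (Suc p)) y" "y \<noteq> r p"
  obtains r' where "r' \<in> rays adj" "\<And>i. i \<le> Suc p \<Longrightarrow> r' i = r i" "r' (Suc (Suc p)) = y"
proof -
  define next_v where "next_v u v = (SOME w. adj v w \<and> w \<noteq> u)" for u v
  have next_v: "adj v (next_v u v)" "next_v u v \<noteq> u" for u v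
    using someI_ex[of "\<lambda>w. adj v w \<and> w \<noteq> u"] three_neighbours[of v u u] by (auto simp: next_v_def)
  \<comment> \<open>The state consists of the last two vertices, since the next vertex must differ
    from the one before last.\<close>
  define e where "e = rec_nat (r (Suc p), y) (\<lambda>_ (u, v). (v, next_v u v))"
  have e: "e 0 = (r (Suc p), y)" "\<And>n. e (Suc n) = (snd (e n), next_v (fst (e n)) (snd (e n)))"
    by (auto simp: e_def case_prod_unfold)
  define r' where "r' i = (if i \<le> Suc p then r i else snd (e (i - Suc (Suc p))))" for i
  have fst_e: "fst (e n) = r' (Suc p + n)" for n
    by (cases n) (auto simp: e r'_def)
  have snd_e: "snd (e n) = r' (Suc (Suc p) + n)" for n
    by (auto simp: r'_def)
  have r'_Suc: "r' (Suc (Suc (Suc p + n))) = next_v (r' (Suc p + n)) (r' (Suc (Suc p + n)))" for n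
    using snd_e[of "Suc n"] fst_e[of n] snd_e[of n] by (simp add: e)
  have step: "adj (r' i) (r' (Suc i))" for i
  proof -
    consider "i \<le> p" | "i = Suc p" | n where "i = Suc (Suc p + n)"
      by (metis Suc_leI add_Suc le_eq_less_or_eq less_iff_Suc_add not_less)
    then show ?thesis
    proof cases
      case 3
      then show ?thesis using r'_Suc[of n] next_v(1) by simp
    qed (use r y in \<open>auto simp: r'_def e rays_step\<close>)
  qed
  moreover have "r' i \<noteq> r' (Suc (Suc i))" for i
  proof -
    consider "i < p" | "i = p" | n where "i = Suc p + n"
      by (metis add_Suc less_iff_Suc_add linorder_neqE_nat)
    then show ?thesis
    proof cases
      case 1
      then show ?thesis using r by (auto simp: r'_def rays_def dest: injD[of r i])
    next
      case 2
      then show ?thesis using y by (auto simp: r'_def e)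
    next
      case 3
      then show ?thesis using r'_Suc[of n] next_v(2) by metis
    qed
  qed
  ultimately have "r' \<in> rays adj" by (auto simp: rays_def intro: nonbacktracking_inj)
  then show thesis using that[of r'] by (auto simp: r'_def e)
qed

text \<open>
  If the conclusion failed, one could build a ray whose 2-paths, taken up to \<open>G\<close>, violate the
  period of the axis infinitely often; but every ray is eventually a translate of the axis.
\<close>

lemma locally_transitive_forward:
  assumes y: "adj (l n) y" "y \<noteq> l (n - 1)"
  obtains g where "g \<in> G" "g (l (n - 1)) = l (n - 1)" "g (l n) = l n" "g (l (n + 1)) = y"
proof -
  \<comment> \<open>The \<open>G\<close>-type of a turn of \<open>r\<close>:
    \<open>z = l (n + 1)\<close> is the axis turn at \<open>l n\<close>, \<open>z = y\<close> the
    prescribed one. A single turn of both types yields the element sought.\<close>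
  define follows where "follows z r p \<longleftrightarrow>
    (\<exists>g\<in>G. r p = g (l (n - 1)) \<and> r (Suc p) = g (l n) \<and> r (Suc (Suc p)) = g z)" for z r p
  define T where "T = nat t"
  have T: "int T = t" "T > 0" using t_pos by (auto simp: T_def)
  define bad where "bad r p \<longleftrightarrow> follows (l (n + 1)) r p \<and> follows y r (p + T)" for r p
  have exclusive: "\<exists>g\<in>G. g (l (n - 1)) = l (n - 1) \<and> g (l n) = l n \<and> g (l (n + 1)) = y"
    if "follows (l (n + 1)) r p" "follows y r p" for r p
  proof -
    from that obtain g h where gh: "g \<in> G" "h \<in> G" "r p = g (l (n - 1))" "r (Suc p) = g (l n)"
      "r (Suc (Suc p)) = g (l (n + 1))" "r p = h (l (n - 1))" "r (Suc p) = h (l n)"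
      "r (Suc (Suc p)) = h y" by (auto simp: follows_def)
    then show ?thesis
      by (intro bexI[of _ "finv h \<circ> g"]) (auto simp: inv_eq_iff)
  qed
  have periodic: "\<exists>m. \<forall>p\<ge>m. follows (l (n + 1)) r p \<longrightarrow> follows (l (n + 1)) r (p + T)"
    if r: "r \<in> rays adj" for r
  proof -
    obtain g m c where g: "g \<in> G" "\<And>j. r (m + j) = g (l (c + int j))"
      using ray_eventually_axis[OF r] by metis
    \<comment> \<open>On its tail, \<open>r\<close> is moved forward by \<open>T\<close> under a
      conjugate of \<open>a\<close>, so each turn there has the same type as the turn one period
      later.\<close>
    have shift: "r (p + T) = (g \<circ> a \<circ> finv g) (r p)" if "p \<ge> m" for p
      using g(2)[of "p - m"] g(2)[of "p - m + T"] that g(1) T a_l[of "c + int (p - m)"]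
      by (simp add: algebra_simps)
    show ?thesis
    proof (intro exI[of _ m] allI impI)
      fix p assume p: "p \<ge> m" and "follows (l (n + 1)) r p"
      then obtain h where h: "h \<in> G" "r p = h (l (n - 1))" "r (Suc p) = h (l n)"
        "r (Suc (Suc p)) = h (l (n + 1))" by (auto simp: follows_def)
      have "g \<circ> a \<circ> finv g \<circ> h \<in> G" using g h a_in by blast
      then show "follows (l (n + 1)) r (p + T)" unfolding follows_def
        using h p shift[of p] shift[of "Suc p"] shift[of "Suc (Suc p)"]
        by (intro bexI[of _ "g \<circ> a \<circ> finv g \<circ> h"]) auto
    qed
  qed
  have stage: "\<exists>r' q. r' \<in> rays adj \<and> (\<forall>i\<le>p. r' i = r i) \<and> q \<ge> p \<and> bad r' q"
    if r: "r \<in> rays adj" for r p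
  proof -
    obtain g m c where g: "g \<in> G" "\<And>j. r (m + j) = g (l (c + int j))"
      using ray_eventually_axis[OF r] by metis
    \<comment> \<open>\<open>s\<close> is so large that \<open>g (l (n - 1 + int s * t))\<close>
      lies on the tail of \<open>r\<close> at an index \<open>q\<close> beyond \<open>p\<close>;
      from \<open>q\<close> on, \<open>r\<close> runs along the \<open>h\<close>-image of the axis,
      starting at \<open>h (l (n - 1))\<close>.\<close>
    define s where "s = nat \<bar>c - n + 1\<bar> + p"
    define q where "q = m + nat (n - 1 + int s * t - c)"
    have s: "int s * t \<ge> int s" using t_pos mult_left_mono[of 1 t "int s"] by simp
    have "n - 1 + int s * t - c \<ge> int p" using s by (auto simp: s_def)
    then have q: "q \<ge> p" "c + int (q - m) = n - 1 + int s * t" "q \<ge> m" by (auto simp: q_def)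
    define h where "h = g \<circ> a ^^ s"
    have h: "h \<in> G" using g a_in by (auto simp: h_def)
    have rh: "r (q + i) = h (l (n - 1 + int i))" for i
    proof -
      have e: "c + int (q - m + i) = (n - 1 + int i) + int s * t" "m + (q - m + i) = q + i"
        using q by simp_all
      show ?thesis using g(2)[of "q - m + i"] unfolding e by (simp add: h_def a_pow_l)
    qed
    \<comment> \<open>Leaving the image of the axis through \<open>h (a y)\<close> gives the turn at
      \<open>q + T\<close> type \<open>y\<close>; the axis turn at \<open>q\<close> is untouched
      because \<open>T > 0\<close>.\<close>
    let ?y = "h (a y)"
    have "r (Suc (q + T)) = h (a (l n))" "r (q + T) = h (a (l (n - 1)))"
      using rh[of "Suc T"] rh[of T] by (auto simp: a_l T algebra_simps)
    moreover from this have "adj (r (Suc (q + T))) ?y" "?y \<noteq> r (q + T)"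
      using h a_in y by auto
    ultimately obtain r' where r': "r' \<in> rays adj" "\<And>i. i \<le> Suc (q + T) \<Longrightarrow> r' i = r i"
      "r' (Suc (Suc (q + T))) = ?y" "r (Suc (q + T)) = h (a (l n))" "r (q + T) = h (a (l (n - 1)))"
      using extend_ray[OF r, of "q + T" ?y] by metis
    have "follows y r' (q + T)"
      unfolding follows_def using r' h a_in by (intro bexI[of _ "h \<circ> a"]) auto
    moreover have "follows (l (n + 1)) r' q"
      unfolding follows_def using r'(2)[of q] r'(2)[of "Suc q"] r'(2)[of "Suc (Suc q)"] T
        rh[of 0] rh[of 1] rh[of 2] h by (intro bexI[of _ h]) (auto simp: algebra_simps)
    ultimately show ?thesis
      using r' q by (intro exI[of _ r'] exI[of _ q]) (auto simp: bad_def)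
  qed
  define good_pair where "good_pair = (\<lambda>(r, p::nat). r \<in> rays adj)"
  \<comment> \<open>The margin \<open>q + T + 2\<close> covers every vertex on which
    \<open>bad r' q\<close> depends, so later stages preserve it and it passes to the limit
    ray.\<close>
  define succ where "succ = (\<lambda>(r, p) (r', p'). (\<forall>i\<le>p. r' i = r i) \<and> p < p' \<and>
    (\<exists>q\<ge>p. q + T + 2 \<le> p' \<and> bad r' q))"
  have "\<exists>f. \<forall>k::nat. good_pair (f k) \<and> succ (f k) (f (Suc k))"
  proof (rule dependent_nat_choice)
    show "\<exists>x. good_pair x"
      using axis_rays(1)[of 0] by (auto simp: good_pair_def)
    fix x :: "(nat \<Rightarrow> 'v) \<times> nat" and k :: nat assume "good_pair x"
    then obtain r p where x: "x = (r, p)" "r \<in> rays adj" by (cases x) (auto simp: good_pair_def)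
    obtain r' q where "r' \<in> rays adj" "\<forall>i\<le>p. r' i = r i" "q \<ge> p" "bad r' q"
      using stage[OF x(2)] by blast
    then show "\<exists>y. good_pair y \<and> succ x y"
      by (intro exI[of _ "(r', q + T + 2)"]) (auto simp: good_pair_def succ_def x)
  qed
  then obtain f where f: "\<And>k. good_pair (f k)" "\<And>k. succ (f k) (f (Suc k))" by blast
  define R where "R k = fst (f k)" for k
  define P where "P k = snd (f k)" for k
  have R: "R k \<in> rays adj" for k using f(1)[of k] by (auto simp: good_pair_def R_def split: prod.splits)
  have S: "\<forall>i\<le>P k. R (Suc k) i = R k i" "P k < P (Suc k)"
    "\<exists>q\<ge>P k. q + T + 2 \<le> P (Suc k) \<and> bad (R (Suc k)) q" for k
    using f(2)[of k] by (auto simp: succ_def R_def P_def split: prod.splits)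
  have mono: "strict_mono P" using S(2) by (simp add: strict_mono_Suc_iff)
  have agree: "R (k + d) i = R k i" if "i \<le> P k" for k d i
  proof (induction d)
    case (Suc d)
    have "P k \<le> P (k + d)" using mono by (simp add: strict_mono_less_eq)
    then show ?case using Suc S(1)[of "k + d"] that by auto
  qed simp
  \<comment> \<open>Stage \<open>k\<close> freezes the vertices up to index \<open>P k\<close>, and
    \<open>i \<le> P i\<close>, so the diagonal is the limit of the stages.\<close>
  define r where "r i = R i i" for i
  have r: "r i = R k i" if "i \<le> P k" for i k
  proof -
    have "i \<le> P i" using mono by (rule strict_mono_imp_increasing)
    then show ?thesis
      using agree[of i i "k - i"] agree[of i k "i - k"] that by (cases "i \<le> k") (auto simp: r_def)
  qed
  have ge: "k \<le> P k" for k using mono by (rule strict_mono_imp_increasing)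
  have "r \<in> rays adj"
    unfolding rays_def
  proof (intro CollectI conjI allI injI)
    fix i j assume "r i = r j"
    then have "R (max i j) i = R (max i j) j"
      using r[of i "max i j"] r[of j "max i j"] ge[of "max i j"] by auto
    then show "i = j" using R[of "max i j"] by (auto simp: rays_def dest: injD)
  next
    fix i
    show "adj (r i) (r (Suc i))"
      using r[of i "Suc i"] r[of "Suc i" "Suc i"] ge[of "Suc i"] R[of "Suc i"] by (auto simp: rays_def)
  qed
  then obtain m where m: "\<And>p. p \<ge> m \<Longrightarrow> follows (l (n + 1)) r p \<Longrightarrow> follows (l (n + 1)) r (p + T)"
    using periodic by blast
  obtain q where q: "q \<ge> P m" "q + T + 2 \<le> P (Suc m)" "bad (R (Suc m)) q" using S(3) by blast
  have "bad r q"
    using q(2,3) r[of _ "Suc m"] by (auto simp: bad_def follows_def)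
  moreover have "q \<ge> m" using q(1) ge[of m] by simp
  ultimately have "follows (l (n + 1)) r (q + T)" "follows y r (q + T)" using m by (auto simp: bad_def)
  then show thesis using exclusive that by blast
qed

text \<open>The negative half-axis is a ray too, hence eventually a translate of the positive one.
  So some \<open>h\<close> in \<open>G\<close> maps a stretch of the axis into the axis with its
  direction reversed, and conjugating by \<open>h\<close> reduces to the forward case.\<close>

lemma locally_transitive_backward:
  assumes y: "adj (l n) y" "y \<noteq> l (n + 1)"
  obtains g where "g \<in> G" "g (l (n + 1)) = l (n + 1)" "g (l n) = l n" "g (l (n - 1)) = y"
proof -
  obtain g m c where g: "g \<in> G" "\<And>j. l (0 - int (m + j)) = g (l (c + int j))"
    using ray_eventually_axis[OF axis_rays(2)[of 0]] by metis
  \<comment> \<open>Chosen so that \<open>int s * t - n - int m - 1\<close> is nonnegative: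
    \<open>finv (a ^^ s)\<close> then pushes \<open>l (n + 1)\<close> into the part of the negative
    half-axis on which \<open>g\<close> is known.\<close>
  define s where "s = nat \<bar>n + int m + 1\<bar>"
  define j where "j = nat (int s * t - n - int m - 1)"
  have "int s * t \<ge> int s" using t_pos mult_left_mono[of 1 t "int s"] by simp
  then have j: "int j = int s * t - n - int m - 1" by (auto simp: s_def j_def)
  define h where "h = finv g \<circ> finv (a ^^ s)"
  have h: "h \<in> G" using g a_in by (auto simp: h_def)
  have hl: "h (l (n + 1 - int i)) = l (c + int j + int i)" for i
    using g(2)[of "j + i"] j g(1) by (auto simp: h_def inv_a_pow_l inv_eq_iff algebra_simps)
  let ?n = "c + int j + 1"
  have "h (l n) = l ?n" "h (l (n + 1)) = l (?n - 1)" "h (l (n - 1)) = l (?n + 1)"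
    using hl[of 0] hl[of 1] hl[of 2] by (auto simp: algebra_simps)
  moreover from this have "adj (l ?n) (h y)" "h y \<noteq> l (?n - 1)"
    using y h by (metis G_adj, metis G_eq)
  then obtain k where "k \<in> G" "k (l (?n - 1)) = l (?n - 1)" "k (l ?n) = l ?n" "k (l (?n + 1)) = h y"
    by (rule locally_transitive_forward)
  ultimately show thesis
    using h by (intro that[of "finv h \<circ> k \<circ> h"]) (auto simp: inv_eq_iff)
qed

text \<open>Tits' property puts the fixators of axis edges in \<open>S\<close>. Local transitivity
  then supplies elements of \<open>S\<close> that fix \<open>l n\<close> and move
  \<open>l (n + 1)\<close> to any neighbour, whence all fixators of axis vertices lie in
  \<open>S\<close>, and connectedness spreads this over the tree.\<close>

lemma generated_by_half_tree_fixers: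
  assumes tits: "tits_independent adj G" and bip: "bipartition adj V0"
    and S: "S \<subseteq> G" "\<And>g h. g \<in> S \<Longrightarrow> h \<in> S \<Longrightarrow> g \<circ> h \<in> S" "\<And>g. g \<in> S \<Longrightarrow> finv g \<in> S"
    and half: "\<And>n. fixer G (Tp n) \<subseteq> S" "\<And>n. fixer G (Tm n) \<subseteq> S"
  shows "S = G"
proof -
  have edge: "fixer G {l n, l (n + 1)} \<subseteq> S" for n
  proof
    fix u assume "u \<in> fixer G {l n, l (n + 1)}"
    then obtain p q where "p \<in> fixer G (Tp n)" "q \<in> fixer G (Tm n)" "u = p \<circ> q"
      using tits adj_l[of n] unfolding tits_independent_def set_mult_def by auto
    then show "u \<in> S" using half[of n] S(2) by blast
  qed
  have up: "g \<in> S" if "g \<in> G" "g (l n) = l n" "g (l (n + 1)) = l (n + 1)" for g n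
    using edge[of n] that by (auto simp: fixer_def)
  have down: "g \<in> S" if "g \<in> G" "g (l n) = l n" "g (l (n - 1)) = l (n - 1)" for g n
    using edge[of "n - 1"] that by (auto simp: fixer_def)
  have move: "\<exists>g\<in>S. g (l n) = l n \<and> g (l (n + 1)) = y" if y: "adj (l n) y" for n y
  proof (cases "y = l (n - 1)")
    case False
    then obtain g where "g \<in> G" "g (l (n - 1)) = l (n - 1)" "g (l n) = l n" "g (l (n + 1)) = y"
      using locally_transitive_forward[OF y] by blast
    then show ?thesis using down by blast
  next
    case True
    \<comment> \<open>Folding the axis back onto itself takes two moves through a third neighbour:
      \<open>g\<close> sends \<open>l (n + 1)\<close> to \<open>y'\<close> and \<open>h\<close>
      sends \<open>l (n - 1)\<close> to \<open>y'\<close>.\<close>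
    obtain y' where y': "adj (l n) y'" "y' \<noteq> l (n - 1)" "y' \<noteq> l (n + 1)"
      using three_neighbours by blast
    obtain g where g: "g \<in> G" "g (l (n - 1)) = l (n - 1)" "g (l n) = l n" "g (l (n + 1)) = y'"
      using locally_transitive_forward[OF y'(1,2)] by blast
    obtain h where h: "h \<in> G" "h (l (n + 1)) = l (n + 1)" "h (l n) = l n" "h (l (n - 1)) = y'"
      using locally_transitive_backward[OF y'(1,3)] by blast
    have "g \<in> S" "h \<in> S" using down up g h by auto
    then have "finv h \<circ> g \<in> S" using S by blast
    then show ?thesis
      using g h True by (intro bexI[of _ "finv h \<circ> g"]) (auto simp: inv_eq_iff)
  qed
  have vertex: "g \<in> S" if g: "g \<in> G" "g (l n) = l n" for g n
  proof -
    have "adj (l n) (g (l (n + 1)))" using g adj_l[of n] by (metis G_adj)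
    then obtain s where s: "s \<in> S" "s (l n) = l n" "s (l (n + 1)) = g (l (n + 1))" using move by blast
    then have "s \<in> G" using S by blast
    then have "finv s \<circ> g \<in> S" using s g by (intro up[of _ n]) (auto simp: inv_eq_iff)
    then have "s \<circ> (finv s \<circ> g) \<in> S" using S s by blast
    moreover have "s \<circ> (finv s \<circ> g) = g" using \<open>s \<in> G\<close> by (auto simp: fun_eq_iff)
    ultimately show ?thesis by simp
  qed
  have idS: "id \<in> S" using vertex[of id] by simp
  have reach: "\<exists>s\<in>S. v = s (l 0) \<or> v = s (l 1)" for v
    using connected[of "l 0" v]
  proof (induction rule: rtranclp_induct)
    case base
    show ?case using idS by (intro bexI[of _ id]) auto
  next
    case (step p q)
    obtain s where s: "s \<in> S" "p = s (l 0) \<or> p = s (l 1)" using step by blast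
    then have sG: "s \<in> G" using S by blast
    let ?q = "finv s q"
    have "\<exists>k\<in>S. ?q = k (l 0) \<or> ?q = k (l 1)"
      using s(2)
    proof
      assume "p = s (l 0)"
      then have "adj (l 0) ?q" using step(2) sG by (metis G_adj inv_app(2))
      then show ?thesis using move[of 0 ?q] by (metis add_0)
    next
      assume "p = s (l 1)"
      then have q: "adj (l 1) ?q" using step(2) sG by (metis G_adj inv_app(2))
      \<comment> \<open>\<open>k\<close> reaches \<open>?q\<close> from \<open>l 2\<close>, which is
        not a base point; \<open>k'\<close> folds \<open>l 2\<close> onto
        \<open>l 0\<close>.\<close>
      obtain k where k: "k \<in> S" "k (l 1) = l 1" "k (l 2) = ?q" using move[OF q] by auto
      obtain k' where k': "k' \<in> S" "k' (l 1) = l 1" "k' (l 2) = l 0"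
        using move[of 1 "l 0"] adj_l'(1)[of 0] by auto
      have "k' \<in> G" using k' S by blast
      then have "finv k' (l 0) = l 2" using k' by (simp add: inv_eq_iff)
      then have "?q = (k \<circ> finv k') (l 0)" using k by simp
      moreover have "k \<circ> finv k' \<in> S" using S(2,3) k k' by blast
      ultimately show ?thesis by blast
    qed
    then obtain k where "k \<in> S" "?q = k (l 0) \<or> ?q = k (l 1)" by blast
    moreover from this have "q = (s \<circ> k) (l 0) \<or> q = (s \<circ> k) (l 1)"
      using inv_app(2)[OF sG, of q] by auto
    moreover have "s \<circ> k \<in> S" using S(2) s(1) calculation(1) by blast
    ultimately show ?case by blast
  qed
  have "g \<in> S" if g: "g \<in> G" for g
  proof -
    obtain s where s: "s \<in> S" "g (l 0) = s (l 0) \<or> g (l 0) = s (l 1)" using reach by blast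
    then have sG: "s \<in> G" using S by blast
    have parts: "k v \<in> V0 \<longleftrightarrow> v \<in> V0" if "k \<in> G" for k v
      using G_parts[OF that bip] inj_image_mem_iff[OF G_inj[OF that], of v V0] by simp
    \<comment> \<open>Elements of \<open>G\<close> preserve the bipartition, which excludes
      \<open>g (l 0) = s (l 1)\<close>.\<close>
    have "l 0 \<in> V0 \<longleftrightarrow> l 1 \<notin> V0" using bip adj_l[of 0] by (auto simp: bipartition_def)
    then have "g (l 0) = s (l 0)" using s(2) parts[OF g, of "l 0"] parts[OF sG, of "l 0"] parts[OF sG, of "l 1"] by auto
    then have "finv s \<circ> g \<in> S" using g sG by (intro vertex[of _ 0]) (auto simp: inv_eq_iff)
    then have "s \<circ> (finv s \<circ> g) \<in> S" using S s by blast
    moreover have "s \<circ> (finv s \<circ> g) = g" using sG by (auto simp: fun_eq_iff)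
    ultimately show ?thesis by simp
  qed
  then show ?thesis using S(1) by blast
qed

end

section \<open>Averaging over a countable measurable partition\<close>

text \<open>Since every block has positive measure, block-constant functions that agree almost
  everywhere agree everywhere. This lets \<open>L^2\<close> arguments yield statements about each
  point.\<close>

locale block_average = prob_space M for M :: "'a measure" +
  fixes q :: "'a \<Rightarrow> 'b"
  assumes q_meas: "q \<in> measurable M (count_space UNIV)"
    and countable_blocks: "countable (q ` space M)"
    and block_pos: "\<And>z. z \<in> space M \<Longrightarrow> measure M {y \<in> space M. q y = q z} > 0"
begin

definition "blocks = vimage_algebra (space M) q (count_space UNIV)"

definition avg :: "('a \<Rightarrow> real) \<Rightarrow> 'a \<Rightarrow> real" where
  "avg = real_cond_exp M blocks"

definition block :: "'a \<Rightarrow> 'a set" where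
  "block z = {y \<in> space M. q y = q z}"

definition block_const :: "('a \<Rightarrow> real) \<Rightarrow> bool" where
  "block_const f \<longleftrightarrow> (\<forall>y\<in>space M. \<forall>z\<in>space M. q y = q z \<longrightarrow> f y = f z)"

lemma sets_blocks: "sets blocks = {q -` B \<inter> space M |B. True}"
  unfolding blocks_def by (subst sets_vimage_algebra2) auto

lemma subalgebra_blocks: "subalgebra M blocks"
  unfolding subalgebra_def sets_blocks
  using measurable_sets[OF q_meas] by (auto simp: blocks_def)

sublocale finite_measure_subalgebra M blocks
  by unfold_locales (rule subalgebra_blocks)

lemma block_in: "block z \<in> sets blocks" "block z \<in> sets M"
proof -
  have "block z = q -` {q z} \<inter> space M" by (auto simp: block_def)
  then show "block z \<in> sets blocks" unfolding sets_blocks by blast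
  then show "block z \<in> sets M" using subalgebra_blocks by (auto simp: subalgebra_def)
qed

lemma block_const_measurable_blocks:
  assumes f: "block_const f"
  shows "f \<in> borel_measurable blocks"
proof (rule measurableI)
  fix B :: "real set"
  have "f -` B \<inter> space blocks = q -` (q ` (f -` B \<inter> space M)) \<inter> space M"
    using f by (auto simp: block_const_def blocks_def)
  then show "f -` B \<inter> space blocks \<in> sets blocks" unfolding sets_blocks by blast
qed simp

lemma block_const_measurable: "block_const f \<Longrightarrow> f \<in> borel_measurable M"
  using block_const_measurable_blocks measurable_from_subalg[OF subalgebra_blocks] by blast

lemma avg_measurable_blocks: "avg f \<in> borel_measurable blocks"
  by (simp add: avg_def borel_measurable_cond_exp)

lemma avg_measurable [measurable]: "avg f \<in> borel_measurable M"
  using avg_measurable_blocks measurable_from_subalg[OF subalgebra_blocks] by blast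

lemma block_const_avg: "block_const (avg f)"
  unfolding block_const_def
proof (intro ballI impI)
  fix y z assume *: "y \<in> space M" "z \<in> space M" "q y = q z"
  have "avg f -` {avg f z} \<inter> space blocks \<in> sets blocks"
    using measurable_sets[OF avg_measurable_blocks, of "{avg f z}"] by simp
  then obtain B where "avg f -` {avg f z} \<inter> space M = q -` B \<inter> space M"
    unfolding sets_blocks by (auto simp: blocks_def)
  then show "avg f y = avg f z" using * by blast
qed

lemma bounded_integrable:
  "f \<in> borel_measurable M \<Longrightarrow> (\<And>z. z \<in> space M \<Longrightarrow> \<bar>f z\<bar> \<le> C) \<Longrightarrow> integrable M (f :: 'a \<Rightarrow> real)"
  by (rule integrable_const_bound[of _ C]) auto

lemma integral_block_const:
  assumes f: "block_const f" and z: "z \<in> space M"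
  shows "(\<integral>y. indicator (block z) y * f y \<partial>M) = measure M (block z) * f z"
proof -
  have "indicator (block z) y * f y = indicator (block z) y * f z" for y
  proof (cases "y \<in> block z")
    case True
    then have "f y = f z" using f z unfolding block_const_def block_def by blast
    then show ?thesis by simp
  qed simp
  then have "(\<lambda>y. indicator (block z) y * f y) = (\<lambda>y. indicator (block z) y * f z)" by (rule ext)
  then show ?thesis using block_in(2)[of z] by (simp only:) simp
qed

text \<open>A conditional expectation is determined only up to null sets, but this one is constant
  on blocks of positive measure, so its values are forced at every point.\<close>

lemma avg_formula:
  assumes "integrable M f" "z \<in> space M"
  shows "avg f z = (\<integral>y. indicator (block z) y * f y \<partial>M) / measure M (block z)"
proof -
  have "(\<integral>y. indicator (block z) y * f y \<partial>M) = (\<integral>y. indicator (block z) y * avg f y \<partial>M)"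
    using real_cond_exp_intA[OF assms(1) block_in(1)[of z]]
    by (simp add: set_lebesgue_integral_def avg_def)
  also have "\<dots> = measure M (block z) * avg f z"
    by (rule integral_block_const[OF block_const_avg assms(2)])
  finally show ?thesis using block_pos[OF assms(2)] by (simp add: block_def)
qed

lemma avg_block_const:
  assumes "block_const f" "integrable M f" "z \<in> space M"
  shows "avg f z = f z"
proof -
  have "(\<integral>y. indicator (block z) y * f y \<partial>M) = measure M (block z) * f z"
    by (rule integral_block_const[OF assms(1,3)])
  then show ?thesis
    using block_pos[OF assms(3)] by (simp add: avg_formula[OF assms(2,3)] block_def)
qed

lemma integral_avg: "integrable M f \<Longrightarrow> (\<integral>y. avg f y \<partial>M) = (\<integral>y. f y \<partial>M)"
  unfolding avg_def by (rule real_cond_exp_int(2))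

lemma avg_cong:
  assumes "\<And>y. y \<in> space M \<Longrightarrow> f y = g y" "integrable M f" "z \<in> space M"
  shows "avg f z = avg g z"
proof -
  have "integrable M g"
    using assms(2) Bochner_Integration.integrable_cong[OF refl assms(1), of M] by simp
  moreover have "(\<integral>y. indicator (block z) y * f y \<partial>M) = (\<integral>y. indicator (block z) y * g y \<partial>M)"
    using assms(1) by (intro Bochner_Integration.integral_cong) auto
  ultimately show ?thesis using assms by (simp add: avg_formula)
qed

lemma avg_sum:
  assumes "\<And>i. i \<in> I \<Longrightarrow> integrable M (f i)" "z \<in> space M"
  shows "avg (\<lambda>y. (\<Sum>i\<in>I. f i y) / c) z = (\<Sum>i\<in>I. avg (f i) z) / c"
proof -
  have int: "integrable M (\<lambda>y. indicator (block z) y * f i y)" if "i \<in> I" for i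
    using integrable_mult_indicator[OF block_in(2) assms(1)[OF that], of z] by simp
  have "(\<integral>y. indicator (block z) y * ((\<Sum>i\<in>I. f i y) / c) \<partial>M)
      = (\<integral>y. (\<Sum>i\<in>I. indicator (block z) y * f i y) / c \<partial>M)"
    by (simp only: sum_distrib_left times_divide_eq_right)
  also have "\<dots> = (\<integral>y. (\<Sum>i\<in>I. indicator (block z) y * f i y) \<partial>M) / c"
    by (rule integral_divide_zero)
  also have "(\<integral>y. (\<Sum>i\<in>I. indicator (block z) y * f i y) \<partial>M) =
      (\<Sum>i\<in>I. \<integral>y. indicator (block z) y * f i y \<partial>M)"
    using int by (rule Bochner_Integration.integral_sum)
  finally have "(\<integral>y. indicator (block z) y * ((\<Sum>i\<in>I. f i y) / c) \<partial>M) =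
      (\<Sum>i\<in>I. \<integral>y. indicator (block z) y * f i y \<partial>M) / c" .
  moreover have "integrable M (\<lambda>y. (\<Sum>i\<in>I. f i y) / c)" using assms by auto
  ultimately have "avg (\<lambda>y. (\<Sum>i\<in>I. f i y) / c) z =
      (\<Sum>i\<in>I. \<integral>y. indicator (block z) y * f i y \<partial>M) / c / measure M (block z)"
    by (simp only: avg_formula[OF _ assms(2)])
  also have "\<dots> = (\<Sum>i\<in>I. (\<integral>y. indicator (block z) y * f i y \<partial>M) / measure M (block z)) / c"
    by (simp add: sum_divide_distrib[symmetric] mult.commute)
  also have "\<dots> = (\<Sum>i\<in>I. avg (f i) z) / c"
    using assms by (simp add: avg_formula)
  finally show ?thesis .
qed

text \<open>\<open>T\<close> preserves the measure and every block, hence every block integral. It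
  is applied to elements of \<open>U\<close>.\<close>

lemma avg_measure_preserving:
  assumes T: "T \<in> measurable M M" "distr M M T = M" "\<And>y. y \<in> space M \<Longrightarrow> q (T y) = q y"
    and f: "integrable M f" and z: "z \<in> space M"
  shows "avg (\<lambda>y. f (T y)) z = avg f z"
proof -
  have fT: "integrable M (\<lambda>y. f (T y))"
    using f T(1) integrable_distr[of T M M f] by (simp add: T(2))
  have "(\<integral>y. indicator (block z) y * f y \<partial>M) = (\<integral>y. indicator (block z) y * f y \<partial>distr M M T)"
    by (simp add: T(2))
  also have "\<dots> = (\<integral>y. indicator (block z) (T y) * f (T y) \<partial>M)"
    using T(1) f block_in(2)[of z] by (intro integral_distr) auto
  also have "\<dots> = (\<integral>y. indicator (block z) y * f (T y) \<partial>M)"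
    using T measurable_space[OF T(1)]
    by (intro Bochner_Integration.integral_cong) (auto simp: indicator_def block_def)
  finally show ?thesis by (simp add: avg_formula[OF f z] avg_formula[OF fT z])
qed

lemma avg_bounded:
  assumes f: "f \<in> borel_measurable M" "\<And>z. z \<in> space M \<Longrightarrow> \<bar>f z\<bar> \<le> C" and z: "z \<in> space M"
  shows "\<bar>avg f z\<bar> \<le> C"
proof -
  have int: "integrable M f" using bounded_integrable[OF f] .
  have "\<bar>\<integral>y. indicator (block z) y * f y \<partial>M\<bar> \<le> (\<integral>y. indicator (block z) y * C \<partial>M)"
  proof (rule order_trans[OF integral_abs_bound] integral_mono)+
    show "integrable M (\<lambda>y. \<bar>indicator (block z) y * f y\<bar>)"
      using integrable_mult_indicator[OF block_in(2) int, of z] by simp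
    show "integrable M (\<lambda>y. indicator (block z) y * C)"
      using integrable_mult_indicator[OF block_in(2), of "\<lambda>_. C" z] by simp
  qed (use f in \<open>auto simp: indicator_def\<close>)
  also have "\<dots> = measure M (block z) * C" using block_in(2)[of z] by simp
  finally show ?thesis
    using block_pos[OF z] by (simp add: avg_formula[OF int z] block_def abs_divide field_simps)
qed

lemma avg_tendsto:
  assumes f: "\<And>n. f n \<in> borel_measurable M" "\<And>n z. z \<in> space M \<Longrightarrow> \<bar>f n z\<bar> \<le> C"
    and lim: "\<And>z. z \<in> space M \<Longrightarrow> (\<lambda>n. f n z) \<longlonglongrightarrow> g z" and z: "z \<in> space M"
  shows "(\<lambda>n. avg (f n) z) \<longlonglongrightarrow> avg g z"
proof -
  have g: "g \<in> borel_measurable M" using f(1) lim by (rule borel_measurable_LIMSEQ_real[rotated])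
  have bg: "\<bar>g y\<bar> \<le> C" if "y \<in> space M" for y
    using tendsto_rabs[OF lim[OF that]] f(2)[OF that] by (intro LIMSEQ_le_const2) auto
  have "(\<lambda>n. \<integral>y. indicator (block z) y * f n y \<partial>M) \<longlonglongrightarrow> (\<integral>y. indicator (block z) y * g y \<partial>M)"
  proof (rule integral_dominated_convergence[where w = "\<lambda>_. \<bar>C\<bar>"])
    show "(\<lambda>y. indicator (block z) y * g y) \<in> borel_measurable M"
      "\<And>n. (\<lambda>y. indicator (block z) y * f n y) \<in> borel_measurable M"
      using f(1) g block_in(2)[of z] by measurable
    show "AE x in M. (\<lambda>n. indicator (block z) x * f n x) \<longlonglongrightarrow> indicator (block z) x * g x"
      using lim by (auto intro!: AE_I2 tendsto_mult)
    show "\<And>n. AE x in M. norm (indicator (block z) x * f n x) \<le> \<bar>C\<bar>"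
      using f(2) by (auto intro!: AE_I2 simp: indicator_def intro: order_trans[OF _ abs_ge_self])
  qed simp
  then show ?thesis
    using block_pos[OF z] bounded_integrable[OF f] bounded_integrable[OF g bg]
    by (simp add: avg_formula z block_def tendsto_divide)
qed

text \<open>Pythagoras: conditional expectation is the orthogonal projection onto the block-constant
  functions.\<close>

lemma avg_energy:
  assumes f: "f \<in> borel_measurable M" "\<And>z. z \<in> space M \<Longrightarrow> \<bar>f z\<bar> \<le> C"
  shows "(\<integral>y. (f y - avg f y)\<^sup>2 \<partial>M) = (\<integral>y. (f y)\<^sup>2 \<partial>M) - (\<integral>y. (avg f y)\<^sup>2 \<partial>M)"
proof -
  note b = avg_bounded[OF f]
  have prod: "integrable M (\<lambda>y. u y * v y)"
    if "u \<in> borel_measurable M" "v \<in> borel_measurable M" "\<And>z. z \<in> space M \<Longrightarrow> \<bar>u z\<bar> \<le> C"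
      "\<And>z. z \<in> space M \<Longrightarrow> \<bar>v z\<bar> \<le> C" for u v :: "'a \<Rightarrow> real"
  proof (rule bounded_integrable[where C = "C * C"])
    fix z assume "z \<in> space M"
    then show "\<bar>u z * v z\<bar> \<le> C * C"
      unfolding abs_mult using that(3,4) by (intro mult_mono) (auto intro: order_trans[OF abs_ge_zero])
  qed (use that in simp)
  have i: "integrable M (\<lambda>y. f y * f y)" "integrable M (\<lambda>y. avg f y * f y)"
    "integrable M (\<lambda>y. avg f y * avg f y)"
    using prod f b by auto
  have cross: "(\<integral>y. avg f y * avg f y \<partial>M) = (\<integral>y. avg f y * f y \<partial>M)"
    unfolding avg_def
    using real_cond_exp_intg(2)[of "avg f" f] i(2) f(1) avg_measurable_blocks by (simp add: avg_def)
  have "(\<integral>y. (f y - avg f y)\<^sup>2 \<partial>M)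
      = (\<integral>y. f y * f y - 2 * (avg f y * f y) + avg f y * avg f y \<partial>M)"
    by (intro Bochner_Integration.integral_cong) (auto simp: power2_eq_square algebra_simps)
  also have "\<dots> = (\<integral>y. f y * f y \<partial>M) - 2 * (\<integral>y. avg f y * f y \<partial>M) + (\<integral>y. avg f y * avg f y \<partial>M)"
    using i by simp
  finally show ?thesis using cross by (simp add: power2_eq_square)
qed

lemma integral_tendsto:
  fixes f :: "nat \<Rightarrow> 'a \<Rightarrow> real"
  assumes f: "\<And>n. f n \<in> borel_measurable M" "\<And>n z. z \<in> space M \<Longrightarrow> \<bar>f n z\<bar> \<le> C"
    and lim: "\<And>z. z \<in> space M \<Longrightarrow> (\<lambda>n. f n z) \<longlonglongrightarrow> g z"
  shows "(\<lambda>n. \<integral>y. f n y \<partial>M) \<longlonglongrightarrow> (\<integral>y. g y \<partial>M)"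
proof (rule integral_dominated_convergence[where w = "\<lambda>_. C"])
  show "g \<in> borel_measurable M" using f(1) lim by (rule borel_measurable_LIMSEQ_real[rotated])
qed (use f lim in auto)

text \<open>
  The averages are the iterates of a Markov operator on the countable set of blocks. Its
  \<open>L\<^sup>2\<close>-norms decrease to a limit, so along every subsequential limit the averaging step preserves
  the norm and hence is trivial.
\<close>

theorem iterated_averages_converge:
  assumes T: "T \<in> measurable M M" "distr M M T = M"
    and Tpos: "\<And>z. z \<in> space M \<Longrightarrow> measure M {y \<in> space M. q y = q z \<and> q (T y) = q (T z)} > 0"
    and ergodic: "\<And>h :: int \<Rightarrow> 'a \<Rightarrow> real. (\<And>j. block_const (h j)) \<Longrightarrow>
      (\<And>j z. z \<in> space M \<Longrightarrow> h (j + 1) z = h j (T z)) \<Longrightarrow>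
      \<forall>y\<in>space M. \<forall>z\<in>space M. h 0 y = h 0 z"
    and F: "\<And>i. block_const (F i)" "\<And>i z. z \<in> space M \<Longrightarrow> \<bar>F i z\<bar> \<le> C"
      "\<And>i z. z \<in> space M \<Longrightarrow> F (Suc i) z = avg (\<lambda>y. F i (T y)) z"
    and z: "z \<in> space M"
  shows "(\<lambda>i. F i z) \<longlonglongrightarrow> (\<integral>y. F 0 y \<partial>M)"
proof (rule ccontr)
  assume not_lim: "\<not> ?thesis"
  have Tsp: "T y \<in> space M" if "y \<in> space M" for y using measurable_space[OF T(1) that] .
  have F_meas [measurable]: "F i \<in> borel_measurable M" for i
    using F(1) by (rule block_const_measurable)
  have FT_meas: "(\<lambda>y. F i (T y)) \<in> borel_measurable M" for i using T(1) by measurable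
  have preserve: "(\<integral>y. f (T y) \<partial>M) = (\<integral>y. f y \<partial>M)" if "f \<in> borel_measurable M" for f :: "'a \<Rightarrow> real"
    using integral_distr[OF T(1) that] by (simp add: T(2))
  have int_F: "(\<integral>y. F i y \<partial>M) = (\<integral>y. F 0 y \<partial>M)" for i
  proof (induction i)
    case (Suc i)
    have "(\<integral>y. F (Suc i) y \<partial>M) = (\<integral>y. avg (\<lambda>y. F i (T y)) y \<partial>M)"
      using F(3) by (intro Bochner_Integration.integral_cong) auto
    also have "\<dots> = (\<integral>y. F i (T y) \<partial>M)"
      unfolding avg_def using bounded_integrable[OF FT_meas F(2)[OF Tsp]]
      by (intro real_cond_exp_int(2))
    finally show ?case using Suc preserve[OF F_meas] by simp
  qed simp
  define E where "E i = (\<integral>y. (F i y)\<^sup>2 \<partial>M)" for i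
  have E_step: "E (Suc i) \<le> E i" for i
  proof -
    have "E (Suc i) = (\<integral>y. (avg (\<lambda>y. F i (T y)) y)\<^sup>2 \<partial>M)"
      unfolding E_def using F(3) by (intro Bochner_Integration.integral_cong) auto
    also have "\<dots> \<le> (\<integral>y. (F i (T y))\<^sup>2 \<partial>M)"
      using avg_energy[OF FT_meas F(2)[OF Tsp]]
        Bochner_Integration.integral_nonneg[of M "\<lambda>y. (F i (T y) - avg (\<lambda>y. F i (T y)) y)\<^sup>2"] by simp
    finally show ?thesis using preserve[of "\<lambda>y. (F i y)\<^sup>2"] by (simp add: E_def)
  qed
  obtain L where L: "E \<longlonglongrightarrow> L"
    using decseq_convergent[of E 0] decseq_SucI[of E] E_step
    by (metis E_def Bochner_Integration.integral_nonneg zero_le_power2)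
  obtain e where e: "e > 0" "\<not> (\<forall>\<^sub>F i in sequentially. dist (F i z) (\<integral>y. F 0 y \<partial>M) < e)"
    using not_lim by (auto simp: tendsto_iff)
  have "infinite {i. \<not> dist (F i z) (\<integral>y. F 0 y \<partial>M) < e}"
    using e(2) by (simp add: eventually_sequentially infinite_nat_iff_unbounded_le)
  from infinite_enumerate[OF this] obtain s where s: "strict_mono (s :: nat \<Rightarrow> nat)"
    "\<And>n. \<not> dist (F (s n) z) (\<integral>y. F 0 y \<partial>M) < e"
    by auto
  \<comment> \<open>One point per block: block-constant functions are determined on a countable set,
    where a diagonal subsequence exists.\<close>
  define rep where "rep b = (SOME y. y \<in> space M \<and> q y = b)" for b
  have rep: "rep (q y) \<in> space M" "q (rep (q y)) = q y" if "y \<in> space M" for y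
    using someI[of "\<lambda>x. x \<in> space M \<and> q x = q y" y] that by (auto simp: rep_def)
  have F_rep: "F i (rep (q y)) = F i y" if "y \<in> space M" for i y
    using F(1)[of i] rep[OF that] that unfolding block_const_def by blast
  have "countable ((UNIV :: int set) \<times> q ` space M)" using countable_blocks by simp
  \<comment> \<open>All integer shifts are included, so that the limits form a two-sided sequence
    \<open>h j\<close>. For negative shifts \<open>nat\<close> truncates only finitely many
    terms.\<close>
  then obtain k where k: "strict_mono (k :: nat \<Rightarrow> nat)"
    "\<And>p. p \<in> (UNIV :: int set) \<times> q ` space M \<Longrightarrow>
      \<exists>l. (\<lambda>n. F (nat (int (s (k n)) + fst p)) (rep (snd p))) \<longlonglongrightarrow> l"
  proof (rule function_convergent_subsequence[where M = C and
      f = "\<lambda>n p. F (nat (int (s n) + fst p)) (rep (snd p))"])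
    show "norm (F (nat (int (s n) + fst p)) (rep (snd p))) \<le> C"
      if "p \<in> (UNIV :: int set) \<times> q ` space M" for n and p :: "int \<times> 'b"
      using that rep(1) F(2) by (cases p) auto
  next
    fix k assume "strict_mono (k :: nat \<Rightarrow> nat)"
      "\<And>p. p \<in> (UNIV :: int set) \<times> q ` space M \<Longrightarrow>
        \<exists>l. (\<lambda>n. F (nat (int (s (k n)) + fst p)) (rep (snd p))) \<longlonglongrightarrow> l"
    then show thesis by (rule that)
  qed
  define r where "r = s \<circ> k"
  have r: "strict_mono r" using s(1) k(1) by (simp add: r_def strict_mono_o)
  have r_ge: "n \<le> r n" for n using r by (rule strict_mono_imp_increasing)
  define h where "h j y = lim (\<lambda>n. F (nat (int (r n) + j)) y)" for j y
  have h: "(\<lambda>n. F (nat (int (r n) + j)) y) \<longlonglongrightarrow> h j y" if "y \<in> space M" for j y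
  proof -
    have "convergent (\<lambda>n. F (nat (int (r n) + j)) y)"
      using k(2)[of "(j, q y)"] that by (simp add: F_rep r_def convergent_def)
    then show ?thesis unfolding h_def by (rule iffD1[OF convergent_LIMSEQ_iff])
  qed
  have h_const: "block_const (h j)" for j
    unfolding block_const_def h_def
  proof (intro ballI impI)
    fix y y' assume "y \<in> space M" "y' \<in> space M" "q y = q y'"
    then have "F i y = F i y'" for i using F(1)[of i] unfolding block_const_def by blast
    then show "lim (\<lambda>n. F (nat (int (r n) + j)) y) = lim (\<lambda>n. F (nat (int (r n) + j)) y')" by simp
  qed
  note h_meas [measurable] = block_const_measurable[OF h_const]
  have h_bound: "\<bar>h j y\<bar> \<le> C" if "y \<in> space M" for j y
    using F(2)[OF that] by (intro LIMSEQ_le_const2[OF tendsto_rabs[OF h[OF that]]]) auto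
  have index: "filterlim (\<lambda>n. nat (int (r n) + j)) sequentially sequentially" for j
    unfolding filterlim_at_top eventually_sequentially
  proof (intro allI exI impI)
    fix Z n assume "nat (int Z - j) \<le> n"
    then show "Z \<le> nat (int (r n) + j)" using r_ge[of n] by simp
  qed
  have h_avg: "h (j + 1) y = avg (\<lambda>y. h j (T y)) y" if y: "y \<in> space M" for j y
  proof -
    have "(\<lambda>n. avg (\<lambda>y. F (nat (int (r n) + j)) (T y)) y) \<longlonglongrightarrow> avg (\<lambda>y. h j (T y)) y"
      using FT_meas F(2)[OF Tsp] h[OF Tsp] y by (rule avg_tendsto)
    moreover have "\<forall>\<^sub>F n in sequentially.
        avg (\<lambda>y. F (nat (int (r n) + j)) (T y)) y = F (nat (int (r n) + (j + 1))) y"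
      unfolding eventually_sequentially
    proof (intro exI allI impI)
      fix n assume "nat (- j) \<le> n"
      then have "nat (int (r n) + (j + 1)) = Suc (nat (int (r n) + j))" using r_ge[of n] by simp
      then show "avg (\<lambda>y. F (nat (int (r n) + j)) (T y)) y = F (nat (int (r n) + (j + 1))) y"
        by (simp only: F(3)[OF y])
    qed
    ultimately have "(\<lambda>n. F (nat (int (r n) + (j + 1))) y) \<longlonglongrightarrow> avg (\<lambda>y. h j (T y)) y"
      by (rule Lim_transform_eventually)
    then show ?thesis using h[OF y] LIMSEQ_unique by blast
  qed
  have h_energy: "(\<integral>y. (h j y)\<^sup>2 \<partial>M) = L" for j
  proof -
    have "(\<lambda>n. \<integral>y. (F (nat (int (r n) + j)) y)\<^sup>2 \<partial>M) \<longlonglongrightarrow> (\<integral>y. (h j y)\<^sup>2 \<partial>M)"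
    proof (rule integral_tendsto[where C = "C\<^sup>2"])
      show "\<bar>(F (nat (int (r n) + j)) y)\<^sup>2\<bar> \<le> C\<^sup>2" if "y \<in> space M" for n y
        using power_mono[OF F(2)[OF that] abs_ge_zero, of _ 2] by simp
      show "(\<lambda>n. (F (nat (int (r n) + j)) y)\<^sup>2) \<longlonglongrightarrow> (h j y)\<^sup>2" if "y \<in> space M" for y
        using h[OF that] by (rule tendsto_power)
    qed measurable
    moreover have "(\<lambda>n. \<integral>y. (F (nat (int (r n) + j)) y)\<^sup>2 \<partial>M) \<longlonglongrightarrow> L"
      using filterlim_compose[OF L index[of j]] by (simp add: E_def)
    ultimately show ?thesis by (rule LIMSEQ_unique)
  qed
  have h_shift: "h (j + 1) y = h j (T y)" if y: "y \<in> space M" for j y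
  proof -
    let ?g = "\<lambda>y. h j (T y)"
    have g_meas [measurable]: "?g \<in> borel_measurable M" using T(1) by measurable
    have g_bound: "\<bar>?g y\<bar> \<le> C" if "y \<in> space M" for y using h_bound Tsp that by simp
    \<comment> \<open>The norms of \<open>h j\<close> and \<open>h (j + 1)\<close> are both
      \<open>L\<close>, so averaging loses no norm and \<open>avg_energy\<close> makes
      \<open>?g - avg ?g\<close> vanish almost everywhere.\<close>
    have "(\<integral>y. (avg ?g y)\<^sup>2 \<partial>M) = (\<integral>y. (h (j + 1) y)\<^sup>2 \<partial>M)"
      using h_avg by (intro Bochner_Integration.integral_cong) auto
    then have "(\<integral>y. (?g y - avg ?g y)\<^sup>2 \<partial>M) = 0"
      using avg_energy[OF g_meas g_bound] preserve[of "\<lambda>y. (h j y)\<^sup>2"] h_energy by simp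
    moreover have "integrable M (\<lambda>y. (?g y - avg ?g y)\<^sup>2)"
    proof (rule bounded_integrable[where C = "(2 * C)\<^sup>2"])
      fix y assume "y \<in> space M"
      then have "\<bar>?g y - avg ?g y\<bar> \<le> 2 * C"
        using g_bound avg_bounded[OF g_meas g_bound] by (smt (verit))
      then show "\<bar>(?g y - avg ?g y)\<^sup>2\<bar> \<le> (2 * C)\<^sup>2"
        using power_mono[OF _ abs_ge_zero, of "?g y - avg ?g y" "2 * C" 2] by simp
    qed measurable
    ultimately have ae: "AE y in M. ?g y = avg ?g y"
      using Bochner_Integration.integral_nonneg_eq_0_iff_AE[of M "\<lambda>y. (?g y - avg ?g y)\<^sup>2"] by simp
    \<comment> \<open>From almost everywhere to everywhere: \<open>?g\<close> depends on the block
      of the image under \<open>T\<close>, so both sides are constant on \<open>?B\<close>, which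
      has positive measure by \<open>Tpos\<close>.\<close>
    let ?B = "{x \<in> space M. q x = q y \<and> q (T x) = q (T y)}"
    have "\<exists>x\<in>?B. ?g x = avg ?g x"
    proof (rule ccontr)
      assume "\<not> ?thesis"
      then have "?B \<subseteq> {x \<in> space M. \<not> ?g x = avg ?g x}" by blast
      then have "measure M ?B \<le> measure M {x \<in> space M. \<not> ?g x = avg ?g x}"
        by (intro finite_measure_mono) measurable
      moreover have "emeasure M {x \<in> space M. \<not> ?g x = avg ?g x} = 0"
        using ae by (subst (asm) AE_iff_measurable[OF _ refl]) auto
      ultimately show False using Tpos[OF y] by (simp add: measure_def)
    qed
    then obtain x where x: "x \<in> space M" "q x = q y" "q (T x) = q (T y)" "?g x = avg ?g x" by blast
    have "?g x = ?g y" using h_const[of j] x(1,3) y Tsp unfolding block_const_def by blast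
    moreover have "avg ?g x = avg ?g y" using block_const_avg[of ?g] x(1,2) y unfolding block_const_def by blast
    ultimately show ?thesis using x(4) h_avg[OF y] by simp
  qed
  have const: "\<forall>y\<in>space M. \<forall>y'\<in>space M. h 0 y = h 0 y'"
    by (rule ergodic[of h]) (rule h_const, rule h_shift)
  have "(\<lambda>n. \<integral>y. F (nat (int (r n) + 0)) y \<partial>M) \<longlonglongrightarrow> (\<integral>y. h 0 y \<partial>M)"
    by (rule integral_tendsto[OF F_meas F(2) h])
  moreover have "(\<lambda>n. \<integral>y. F (nat (int (r n) + 0)) y \<partial>M) = (\<lambda>_. \<integral>y. F 0 y \<partial>M)"
    by (rule ext, rule int_F)
  ultimately have "(\<integral>y. h 0 y \<partial>M) = (\<integral>y. F 0 y \<partial>M)"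
    using LIMSEQ_unique[OF _ tendsto_const] by metis
  moreover have "(\<integral>y. h 0 y \<partial>M) = (\<integral>y. h 0 z \<partial>M)"
    by (intro Bochner_Integration.integral_cong[OF refl]) (use const z in blast)
  ultimately have "h 0 z = (\<integral>y. F 0 y \<partial>M)" by (simp add: prob_space)
  then have "(\<lambda>n. F (r n) z) \<longlonglongrightarrow> (\<integral>y. F 0 y \<partial>M)" using h[OF z, of 0] by simp
  then have "\<forall>\<^sub>F n in sequentially. dist (F (r n) z) (\<integral>y. F 0 y \<partial>M) < e"
    using e(1) by (simp add: tendsto_iff)
  then show False using s(2) by (auto simp: eventually_sequentially r_def)
qed

end

section \<open>The coset space\<close>

definition act :: "('v \<Rightarrow> 'v) \<Rightarrow> ('v \<Rightarrow> 'v) set \<Rightarrow> ('v \<Rightarrow> 'v) set" where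
  "act g C = (\<lambda>h. g \<circ> h) ` C"

lemma l_coset_eq_act: "g <#\<^bsub>tree_aut adj\<^esub> C = act g C"
  by (auto simp: l_coset_def act_def)

lemma act_comp: "act (g \<circ> h) C = act g (act h C)"
  by (auto simp: act_def image_image comp_assoc)

lemma act_id [simp]: "act id C = C"
  by (simp add: act_def)

text \<open>If \<open>f\<close> depends on its argument only through \<open>R\<close>, its image is
  no larger than that of \<open>R\<close>. In use, \<open>R\<close> restricts a group element or its
  inverse to a finite vertex set.\<close>

lemma image_factor:
  assumes "\<And>x y. x \<in> A \<Longrightarrow> y \<in> A \<Longrightarrow> R x = R y \<Longrightarrow> f x = f y"
  shows "f ` A = (\<lambda>z. f (inv_into A R z)) ` R ` A"
proof -
  have "f x = f (inv_into A R (R x))" if "x \<in> A" for x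
    using that by (intro assms) (auto intro: inv_into_into simp: f_inv_into_f)
  then show ?thesis by (force simp: image_image)
qed

lemma measurable_of_openin_vimage:
  assumes "sets \<mu> = sets (sigma (topspace \<tau>) {U. openin \<tau> U})"
    and "\<And>B. openin \<tau> {x \<in> topspace \<tau>. f x \<in> B}"
  shows "f \<in> measurable \<mu> (count_space UNIV)"
proof (rule measurableI)
  have sub: "{U. openin \<tau> U} \<subseteq> Pow (topspace \<tau>)" by (auto dest: openin_subset)
  have sp: "space \<mu> = topspace \<tau>"
    using sets_eq_imp_space_eq[OF assms(1)] sub by simp
  fix B
  have "f -` B \<inter> space \<mu> = {x \<in> topspace \<tau>. f x \<in> B}" using sp by auto
  then show "f -` B \<inter> space \<mu> \<in> sets \<mu>"
    using assms sub by (simp add: sigma_sets.Basic)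
qed simp

lemma borel_measurable_continuous_map:
  fixes f :: "'a \<Rightarrow> 'b::topological_space"
  assumes "sets \<mu> = sets (sigma (topspace \<tau>) {U. openin \<tau> U})"
    and f: "continuous_map \<tau> euclidean f"
  shows "f \<in> borel_measurable \<mu>"
proof (rule borel_measurableI)
  have sub: "{U. openin \<tau> U} \<subseteq> Pow (topspace \<tau>)" by (auto dest: openin_subset)
  have sp: "space \<mu> = topspace \<tau>"
    using sets_eq_imp_space_eq[OF assms(1)] sub by simp
  fix S :: "'b set" assume "open S"
  then have "openin \<tau> {x \<in> topspace \<tau>. f x \<in> S}"
    using f by (simp add: continuous_map_def)
  moreover have "f -` S \<inter> space \<mu> = {x \<in> topspace \<tau>. f x \<in> S}" using sp by auto
  ultimately show "f -` S \<inter> space \<mu> \<in> sets \<mu>"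
    using assms(1) sub by (simp add: sigma_sets.Basic)
qed

locale coset_action = tree_group adj G for adj :: "'v \<Rightarrow> 'v \<Rightarrow> bool" and G +
  fixes \<Gamma> :: "('v \<Rightarrow> 'v) set"
  assumes finite_neighbours: "\<And>x. finite {y. adj x y}"
begin

abbreviation "X \<equiv> coset_space adj G \<Gamma>"
abbreviation "TG \<equiv> subtopology (aut_topology adj) G"

lemma act_inv [simp]:
  "g \<in> G \<Longrightarrow> act (finv g) (act g C) = C" "g \<in> G \<Longrightarrow> act g (act (finv g) C) = C"
  using act_comp[of "finv g" g C] act_comp[of g "finv g" C] by simp_all

lemma fixer_comp: "g \<in> fixer G D \<Longrightarrow> h \<in> fixer G D \<Longrightarrow> g \<circ> h \<in> fixer G D"
  by (auto simp: fixer_def)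

lemma fixer_inv: "g \<in> fixer G D \<Longrightarrow> finv g \<in> fixer G D"
  by (auto simp: fixer_def inv_eq_iff)

lemma fixer_id: "id \<in> fixer G D"
  by (auto simp: fixer_def)

lemma fixer_conj: "k \<in> G \<Longrightarrow> g \<in> fixer G D \<Longrightarrow> k \<circ> g \<circ> finv k \<in> fixer G (k ` D)"
  by (auto simp: fixer_def)

lemma topspace_TG: "topspace TG = G"
  using G_sub by (auto simp: aut_topology_def)

lemma topspace_X: "topspace X = (\<lambda>g. act g \<Gamma>) ` G"
  by (simp add: coset_space_def l_coset_eq_act topspace_TG del: topspace_subtopology)

lemma openin_X:
  "openin X U \<longleftrightarrow> U \<subseteq> topspace X \<and> openin TG {g \<in> G. act g \<Gamma> \<in> U}"
  unfolding topspace_X by (simp only: coset_space_def openin_quotient_topology topspace_TG l_coset_eq_act)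

lemma act_X [simp]: "g \<in> G \<Longrightarrow> act g C \<in> topspace X \<longleftrightarrow> C \<in> topspace X"
proof
  have into: "act h D \<in> topspace X" if "h \<in> G" "D \<in> topspace X" for h D
    using that unfolding topspace_X by (auto simp: act_comp[symmetric])
  assume g: "g \<in> G"
  show "act g C \<in> topspace X" if "C \<in> topspace X" using into g that by blast
  show "C \<in> topspace X" if "act g C \<in> topspace X"
    using into[of "finv g" "act g C"] g that by auto
qed

lemma act_transitive:
  assumes "C \<in> topspace X" "D \<in> topspace X"
  obtains g where "g \<in> G" "D = act g C"
proof -
  obtain h k where "h \<in> G" "k \<in> G" "C = act h \<Gamma>" "D = act k \<Gamma>"
    using assms unfolding topspace_X by blast
  then have "D = act (k \<circ> finv h) C" by (simp add: act_comp)
  then show thesis using that \<open>h \<in> G\<close> \<open>k \<in> G\<close> by blast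
qed

lemma openin_TG:
  "openin TG S \<longleftrightarrow> S \<subseteq> G \<and>
    (\<forall>g\<in>S. \<exists>E. finite E \<and> {h \<in> G. \<forall>v\<in>E. h v = g v} \<subseteq> S)"
    (is "_ \<longleftrightarrow> ?R")
proof -
  let ?P = "product_topology (\<lambda>_::'v. discrete_topology (UNIV :: 'v set)) UNIV"
  have TG: "TG = subtopology ?P G"
    using G_sub by (simp add: aut_topology_def subtopology_subtopology Int_absorb1 subsetI)
  have basic: "openin ?P {h. \<forall>v\<in>E. h v = g v}" if "finite E" for E and g :: "'v \<Rightarrow> 'v"
    unfolding openin_product_topology_alt
  proof (intro ballI)
    fix k assume "k \<in> {h. \<forall>v\<in>E. h v = g v}"
    then show "\<exists>U. finite {i \<in> UNIV. U i \<noteq> topspace (discrete_topology UNIV)} \<and>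
        (\<forall>i\<in>UNIV. openin (discrete_topology UNIV) (U i)) \<and> k \<in> Pi\<^sub>E UNIV U \<and>
        Pi\<^sub>E UNIV U \<subseteq> {h. \<forall>v\<in>E. h v = g v}"
      using that by (intro exI[of _ "\<lambda>v. if v \<in> E then {g v} else UNIV"])
        (auto simp: PiE_def Pi_def split: if_splits elim: rev_finite_subset)
  qed
  show ?thesis
  proof
    assume "openin TG S"
    then obtain T where T: "openin ?P T" "S = T \<inter> G" by (auto simp: TG openin_subtopology)
    have "\<exists>E. finite E \<and> {h \<in> G. \<forall>v\<in>E. h v = g v} \<subseteq> S" if g: "g \<in> S" for g
    proof -
      obtain U where U: "finite {i. U i \<noteq> (UNIV :: 'v set)}" "g \<in> Pi\<^sub>E UNIV U" "Pi\<^sub>E UNIV U \<subseteq> T"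
        using bspec[OF T(1)[unfolded openin_product_topology_alt], of g] g T(2) by auto
      have "h \<in> Pi\<^sub>E UNIV U" if "\<forall>v\<in>{i. U i \<noteq> UNIV}. h v = g v" for h
        using that U(2) by (auto simp: PiE_def Pi_def) (metis UNIV_I)
      then have "{h \<in> G. \<forall>v\<in>{i. U i \<noteq> UNIV}. h v = g v} \<subseteq> S" using U(3) T(2) by blast
      then show ?thesis using U(1) by blast
    qed
    then show ?R using T by blast
  next
    assume R: ?R
    show "openin TG S"
    proof (subst openin_subopen, intro ballI)
      fix g assume g: "g \<in> S"
      then obtain E where E: "finite E" "{h \<in> G. \<forall>v\<in>E. h v = g v} \<subseteq> S" using R by blast
      have "openin TG ({h. \<forall>v\<in>E. h v = g v} \<inter> G)"
        unfolding TG using basic[OF E(1)] by (auto simp: openin_subtopology)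
      then show "\<exists>T. openin TG T \<and> g \<in> T \<and> T \<subseteq> S"
        using E g R by (intro exI[of _ "{h. \<forall>v\<in>E. h v = g v} \<inter> G"]) auto
    qed
  qed
qed

lemma openin_X_invariant:
  assumes W: "W \<subseteq> topspace X" and D: "finite D"
    and inv: "\<And>v C. v \<in> fixer G D \<Longrightarrow> C \<in> W \<Longrightarrow> act v C \<in> W"
  shows "openin X W"
  unfolding openin_X openin_TG
proof (intro conjI ballI W)
  fix g assume g: "g \<in> {g \<in> G. act g \<Gamma> \<in> W}"
  \<comment> \<open>Agreeing with \<open>g\<close> on the preimage of \<open>D\<close> under
    \<open>g\<close> means that \<open>h \<circ> finv g\<close> fixes \<open>D\<close>.\<close>
  show "\<exists>E. finite E \<and> {h \<in> G. \<forall>v\<in>E. h v = g v} \<subseteq> {g \<in> G. act g \<Gamma> \<in> W}"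
  proof (intro exI[of _ "finv g ` D"] conjI subsetI CollectI)
    fix h assume h: "h \<in> {h \<in> G. \<forall>v\<in>finv g ` D. h v = g v}"
    then show "h \<in> G" by simp
    have "h \<circ> finv g \<in> fixer G D" using g h by (auto simp: fixer_def)
    then have "act (h \<circ> finv g) (act g \<Gamma>) \<in> W" using inv g by blast
    then show "act h \<Gamma> \<in> W" using g by (simp add: act_comp)
  qed (use D in simp)
qed auto

lemma openin_X_nbhd:
  assumes "openin X W" "C \<in> W"
  obtains D where "finite D" "\<And>v. v \<in> fixer G D \<Longrightarrow> act v C \<in> W"
proof -
  obtain g where g: "g \<in> G" "C = act g \<Gamma>" using assms openin_subset topspace_X by blast
  obtain E where E: "finite E" "{h \<in> G. \<forall>v\<in>E. h v = g v} \<subseteq> {g \<in> G. act g \<Gamma> \<in> W}"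
    using assms g unfolding openin_X openin_TG by blast
  have "act v C \<in> W" if "v \<in> fixer G (g ` E)" for v
  proof -
    have "v \<circ> g \<in> {h \<in> G. \<forall>v\<in>E. h v = g v}" using that g by (auto simp: fixer_def)
    then show ?thesis using E(2) g(2) by (auto simp: act_comp)
  qed
  then show thesis using that[of "g ` E"] E(1) by blast
qed

lemma openin_X_act:
  assumes "openin X W" "g \<in> G"
  shows "openin X {C \<in> topspace X. act g C \<in> W}"
proof (subst openin_subopen, intro ballI)
  fix C assume C: "C \<in> {C \<in> topspace X. act g C \<in> W}"
  then obtain D where D: "finite D" "\<And>v. v \<in> fixer G D \<Longrightarrow> act v (act g C) \<in> W"
    using openin_X_nbhd[OF assms(1)] by blast
  let ?D = "finv g ` D"
  let ?T = "{act v C |v. v \<in> fixer G ?D}"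
  have sub: "?T \<subseteq> topspace X" using C by (auto simp: fixer_def)
  have "openin X ?T"
  proof (rule openin_X_invariant[where D = ?D])
    fix v C' assume "v \<in> fixer G ?D" "C' \<in> ?T"
    then show "act v C' \<in> ?T" using fixer_comp by (auto simp: act_comp[symmetric])
  qed (use D sub in auto)
  moreover have "C \<in> ?T" using fixer_id[of ?D] by (force intro: exI[of _ id])
  moreover have "?T \<subseteq> {C \<in> topspace X. act g C \<in> W}"
  proof
    fix C' assume C': "C' \<in> ?T"
    then obtain v where v: "v \<in> fixer G ?D" "C' = act v C" by blast
    have "g \<circ> v \<circ> finv g \<in> fixer G (g ` ?D)" using fixer_conj[OF assms(2) v(1)] .
    moreover have "g ` ?D = D" using assms(2) by (auto simp: image_image)
    ultimately have "act (g \<circ> v \<circ> finv g) (act g C) \<in> W" using D(2) by simp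
    then show "C' \<in> {C \<in> topspace X. act g C \<in> W}"
      using C' sub v assms(2) by (auto simp: act_comp)
  qed
  ultimately show "\<exists>T. openin X T \<and> C \<in> T \<and> T \<subseteq> {C \<in> topspace X. act g C \<in> W}" by blast
qed

section \<open>Functions invariant under an open subgroup\<close>

text \<open>Uniform local constancy, as for smooth vectors of totally disconnected groups.
  Invariance is asked at every \<open>C\<close>, also outside the coset space, which spares
  membership conditions.\<close>

definition smooth :: "(('v \<Rightarrow> 'v) set \<Rightarrow> 'c) \<Rightarrow> bool" where
  "smooth f \<longleftrightarrow> (\<exists>D. finite D \<and> (\<forall>v\<in>fixer G D. \<forall>C. f (act v C) = f C))"

lemma smooth_act:
  assumes "smooth f" "g \<in> G"
  shows "smooth (\<lambda>C. f (act g C))"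
proof -
  obtain D where D: "finite D" "\<forall>v\<in>fixer G D. \<forall>C. f (act v C) = f C"
    using assms by (auto simp: smooth_def)
  have "f (act g (act v C)) = f (act g C)" if v: "v \<in> fixer G (finv g ` D)" for v C
  proof -
    have "g \<circ> v \<circ> finv g \<in> fixer G (g ` finv g ` D)" using fixer_conj[OF assms(2) v] .
    moreover have "g ` finv g ` D = D" using assms(2) by (auto simp: image_image)
    ultimately have "f (act (g \<circ> v \<circ> finv g) (act g C)) = f (act g C)" using D by simp
    then show ?thesis using assms(2) by (simp add: act_comp)
  qed
  then show ?thesis using D unfolding smooth_def by (intro exI[of _ "finv g ` D"]) auto
qed

lemma smooth_compose: "smooth f \<Longrightarrow> smooth (\<lambda>C. \<phi> (f C))"
  unfolding smooth_def by (metis (no_types, lifting))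

lemma smooth_openin: "smooth f \<Longrightarrow> openin X {C \<in> topspace X. f C \<in> B}"
  unfolding smooth_def
proof (elim exE conjE)
  fix D assume "finite D" "\<forall>v\<in>fixer G D. \<forall>C. f (act v C) = f C"
  then show ?thesis by (intro openin_X_invariant[where D = D]) (auto simp: fixer_def)
qed

text \<open>The subspace \<open>Y\<close> lets one statement serve both the measure on the whole
  space and the measures on orbits.\<close>

lemma smooth_measurable:
  assumes "sets \<mu> = sets (sigma (topspace (subtopology X Y)) {U. openin (subtopology X Y) U})"
    and "smooth f"
  shows "f \<in> measurable \<mu> (count_space UNIV)"
proof (rule measurable_of_openin_vimage[OF assms(1)])
  fix B
  have "{x \<in> topspace (subtopology X Y). f x \<in> B} = {C \<in> topspace X. f C \<in> B} \<inter> Y" by auto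
  then show "openin (subtopology X Y) {x \<in> topspace (subtopology X Y). f x \<in> B}"
    using smooth_openin[OF assms(2)] by (auto simp: openin_subtopology)
qed

lemma invariant_act:
  assumes \<mu>: "invariant_borel_prob (tree_aut adj) H (subtopology X Y) \<mu>"
    and g: "g \<in> G" "g \<in> H" "finv g \<in> H"
  shows "act g \<in> measurable \<mu> \<mu>" "distr \<mu> \<mu> (act g) = \<mu>"
proof -
  let ?\<tau> = "subtopology X Y"
  interpret prob_space \<mu> using \<mu> by (simp add: invariant_borel_prob_def)
  have sets: "sets \<mu> = sets (sigma (topspace ?\<tau>) {U. openin ?\<tau> U})"
    using \<mu> by (simp add: invariant_borel_prob_def)
  have sub: "{U. openin ?\<tau> U} \<subseteq> Pow (topspace ?\<tau>)" using openin_subset by blast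
  have sp: "space \<mu> = topspace ?\<tau>"
    using sets_eq_imp_space_eq[OF sets] sub by simp
  have gen: "sets \<mu> = sigma_sets (space \<mu>) {U. openin ?\<tau> U}"
    using sets sub by (simp add: sp)
  have inv: "emeasure \<mu> (act h ` B) = emeasure \<mu> B" if "h \<in> H" "B \<in> sets \<mu>" for h B
    using \<mu> that by (auto simp: invariant_borel_prob_def l_coset_eq_act)
  \<comment> \<open>non-measurable sets have measure 0, so invariance forces the image of the space
    to be measurable\<close>
  have stable: "act h C \<in> space \<mu>" if "h \<in> H" "C \<in> space \<mu>" for h C
  proof -
    have "emeasure \<mu> (act h ` space \<mu>) = 1" using inv[OF that(1)] emeasure_space_1 by simp
    then have "act h ` space \<mu> \<in> sets \<mu>" using emeasure_notin_sets by fastforce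
    then show ?thesis using that sets.sets_into_space by blast
  qed
  show meas: "act g \<in> measurable \<mu> \<mu>"
  proof (rule measurable_sigma_sets[OF gen])
    fix U assume "U \<in> {U. openin ?\<tau> U}"
    then obtain W where W: "openin X W" "U = W \<inter> Y" by (auto simp: openin_subtopology)
    have "act g -` U \<inter> space \<mu> = {C \<in> topspace X. act g C \<in> W} \<inter> Y"
      using stable[OF g(2)] W by (auto simp: sp)
    then have "openin ?\<tau> (act g -` U \<inter> space \<mu>)"
      using openin_X_act[OF W(1) g(1)] by (auto simp: openin_subtopology)
    then show "act g -` U \<inter> space \<mu> \<in> sets \<mu>" by (simp add: gen sigma_sets.Basic)
  qed (use sub stable[OF g(2)] in \<open>auto simp: sp\<close>)
  show "distr \<mu> \<mu> (act g) = \<mu>"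
  proof (rule measure_eqI)
    fix B assume "B \<in> sets (distr \<mu> \<mu> (act g))"
    then have B: "B \<in> sets \<mu>" by simp
    then have Bs: "B \<subseteq> space \<mu>" by (rule sets.sets_into_space)
    \<comment> \<open>Invariance is given for images; applied to the inverse of \<open>g\<close> it
      becomes invariance for preimages.\<close>
    have "act g -` B \<inter> space \<mu> = act (finv g) ` B"
    proof (intro equalityI subsetI)
      fix C assume "C \<in> act g -` B \<inter> space \<mu>"
      then show "C \<in> act (finv g) ` B" using g by (intro image_eqI[of _ _ "act g C"]) auto
    next
      fix C assume "C \<in> act (finv g) ` B"
      then show "C \<in> act g -` B \<inter> space \<mu>" using Bs g stable[OF g(3)] by auto
    qed
    then show "emeasure (distr \<mu> \<mu> (act g)) B = emeasure \<mu> B"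
      using meas B inv[OF g(3) B] by (simp add: emeasure_distr)
  qed simp
qed

section \<open>Finiteness, countability and positivity of orbits\<close>

text \<open>Local finiteness propagates along a walk from \<open>x\<close>. This stands in for
  compactness of vertex fixators.\<close>

lemma finite_vertex_orbit: "finite {g v |g. g \<in> fixer G {x}}"
  using connected[of x v]
proof (induction rule: rtranclp_induct)
  case base
  then show ?case by (rule finite_subset[of _ "{x}"]) (auto simp: fixer_def)
next
  case (step p q)
  have "{g q |g. g \<in> fixer G {x}} \<subseteq> (\<Union>p'\<in>{g p |g. g \<in> fixer G {x}}. {y. adj p' y})"
    using step(2) by (auto simp: fixer_def)
  then show ?case using step.IH finite_neighbours by (meson finite_UN_I finite_subset)
qed

lemma countable_vertices: "countable (UNIV :: 'v set)"
proof -
  fix x :: 'v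
  have fin: "finite {y. (adj ^^ n) x y}" for n
  proof (induction n)
    case (Suc n)
    have "{y. (adj ^^ Suc n) x y} \<subseteq> (\<Union>p\<in>{y. (adj ^^ n) x y}. {y. adj p y})" by auto
    then show ?case using Suc finite_neighbours by (meson finite_UN_I finite_subset)
  qed simp
  have "UNIV = (\<Union>n. {y. (adj ^^ n) x y})"
    using connected[of x] by (auto simp: rtranclp_power)
  moreover have "countable (\<Union>n. {y. (adj ^^ n) x y})"
    using fin by (intro countable_UN) (auto intro: countable_finite)
  ultimately show ?thesis by simp
qed

text \<open>The translate by \<open>u\<close> depends only on the coset of \<open>u\<close> modulo
  the fixator of \<open>D\<close>, that is, on the restriction of \<open>finv u\<close> to
  \<open>D\<close>. As \<open>u\<close> fixes \<open>x\<close>, its values there lie in finite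
  orbits.\<close>

lemma finite_translates:
  assumes f: "smooth f" and x: "x \<in> D0"
  shows "finite ((\<lambda>u C. f (act u C)) ` fixer G D0)"
proof -
  obtain D where D: "finite D" "\<And>v C. v \<in> fixer G D \<Longrightarrow> f (act v C) = f C"
    using f by (auto simp: smooth_def)
  let ?R = "\<lambda>u. restrict (finv u) D"
  have fin: "finite (?R ` fixer G D0)"
  proof (rule finite_subset)
    show "?R ` fixer G D0 \<subseteq> PiE D (\<lambda>v. {g v |g. g \<in> fixer G {x}})"
    proof (rule image_subsetI)
      fix u assume "u \<in> fixer G D0"
      then have "finv u \<in> fixer G {x}" using fixer_inv[of u D0] x by (auto simp: fixer_def)
      then show "?R u \<in> PiE D (\<lambda>v. {g v |g. g \<in> fixer G {x}})" by auto
    qed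
    show "finite (PiE D (\<lambda>v. {g v |g. g \<in> fixer G {x}}))"
      using D(1) finite_vertex_orbit by (rule finite_PiE)
  qed
  have same: "(\<lambda>C. f (act u C)) = (\<lambda>C. f (act u' C))"
    if u: "u \<in> fixer G D0" "u' \<in> fixer G D0" "?R u = ?R u'" for u u'
  proof
    fix C
    have uG: "u \<in> G" "u' \<in> G" using u by (auto simp: fixer_def)
    have "finv u v = finv u' v" if "v \<in> D" for v
      using fun_cong[OF u(3), of v] that by simp
    then have "u \<circ> finv u' \<in> fixer G D" using uG by (auto simp: fixer_def) (metis inv_app(2))
    then have "f (act (u \<circ> finv u') (act u' C)) = f (act u' C)" by (rule D(2))
    then show "f (act u C) = f (act u' C)" using uG by (simp add: act_comp)
  qed
  show ?thesis
    using fin by (subst image_factor[where R = ?R, OF same]) auto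
qed

lemma orbit_open:
  assumes "C \<in> topspace X" "finite D"
  shows "openin X {act v C |v. v \<in> fixer G D}"
proof (rule openin_X_invariant[OF _ assms(2)])
  fix v C' assume "v \<in> fixer G D" "C' \<in> {act v C |v. v \<in> fixer G D}"
  then show "act v C' \<in> {act v C |v. v \<in> fixer G D}"
    using fixer_comp by (auto simp: act_comp[symmetric])
qed (use assms(1) in \<open>auto simp: fixer_def\<close>)

lemma countable_translates:
  assumes "finite D"
  shows "countable ((\<lambda>g. {act (g \<circ> v) C |v. v \<in> fixer G D}) ` G)"
proof -
  let ?R = "\<lambda>g. restrict g D"
  have "countable (PiE D (\<lambda>_. UNIV :: 'v set))"
    using assms countable_vertices by (intro countable_PiE) auto
  then have cR: "countable (?R ` G)" by (rule countable_subset[rotated]) auto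
  have same: "{act (g \<circ> v) C |v. v \<in> fixer G D} \<subseteq> {act (g' \<circ> v) C |v. v \<in> fixer G D}"
    if g: "g \<in> G" "g' \<in> G" "?R g = ?R g'" for g g'
  proof safe
    fix v assume v: "v \<in> fixer G D"
    have "g w = g' w" if "w \<in> D" for w using fun_cong[OF g(3), of w] that by simp
    then have "finv g' \<circ> g \<in> fixer G D" using g by (auto simp: fixer_def inv_eq_iff)
    then have "finv g' \<circ> g \<circ> v \<in> fixer G D" using v fixer_comp by blast
    moreover have "g \<circ> v = g' \<circ> (finv g' \<circ> g \<circ> v)" using g by (auto simp: fun_eq_iff)
    ultimately show "\<exists>v'. act (g \<circ> v) C = act (g' \<circ> v') C \<and> v' \<in> fixer G D" by metis
  qed
  have eq: "{act (g \<circ> v) C |v. v \<in> fixer G D} = {act (g' \<circ> v) C |v. v \<in> fixer G D}"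
    if "g \<in> G" "g' \<in> G" "?R g = ?R g'" for g g'
    by (rule equalityI[OF same[OF that] same[OF that(2,1) that(3)[symmetric]]])
  show ?thesis
    using cR by (subst image_factor[where R = ?R, OF eq]) auto
qed

text \<open>The \<open>G\<close>-translates of the orbit cover the space, and only countably many
  are distinct. If the orbit were null, invariance would make the whole space null.\<close>

lemma invariant_orbit_pos:
  assumes \<mu>: "invariant_borel_prob (tree_aut adj) G X \<mu>"
    and C: "C \<in> topspace X" and D: "finite D"
  shows "measure \<mu> {act v C |v. v \<in> fixer G D} > 0"
proof (rule ccontr)
  interpret prob_space \<mu> using \<mu> by (simp add: invariant_borel_prob_def)
  have sets: "sets \<mu> = sets (sigma (topspace X) {U. openin X U})"
    using \<mu> by (simp add: invariant_borel_prob_def)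
  have sub: "{U. openin X U} \<subseteq> Pow (topspace X)" by (auto dest: openin_subset)
  have sp: "space \<mu> = topspace X"
    using sets_eq_imp_space_eq[OF sets] sub by simp
  let ?O = "{act v C |v. v \<in> fixer G D}"
  let ?T = "\<lambda>g. {act (g \<circ> v) C |v. v \<in> fixer G D}"
  have O: "?O \<in> sets \<mu>" using orbit_open[OF C D] sub by (simp add: sets sigma_sets.Basic)
  assume "\<not> measure \<mu> ?O > 0"
  then have zero: "emeasure \<mu> ?O = 0" by (simp add: emeasure_eq_measure zero_less_measure_iff)
  have T: "?T g = act g ` ?O" for g by (auto simp: act_comp)
  have T0: "emeasure \<mu> (?T g) = 0" if "g \<in> G" for g
    using \<mu> that O zero unfolding T by (auto simp: invariant_borel_prob_def l_coset_eq_act)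
  \<comment> \<open>The translate by \<open>g\<close> is an orbit of the conjugate fixator, that of
    the image of \<open>D\<close> under \<open>g\<close>, and is therefore open.\<close>
  have Tm: "?T g \<in> sets \<mu>" if g: "g \<in> G" for g
  proof -
    have "?T g = {act v (act g C) |v. v \<in> fixer G (g ` D)}"
    proof (intro equalityI subsetI)
      fix B assume "B \<in> ?T g"
      then obtain v where v: "v \<in> fixer G D" "B = act (g \<circ> v) C" by blast
      then have "B = act (g \<circ> v \<circ> finv g) (act g C)" using g by (simp add: act_comp)
      then show "B \<in> {act v (act g C) |v. v \<in> fixer G (g ` D)}" using fixer_conj[OF g v(1)] by blast
    next
      fix B assume "B \<in> {act v (act g C) |v. v \<in> fixer G (g ` D)}"
      then obtain v where v: "v \<in> fixer G (g ` D)" "B = act v (act g C)" by blast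
      then have "finv g \<circ> v \<circ> g \<in> fixer G D" using g by (auto simp: fixer_def)
      moreover have "B = act (g \<circ> (finv g \<circ> v \<circ> g)) C" using v g by (simp add: act_comp)
      ultimately show "B \<in> ?T g" by blast
    qed
    then have "openin X (?T g)" using orbit_open[of "act g C" "g ` D"] C D g by simp
    then show ?thesis using sub by (simp add: sets sigma_sets.Basic)
  qed
  have "space \<mu> = \<Union> (?T ` G)"
  proof (intro equalityI subsetI)
    fix B assume "B \<in> space \<mu>"
    then obtain g where "g \<in> G" "B = act g C" using act_transitive C sp by metis
    then have "B = act (g \<circ> id) C" by simp
    then show "B \<in> \<Union> (?T ` G)" using fixer_id \<open>g \<in> G\<close> by blast
  next
    fix B assume "B \<in> \<Union> (?T ` G)"
    then show "B \<in> space \<mu>" using Tm sets.sets_into_space by blast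
  qed
  moreover have "\<Union> (?T ` G) \<in> null_sets \<mu>"
  proof -
    have "(\<Union>S\<in>?T ` G. S) \<in> null_sets \<mu>"
      using countable_translates[OF D] T0 Tm by (intro null_sets_UN') auto
    then show ?thesis by simp
  qed
  ultimately show False using emeasure_space_1 by auto
qed

section \<open>Uniform approximation of compactly supported functions by smooth ones\<close>

text \<open>A Lebesgue number argument: the support is covered by finitely many open orbits on each
  of which \<open>\<theta>\<close> stays within \<open>e / 2\<close> of its value at the centre, and
  the corresponding fixators are intersected.\<close>

lemma Cc_uniformly_continuous:
  assumes \<theta>: "\<theta> \<in> Cc X" and e: "e > 0"
  obtains D where "finite D" "\<And>v C. v \<in> fixer G D \<Longrightarrow> C \<in> topspace X \<Longrightarrow> norm (\<theta> (act v C) - \<theta> C) < e"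
proof -
  define K where "K = X closure_of {y \<in> topspace X. \<theta> y \<noteq> 0}"
  have cont: "continuous_map X euclidean \<theta>" and K: "compactin X K"
    using \<theta> by (auto simp: Cc_def K_def)
  have supp: "C \<in> K" if "C \<in> topspace X" "\<theta> C \<noteq> 0" for C
    using closure_of_subset[of "{y \<in> topspace X. \<theta> y \<noteq> 0}" X] that by (auto simp: K_def)
  have KX: "K \<subseteq> topspace X" using K by (rule compactin_subset_topspace)
  have "\<exists>D. finite D \<and> (\<forall>v\<in>fixer G D. norm (\<theta> (act v C) - \<theta> C) < e / 2)" if "C \<in> K" for C
  proof -
    let ?W = "{B \<in> topspace X. \<theta> B \<in> ball (\<theta> C) (e / 2)}"
    have "openin X ?W"
      by (rule openin_continuous_map_preimage[OF cont]) (simp only: open_ball flip: open_openin)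
    moreover have "C \<in> ?W" using that KX e by auto
    ultimately obtain D where "finite D" "\<And>v. v \<in> fixer G D \<Longrightarrow> act v C \<in> ?W"
      using openin_X_nbhd by blast
    then show ?thesis by (intro exI[of _ D]) (auto simp: dist_norm norm_minus_commute)
  qed
  then obtain D where D: "\<And>C. C \<in> K \<Longrightarrow> finite (D C)"
    "\<And>C v. C \<in> K \<Longrightarrow> v \<in> fixer G (D C) \<Longrightarrow> norm (\<theta> (act v C) - \<theta> C) < e / 2"
    by metis
  let ?W = "\<lambda>C. {act v C |v. v \<in> fixer G (D C)}"
  have "\<exists>F. finite F \<and> F \<subseteq> ?W ` K \<and> K \<subseteq> \<Union> F"
  proof (rule compactinD[OF K])
    show "openin X U" if "U \<in> ?W ` K" for U using that orbit_open D KX by auto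
    show "K \<subseteq> \<Union> (?W ` K)"
    proof
      fix C assume "C \<in> K"
      moreover have "C \<in> ?W C" using fixer_id[of "D C"] by (force intro: exI[of _ id])
      ultimately show "C \<in> \<Union> (?W ` K)" by blast
    qed
  qed
  then obtain Y where Y: "finite Y" "Y \<subseteq> K" "K \<subseteq> \<Union> (?W ` Y)"
    by (metis (no_types, lifting) finite_subset_image)
  let ?D = "\<Union> (D ` Y)"
  have on_K: "norm (\<theta> (act v C) - \<theta> C) < e" if v: "v \<in> fixer G ?D" and C: "C \<in> K" for v C
  proof -
    obtain y u where y: "y \<in> Y" "u \<in> fixer G (D y)" "C = act u y" using Y(3) C by blast
    then have "v \<in> fixer G (D y)" using v by (auto simp: fixer_def)
    then have "norm (\<theta> (act (v \<circ> u) y) - \<theta> y) < e / 2" "norm (\<theta> (act u y) - \<theta> y) < e / 2"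
      using D(2) y Y(2) fixer_comp by blast+
    then show ?thesis
      using norm_triangle_ineq4[of "\<theta> (act (v \<circ> u) y) - \<theta> y" "\<theta> (act u y) - \<theta> y"]
      by (simp add: y act_comp)
  qed
  show thesis
  proof (rule that[of ?D])
    show "finite ?D" using Y D(1) by auto
    fix v C assume v: "v \<in> fixer G ?D" and C: "C \<in> topspace X"
    have vG: "v \<in> G" using v by (simp add: fixer_def)
    \<comment> \<open>\<open>K\<close> need not be invariant under \<open>v\<close>. If only
      \<open>act v C\<close> lies in \<open>K\<close>, the estimate is applied to the inverse of
      \<open>v\<close>; if neither point does, both values vanish.\<close>
    consider "C \<in> K" | "act v C \<in> K" | "C \<notin> K" "act v C \<notin> K" by blast
    then show "norm (\<theta> (act v C) - \<theta> C) < e"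
    proof cases
      case 2
      then show ?thesis
        using on_K[OF fixer_inv[OF v] 2] vG by (simp add: norm_minus_commute)
    next
      case 3
      then have "\<theta> C = 0" "\<theta> (act v C) = 0" using supp C vG by (metis, metis act_X)
      then show ?thesis using e by simp
    qed (use on_K v in blast)
  qed
qed

lemma Cc_bounded:
  assumes \<theta>: "\<theta> \<in> Cc X"
  obtains B where "\<And>C. C \<in> topspace X \<Longrightarrow> norm (\<theta> C) \<le> B"
proof -
  define K where "K = X closure_of {y \<in> topspace X. \<theta> y \<noteq> 0}"
  have cont: "continuous_map X euclidean \<theta>" and K: "compactin X K"
    using \<theta> by (auto simp: Cc_def K_def)
  have supp: "C \<in> K" if "C \<in> topspace X" "\<theta> C \<noteq> 0" for C
    using closure_of_subset[of "{y \<in> topspace X. \<theta> y \<noteq> 0}" X] that by (auto simp: K_def)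
  have "compact (\<theta> ` K)" using image_compactin[OF K cont] by simp
  then obtain B where "\<And>z. z \<in> \<theta> ` K \<Longrightarrow> norm z \<le> B"
    using compact_imp_bounded bounded_iff by metis
  then have "norm (\<theta> C) \<le> \<bar>B\<bar>" if "C \<in> topspace X" for C
    using supp[OF that] by (cases "\<theta> C = 0") (auto intro: order_trans[OF _ abs_ge_self])
  then show thesis using that by blast
qed

lemma Cc_approximation:
  assumes \<theta>: "\<theta> \<in> Cc X" and e: "e > 0"
  obtains f B where "smooth f" "\<And>C. norm (f C) \<le> B"
    "\<And>C. C \<in> topspace X \<Longrightarrow> norm (f C - \<theta> C) \<le> e"
proof -
  obtain D where D: "finite D"
    "\<And>v C. v \<in> fixer G D \<Longrightarrow> C \<in> topspace X \<Longrightarrow> norm (\<theta> (act v C) - \<theta> C) < e"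
    using Cc_uniformly_continuous[OF \<theta> e] by blast
  obtain B where B: "\<And>C. C \<in> topspace X \<Longrightarrow> norm (\<theta> C) \<le> B" using Cc_bounded[OF \<theta>] by blast
  \<comment> \<open>The representative depends only on the orbit, so evaluating
    \<open>\<theta>\<close> there gives a function that is exactly invariant.\<close>
  define pt where "pt C = (SOME C'. C' \<in> {act v C |v. v \<in> fixer G D})" for C
  define f where "f C = (if C \<in> topspace X then \<theta> (pt C) else 0)" for C
  have pt: "\<exists>v\<in>fixer G D. pt C = act v C" for C
  proof -
    have "act id C \<in> {act v C |v. v \<in> fixer G D}" using fixer_id by blast
    then have "pt C \<in> {act v C |v. v \<in> fixer G D}" unfolding pt_def by (rule someI)
    then show ?thesis by blast
  qed
  have "f (act v C) = f C" if v: "v \<in> fixer G D" for v C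
  proof -
    have vG: "v \<in> G" using v by (simp add: fixer_def)
    have "{act w (act v C) |w. w \<in> fixer G D} = {act w C |w. w \<in> fixer G D}"
    proof (intro equalityI subsetI)
      fix A assume "A \<in> {act w C |w. w \<in> fixer G D}"
      then obtain w where w: "w \<in> fixer G D" "A = act w C" by blast
      then have "A = act (w \<circ> finv v) (act v C)" using vG by (simp add: act_comp)
      then show "A \<in> {act w (act v C) |w. w \<in> fixer G D}"
        using fixer_comp[OF w(1) fixer_inv[OF v]] by blast
    qed (use fixer_comp[OF _ v] in \<open>auto simp: act_comp[symmetric]\<close>)
    then show ?thesis using vG by (simp add: f_def pt_def)
  qed
  then have "smooth f" using D(1) by (auto simp: smooth_def)
  moreover have "norm (f C) \<le> \<bar>B\<bar>" for C
  proof (cases "C \<in> topspace X")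
    case True
    then have "pt C \<in> topspace X" using pt[of C] by (auto simp: fixer_def)
    then show ?thesis using B[of "pt C"] by (simp add: f_def abs_if)
  qed (simp add: f_def)
  moreover have "norm (f C - \<theta> C) \<le> e" if C: "C \<in> topspace X" for C
  proof -
    obtain v where "v \<in> fixer G D" "pt C = act v C" using pt by blast
    then show ?thesis using D(2)[of v C] C by (simp add: f_def less_imp_le)
  qed
  ultimately show thesis using that by blast
qed

end

section \<open>Equidistribution\<close>

lemma act_funpow_Suc: "act (a ^^ n) (act a C) = act (a ^^ Suc n) C"
  by (simp only: act_comp[symmetric] funpow_Suc_right)

locale horospherical = coset_action adj G \<Gamma> + translation adj G l a t
  for adj :: "'v \<Rightarrow> 'v \<Rightarrow> bool" and G \<Gamma> l a t +
  fixes m\<^sub>X :: "('v \<Rightarrow> 'v) set measure" and V0 :: "'v set"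
  assumes bip: "bipartition adj V0"
    and tits: "tits_independent adj G"
    and mX: "invariant_borel_prob (tree_aut adj) G X m\<^sub>X"
begin

abbreviation "U \<equiv> fixer G {l 0, l 1}"

definition orbit_map :: "('v \<Rightarrow> 'v) set \<Rightarrow> ('v \<Rightarrow> 'v) set set" where
  "orbit_map C = {act u C |u. u \<in> U}"

lemma orbit_map_eq: "orbit_map B = orbit_map C \<longleftrightarrow> (\<exists>u\<in>U. B = act u C)"
proof
  assume "orbit_map B = orbit_map C"
  moreover have "act id B \<in> orbit_map B" unfolding orbit_map_def using fixer_id by blast
  ultimately show "\<exists>u\<in>U. B = act u C" by (auto simp: orbit_map_def)
next
  have sub: "orbit_map (act u C) \<subseteq> orbit_map C" if "u \<in> U" for u C
    using fixer_comp[OF _ that] by (auto simp: orbit_map_def act_comp[symmetric])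
  assume "\<exists>u\<in>U. B = act u C"
  then obtain u where u: "u \<in> U" "B = act u C" by blast
  then have "C = act (finv u) B" by (simp add: fixer_def)
  then show "orbit_map B = orbit_map C" 
    using sub[OF u(1), of C] sub[OF fixer_inv[OF u(1)], of B] u(2) by simp
qed

lemma U_G: "u \<in> U \<Longrightarrow> u \<in> G"
  by (simp add: fixer_def)

sublocale mX: prob_space m\<^sub>X
  using mX by (simp add: invariant_borel_prob_def)

lemma sets_mX: "sets m\<^sub>X = sets (sigma (topspace X) {U. openin X U})"
  using mX by (simp add: invariant_borel_prob_def)

lemma space_mX: "space m\<^sub>X = topspace X"
proof -
  have "{U. openin X U} \<subseteq> Pow (topspace X)" using openin_subset by blast
  then show ?thesis using sets_eq_imp_space_eq[OF sets_mX] by simp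
qed

lemma smooth_mX: "smooth f \<Longrightarrow> f \<in> measurable m\<^sub>X (count_space UNIV)"
  using smooth_measurable[of m\<^sub>X "topspace X" f] sets_mX by simp

lemma smooth_orbit_map: "smooth orbit_map"
  unfolding smooth_def using orbit_map_eq by (intro exI[of _ "{l 0, l 1}"]) auto

lemma act_mX: "g \<in> G \<Longrightarrow> act g \<in> measurable m\<^sub>X m\<^sub>X" "g \<in> G \<Longrightarrow> distr m\<^sub>X m\<^sub>X (act g) = m\<^sub>X"
  using invariant_act[of G "topspace X" m\<^sub>X g] mX by auto

sublocale block_average m\<^sub>X orbit_map
proof
  show "orbit_map \<in> measurable m\<^sub>X (count_space UNIV)"
    using smooth_mX smooth_orbit_map by blast
  fix z assume z: "z \<in> space m\<^sub>X"
  have "{y \<in> space m\<^sub>X. orbit_map y = orbit_map z} = {act v z |v. v \<in> U}"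
    using z by (auto simp: orbit_map_eq space_mX U_G)
  then show "measure m\<^sub>X {y \<in> space m\<^sub>X. orbit_map y = orbit_map z} > 0"
    using invariant_orbit_pos[OF mX, of z "{l 0, l 1}"] z by (simp add: space_mX)
next
  \<comment> \<open>The \<open>U\<close>-orbit of \<open>act g \<Gamma>\<close> depends only on the
    coset \<open>U g\<close>, which is determined by where \<open>finv g\<close> sends the
    edge.\<close>
  let ?R = "\<lambda>g. restrict (finv g) {l 0, l 1}"
  have "countable (PiE {l 0, l 1} (\<lambda>_. UNIV :: 'v set))"
    using countable_vertices by (intro countable_PiE) auto
  then have R: "countable (?R ` G)"
    by (rule countable_subset[rotated]) (intro image_subsetI, simp only: restrict_PiE_iff, simp)
  have same: "orbit_map (act g \<Gamma>) = orbit_map (act g' \<Gamma>)"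
    if g: "g \<in> G" "g' \<in> G" "?R g = ?R g'" for g g'
  proof -
    have "finv g v = finv g' v" if "v \<in> {l 0, l 1}" for v
      using fun_cong[OF g(3), of v] that by simp
    then have "g \<circ> finv g' \<in> U" using g by (auto simp: fixer_def) (metis inv_app(2))+
    moreover have "act g \<Gamma> = act (g \<circ> finv g') (act g' \<Gamma>)" using g by (simp add: act_comp)
    ultimately show ?thesis using orbit_map_eq by blast
  qed
  have "orbit_map ` space m\<^sub>X = (\<lambda>g. orbit_map (act g \<Gamma>)) ` G"
    by (simp add: space_mX topspace_X image_image)
  also have "countable \<dots>"
    using R by (subst image_factor[where R = ?R, OF same]) auto
  finally show "countable (orbit_map ` space m\<^sub>X)" .
qed

lemma smooth_integrable:
  assumes "smooth f" "\<And>C. \<bar>f C\<bar> \<le> B"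
  shows "integrable m\<^sub>X (f :: _ \<Rightarrow> real)"
proof (rule bounded_integrable)
  show "f \<in> borel_measurable m\<^sub>X"
    using smooth_mX[OF assms(1)] by (rule measurable_compose[of f _ _ "\<lambda>x. x"]) simp
qed (rule assms(2))

lemma avg_act_U:
  assumes "u \<in> U" "smooth f" "\<And>C. \<bar>f C\<bar> \<le> B" "C \<in> topspace X"
  shows "avg (\<lambda>C. f (act u C)) C = avg f C"
  using assms U_G[OF assms(1)]
  by (intro avg_measure_preserving act_mX smooth_integrable) (auto simp: orbit_map_eq space_mX)

text \<open>The finite set \<open>A\<close> of \<open>U\<close>-translates of \<open>f\<close> is
  permuted by \<open>U\<close>, so its mean \<open>S\<close> is \<open>U\<close>-invariant and
  equals its own average. Each translate has the same average as \<open>f\<close>; hence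
  \<open>avg f = S\<close> on the space. \<open>I\<close> picks one element of \<open>U\<close> per
  distinct translate.\<close>

lemma avg_smooth:
  assumes f: "smooth f" "\<And>C. \<bar>f C\<bar> \<le> B"
  obtains I where "finite I" "I \<noteq> {}" "I \<subseteq> U"
    "\<And>C. C \<in> topspace X \<Longrightarrow> avg f C = (\<Sum>u\<in>I. f (act u C)) / card I"
proof -
  let ?\<tau> = "\<lambda>u C. f (act u C)"
  define A where "A = ?\<tau> ` U"
  have A: "finite A" "A \<noteq> {}"
    using finite_translates[OF f(1), of "l 0" "{l 0, l 1}"] fixer_id[of "{l 0, l 1}"]
    by (auto simp: A_def)
  define S where "S C = (\<Sum>\<phi>\<in>A. \<phi> C) / card A" for C
  have S_inv: "S (act w C) = S C" if w: "w \<in> U" for w C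
  proof -
    let ?T = "\<lambda>\<phi> C. \<phi> (act w C)"
    have inj: "inj_on ?T A"
    proof (rule inj_onI)
      fix \<phi> \<psi> assume "?T \<phi> = ?T \<psi>"
      then have "?T \<phi> (act (finv w) D) = ?T \<psi> (act (finv w) D)" for D by (rule fun_cong)
      then show "\<phi> = \<psi>" using U_G[OF w] by (auto simp: fun_eq_iff)
    qed
    have "?T ` A \<subseteq> A"
      using fixer_comp[OF _ w] by (auto simp: A_def act_comp[symmetric])
    then have "?T ` A = A" using A(1) inj by (intro endo_inj_surj)
    then have "(\<Sum>\<phi>\<in>A. \<phi> C) = (\<Sum>\<phi>\<in>?T ` A. \<phi> C)" by simp
    also have "\<dots> = (\<Sum>\<phi>\<in>A. \<phi> (act w C))" by (simp add: sum.reindex[OF inj])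
    finally show ?thesis by (simp add: S_def)
  qed
  have \<phi>: "smooth \<phi> \<and> (\<forall>C. \<bar>\<phi> C\<bar> \<le> B) \<and> (\<forall>C\<in>topspace X. avg \<phi> C = avg f C)"
    if \<phi>: "\<phi> \<in> A" for \<phi>
  proof -
    obtain u where u: "u \<in> U" "\<phi> = ?\<tau> u" using \<phi> by (auto simp: A_def)
    then show ?thesis using smooth_act[OF f(1) U_G[OF u(1)]] avg_act_U[OF u(1) f] f(2) by simp
  qed
  then have int: "integrable m\<^sub>X \<phi>" if "\<phi> \<in> A" for \<phi> using smooth_integrable that by blast
  have S: "avg f C = S C" if C: "C \<in> topspace X" for C
  proof -
    have "block_const S" using S_inv unfolding block_const_def orbit_map_eq by auto
    moreover have "integrable m\<^sub>X S" unfolding S_def using int by simp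
    ultimately have "S C = avg S C" using C by (simp add: avg_block_const space_mX)
    also have "\<dots> = (\<Sum>\<phi>\<in>A. avg \<phi> C) / card A"
      unfolding S_def using int C by (intro avg_sum) (auto simp: space_mX)
    also have "\<dots> = avg f C" using \<phi> C A by simp
    finally show ?thesis ..
  qed
  define I where "I = inv_into U ?\<tau> ` A"
  have inj: "inj_on (inv_into U ?\<tau>) A" unfolding A_def by (rule inj_on_inv_into) simp
  show thesis
  proof (rule that[of I])
    show "I \<subseteq> U" by (auto simp: I_def A_def intro: inv_into_into)
    fix C assume C: "C \<in> topspace X"
    have "?\<tau> (inv_into U ?\<tau> \<phi>) C = \<phi> C" if "\<phi> \<in> A" for \<phi>
      using fun_cong[OF f_inv_into_f[of \<phi> ?\<tau> U], of C] that by (simp add: A_def)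
    then show "avg f C = (\<Sum>u\<in>I. f (act u C)) / card I"
      by (simp add: S[OF C] S_def I_def sum.reindex[OF inj] card_image[OF inj])
  qed (use A in \<open>auto simp: I_def\<close>)
qed

section \<open>Half-tree fixators under conjugation by powers of the translation\<close>

lemma fixer_half_tree_conj:
  assumes "k \<in> G" "adj x y" "g \<in> fixer G (half_tree adj x y)"
  shows "k \<circ> g \<circ> finv k \<in> fixer G (half_tree adj (k x) (k y))"
proof -
  have "finv k v \<in> half_tree adj x y" if "v \<in> half_tree adj (k x) (k y)" for v
  proof -
    have k: "finv k \<in> G" using assms(1) by blast
    show ?thesis
      using half_tree_image[of "k x" "k y" "finv k" v] that assms(1,2) G_inj[OF k] G_adj[OF k] by simp
  qed
  then show ?thesis using assms by (auto simp: fixer_def)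
qed

lemma fixer_half_tree_conj_pow:
  "g \<in> fixer G (Tp n) \<Longrightarrow> (a ^^ i) \<circ> g \<circ> finv (a ^^ i) \<in> fixer G (Tp (n + int i * t))"
  "g \<in> fixer G (Tm n) \<Longrightarrow> (a ^^ i) \<circ> g \<circ> finv (a ^^ i) \<in> fixer G (Tm (n + int i * t))"
  "g \<in> fixer G (Tp n) \<Longrightarrow> finv (a ^^ i) \<circ> g \<circ> (a ^^ i) \<in> fixer G (Tp (n - int i * t))"
  "g \<in> fixer G (Tm n) \<Longrightarrow> finv (a ^^ i) \<circ> g \<circ> (a ^^ i) \<in> fixer G (Tm (n - int i * t))"
proof -
  have inv: "finv (finv (a ^^ i)) = a ^^ i"
    using G_bij[OF G_pow[OF a_in]] by (rule inv_inv_eq)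
  note a_pow = G_pow[OF a_in, of i]
  note 1 = fixer_half_tree_conj[OF a_pow] and 2 = fixer_half_tree_conj[OF G_inv[OF a_pow]]
  show "g \<in> fixer G (Tp n) \<Longrightarrow> (a ^^ i) \<circ> g \<circ> finv (a ^^ i) \<in> fixer G (Tp (n + int i * t))"
    using 1[OF adj_l[of n]] by (simp add: a_pow_l algebra_simps)
  show "g \<in> fixer G (Tm n) \<Longrightarrow> (a ^^ i) \<circ> g \<circ> finv (a ^^ i) \<in> fixer G (Tm (n + int i * t))"
    using 1[OF adj_l'(1)[of n]] by (simp add: a_pow_l algebra_simps)
  show "g \<in> fixer G (Tp n) \<Longrightarrow> finv (a ^^ i) \<circ> g \<circ> (a ^^ i) \<in> fixer G (Tp (n - int i * t))"
    using 2[OF adj_l[of n]] by (simp add: inv inv_a_pow_l algebra_simps)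
  show "g \<in> fixer G (Tm n) \<Longrightarrow> finv (a ^^ i) \<circ> g \<circ> (a ^^ i) \<in> fixer G (Tm (n - int i * t))"
    using 2[OF adj_l'(1)[of n]] by (simp add: inv inv_a_pow_l algebra_simps)
qed

lemma U_split:
  assumes "u \<in> U"
  obtains p r where "p \<in> fixer G (Tm 0)" "r \<in> fixer G (Tp 0)" "u = p \<circ> r"
proof -
  \<comment> \<open>The edge is taken in reverse so that the factor fixing \<open>Tm 0\<close> comes
    first: it is then the one met by \<open>a ^^ i\<close>, and contracted by it.\<close>
  have "adj (l 1) (l 0)" using adj_l'(1)[of 0] by simp
  then have "fixer G {l 1, l 0} =
      fixer G (half_tree adj (l 1) (l 0)) <#>\<^bsub>tree_aut adj\<^esub> fixer G (half_tree adj (l 0) (l 1))"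
    using tits unfolding tits_independent_def by blast
  then show thesis
    using assms that unfolding set_mult_def by (auto simp: insert_commute)
qed

lemma Tp_fixer_U: "n \<le> 0 \<Longrightarrow> fixer G (Tp n) \<subseteq> U"
  and Tm_fixer_U: "n \<ge> 0 \<Longrightarrow> fixer G (Tm n) \<subseteq> U"
  using axis_in_Tp axis_in_Tm by (auto simp: fixer_def)

text \<open>Moved past \<open>a ^^ i\<close>, the element \<open>p\<close> becomes one that fixes
  \<open>Tm (int i * t)\<close>, which by \<open>Tm_exhaust\<close> contains the finite set
  controlling \<open>f\<close> once \<open>i\<close> is large.\<close>

lemma eventually_Tm_invariant:
  assumes "smooth f"
  obtains k0 where "\<And>i p C. i \<ge> k0 \<Longrightarrow> p \<in> fixer G (Tm 0) \<Longrightarrow> f (act (a ^^ i) (act p C)) = f (act (a ^^ i) C)"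
proof -
  obtain D where D: "finite D" "\<And>v C. v \<in> fixer G D \<Longrightarrow> f (act v C) = f C"
    using assms by (auto simp: smooth_def)
  have "\<exists>N. \<forall>n\<ge>N. D \<subseteq> Tm n" using D(1)
  proof (induction D rule: finite_induct)
    case (insert v D)
    then obtain N where N: "\<forall>n\<ge>N. D \<subseteq> Tm n" by blast
    obtain N' where "\<forall>n\<ge>N'. v \<in> Tm n" using Tm_exhaust by blast
    then show ?case using N by (intro exI[of _ "max N N'"]) auto
  qed simp
  then obtain N where N: "\<And>n. n \<ge> N \<Longrightarrow> D \<subseteq> Tm n" by blast
  show thesis
  proof (rule that[of "nat N"])
    fix i p C assume i: "nat N \<le> i" and p: "p \<in> fixer G (Tm 0)"
    have "int i * t \<ge> int i" using t_pos mult_left_mono[of 1 t "int i"] by simp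
    then have "D \<subseteq> Tm (0 + int i * t)" using i by (intro N) simp
    then have "(a ^^ i) \<circ> p \<circ> finv (a ^^ i) \<in> fixer G D"
      using fixer_half_tree_conj_pow(2)[OF p, of i] by (auto simp: fixer_def)
    then have "f (act ((a ^^ i) \<circ> p \<circ> finv (a ^^ i)) (act (a ^^ i) C)) = f (act (a ^^ i) C)"
      by (rule D(2))
    then show "f (act (a ^^ i) (act p C)) = f (act (a ^^ i) C)"
      using G_pow[OF a_in] by (simp add: act_comp)
  qed
qed

text \<open>The shift relation trades powers of \<open>a\<close> for the index, so
  \<open>U\<close>-invariance of all \<open>h j\<close> makes \<open>h 0\<close> invariant under the
  conjugates of \<open>U\<close>. The fixators of \<open>Tp n\<close> need nonnegative indices and
  those of \<open>Tm n\<close> nonpositive ones, which is why \<open>j\<close> ranges over the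
  integers.\<close>

lemma ergodic_axis:
  fixes h :: "int \<Rightarrow> ('v \<Rightarrow> 'v) set \<Rightarrow> real"
  assumes const: "\<And>j. block_const (h j)"
    and shift: "\<And>j C. C \<in> topspace X \<Longrightarrow> h (j + 1) C = h j (act a C)"
    and BC: "B \<in> topspace X" "C \<in> topspace X"
  shows "h 0 B = h 0 C"
proof -
  have hU: "h j (act u C) = h j C" if "u \<in> U" "C \<in> topspace X" for j u C
  proof -
    have "orbit_map (act u C) = orbit_map C" using that orbit_map_eq by blast
    then show ?thesis
      using const[of j] that U_G unfolding block_const_def space_mX by (meson act_X)
  qed
  have pow: "h (j + int n) C = h j (act (a ^^ n) C)" if "C \<in> topspace X" for j n C
    using that
  proof (induction n arbitrary: C)
    case (Suc n)
    have "h (j + int n + 1) C = h (j + int n) (act a C)" using Suc shift by blast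
    also have "\<dots> = h j (act (a ^^ n) (act a C))" using Suc a_in by simp
    also have "act (a ^^ n) (act a C) = act (a ^^ Suc n) C" by (rule act_funpow_Suc)
    finally show ?case by (simp add: algebra_simps del: funpow.simps)
  qed simp
  define S where "S = {g \<in> G. \<forall>C\<in>topspace X. h 0 (act g C) = h 0 C}"
  have big: "int n * t \<ge> int n" for n
    using t_pos mult_left_mono[of 1 t "int n"] by simp
  have "S = G"
  proof (rule generated_by_half_tree_fixers[OF tits bip])
    show "S \<subseteq> G" by (auto simp: S_def)
    show "g \<circ> k \<in> S" if "g \<in> S" "k \<in> S" for g k
      using that by (auto simp: S_def act_comp)
    show "finv g \<in> S" if g: "g \<in> S" for g
    proof -
      have gG: "g \<in> G" and gh: "\<And>C. C \<in> topspace X \<Longrightarrow> h 0 (act g C) = h 0 C"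
        using g by (auto simp: S_def)
      have "h 0 (act (finv g) C) = h 0 C" if "C \<in> topspace X" for C
        using gh[of "act (finv g) C"] gG that act_X[OF G_inv[OF gG], of C] by simp
      then show ?thesis using gG by (auto simp: S_def)
    qed
    show "fixer G (Tp n) \<subseteq> S" for n
    proof
      fix g assume g: "g \<in> fixer G (Tp n)"
      \<comment> \<open>Since \<open>t \<ge> 1\<close>, pulling back by \<open>a ^^ j\<close> moves
        \<open>Tp n\<close> to a half-tree that contains the edge from \<open>l 0\<close> to
        \<open>l 1\<close>.\<close>
      define j where "j = nat n"
      let ?A = "a ^^ j"
      have A: "?A \<in> G" using a_in by blast
      have gG: "g \<in> G" using g by (simp add: fixer_def)
      define u where "u = finv ?A \<circ> g \<circ> ?A"
      have "n \<le> int j" by (simp add: j_def)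
      then have "n - int j * t \<le> 0" using big[of j] by linarith
      then have u: "u \<in> U"
        using fixer_half_tree_conj_pow(3)[OF g, of j] Tp_fixer_U unfolding u_def by blast
      have "h 0 (act g C) = h 0 C" if C: "C \<in> topspace X" for C
      proof -
        let ?B = "act (finv ?A) C"
        have B: "?B \<in> topspace X" using C act_X[OF G_inv[OF A]] by simp
        have "act g C = act ?A (act u ?B)" using A by (simp add: u_def act_comp)
        then have "h 0 (act g C) = h (int j) (act u ?B)" using pow[of "act u ?B" 0 j] B u U_G by simp
        also have "\<dots> = h (int j) ?B" using hU[OF u B] .
        also have "\<dots> = h 0 (act ?A ?B)" using pow[OF B, of 0 j] by simp
        finally show ?thesis using A by simp
      qed
      then show "g \<in> S" using gG by (simp add: S_def)
    qed
    show "fixer G (Tm n) \<subseteq> S" for n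
    proof
      fix g assume g: "g \<in> fixer G (Tm n)"
      define j where "j = nat (- n)"
      let ?A = "a ^^ j"
      have A: "?A \<in> G" using a_in by blast
      have gG: "g \<in> G" using g by (simp add: fixer_def)
      define u where "u = ?A \<circ> g \<circ> finv ?A"
      have "- n \<le> int j" by (simp add: j_def)
      then have "n + int j * t \<ge> 0" using big[of j] by linarith
      then have u: "u \<in> U"
        using fixer_half_tree_conj_pow(2)[OF g, of j] Tm_fixer_U unfolding u_def by blast
      have "h 0 (act g C) = h 0 C" if C: "C \<in> topspace X" for C
      proof -
        have gC: "act g C \<in> topspace X" using C gG by simp
        have "h 0 (act g C) = h (- int j) (act ?A (act g C))"
          using pow[OF gC, of "- int j" j] by simp
        also have "act ?A (act g C) = act u (act ?A C)" using A by (simp add: u_def act_comp)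
        also have "h (- int j) (act u (act ?A C)) = h (- int j) (act ?A C)"
          using u C A by (intro hU) auto
        also have "\<dots> = h 0 C" using pow[OF C, of "- int j" j] by simp
        finally show ?thesis .
      qed
      then show "g \<in> S" using gG by (simp add: S_def)
    qed
  qed
  moreover obtain g where "g \<in> G" "B = act g C" using act_transitive BC by metis
  ultimately show ?thesis using BC by (auto simp: S_def)
qed

section \<open>Convergence of averages and equidistribution\<close>

text \<open>\<open>F i\<close> is the \<open>U\<close>-average of \<open>f\<close> composed with
  \<open>a ^^ i\<close>. The explicit finite mean over elements fixing \<open>Tp 0\<close> is
  exported as well, because it is what relates \<open>F i\<close> to the orbit measures.\<close>

lemma smooth_averages_converge:
  assumes f: "smooth f" "\<And>C. \<bar>f C\<bar> \<le> B"
  obtains k0 F where "\<And>C. C \<in> topspace X \<Longrightarrow> (\<lambda>i. F i C) \<longlonglongrightarrow> (\<integral>y. f y \<partial>m\<^sub>X)"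
    and "\<And>i. block_const (F i)"
    and "\<And>i. i \<ge> k0 \<Longrightarrow> \<exists>I r. finite I \<and> I \<noteq> {} \<and> (\<forall>u\<in>I. r u \<in> fixer G (Tp 0)) \<and>
      (\<forall>C\<in>topspace X. F i C = (\<Sum>u\<in>(I :: ('v \<Rightarrow> 'v) set). f (act (a ^^ i) (act (r u) C))) / card I)"
proof -
  obtain k0 where k0: "\<And>i p C. i \<ge> k0 \<Longrightarrow> p \<in> fixer G (Tm 0) \<Longrightarrow>
      f (act (a ^^ i) (act p C)) = f (act (a ^^ i) C)"
    using eventually_Tm_invariant[OF f(1)] by blast
  define fa where "fa i = (\<lambda>C. f (act (a ^^ i) C))" for i
  have fa: "smooth (fa i)" "\<bar>fa i C\<bar> \<le> B" for i C
    using smooth_act[OF f(1) G_pow[OF a_in]] f(2) by (auto simp: fa_def)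
  define F where "F i = avg (fa i)" for i
  have formula: "\<exists>I r. finite I \<and> I \<noteq> {} \<and> (\<forall>u\<in>I. r u \<in> fixer G (Tp 0)) \<and>
      (\<forall>C\<in>topspace X. F i C = (\<Sum>u\<in>(I :: ('v \<Rightarrow> 'v) set). fa i (act (r u) C)) / card I)"
    if i: "i \<ge> k0" for i
  proof -
    obtain I where I: "finite I" "I \<noteq> {}" "I \<subseteq> U"
      "\<And>C. C \<in> topspace X \<Longrightarrow> F i C = (\<Sum>u\<in>I. fa i (act u C)) / card I"
      using avg_smooth[OF fa(1,2), of i] unfolding F_def by metis
    have "\<forall>u\<in>I. \<exists>r\<in>fixer G (Tp 0). \<forall>C. fa i (act u C) = fa i (act r C)"
    proof
      fix u assume "u \<in> I"
      then obtain p r where "p \<in> fixer G (Tm 0)" "r \<in> fixer G (Tp 0)" "u = p \<circ> r"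
        using I(3) U_split by blast
      then show "\<exists>r\<in>fixer G (Tp 0). \<forall>C. fa i (act u C) = fa i (act r C)"
        using k0[OF i] by (intro bexI[of _ r]) (auto simp: fa_def act_comp)
    qed
    then obtain r where r: "\<And>u. u \<in> I \<Longrightarrow> r u \<in> fixer G (Tp 0)"
      "\<And>u C. u \<in> I \<Longrightarrow> fa i (act u C) = fa i (act (r u) C)" by metis
    have "F i C = (\<Sum>u\<in>I. fa i (act (r u) C)) / card I" if "C \<in> topspace X" for C
      using I(4)[OF that] r(2) by simp
    then show ?thesis using I(1,2) r(1) by blast
  qed
  \<comment> \<open>The finite mean for \<open>F i\<close> is composed with \<open>a\<close>;
    commuting \<open>r u\<close> past \<open>a\<close> turns it into an element of \<open>U\<close>,
    which the outer average ignores.\<close>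
  have step: "F (Suc i) C = avg (\<lambda>D. F i (act a D)) C" if i: "i \<ge> k0" and C: "C \<in> topspace X" for i C
  proof -
    obtain I r where I: "finite I" "I \<noteq> {}" "\<And>u. u \<in> I \<Longrightarrow> r u \<in> fixer G (Tp 0)"
      "\<And>C. C \<in> topspace X \<Longrightarrow> F i C = (\<Sum>u\<in>(I :: ('v \<Rightarrow> 'v) set). fa i (act (r u) C)) / card I"
      using formula[OF i] by blast
    let ?g = "\<lambda>u C. fa i (act (r u) (act a C))"
    have g: "?g u = (\<lambda>C. fa (Suc i) (act (finv a \<circ> r u \<circ> a) C))" for u
      by (simp add: fa_def act_comp act_funpow_Suc[symmetric] a_in del: funpow.simps)
    \<comment> \<open>The conjugate fixes \<open>Tp (- t)\<close>, a half-tree that contains the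
      base edge.\<close>
    have w: "finv a \<circ> r u \<circ> a \<in> U" if "u \<in> I" for u
      using fixer_half_tree_conj_pow(3)[OF I(3)[OF that], of 1] Tp_fixer_U[of "- t"] t_pos by auto
    have int: "integrable m\<^sub>X (?g u)" if "u \<in> I" for u
      unfolding g using smooth_act[OF fa(1) U_G[OF w[OF that]]] fa(2) by (rule smooth_integrable)
    have "avg (\<lambda>D. F i (act a D)) C = avg (\<lambda>D. (\<Sum>u\<in>I. ?g u D) / card I) C"
    proof (rule avg_cong[symmetric])
      show "integrable m\<^sub>X (\<lambda>D. (\<Sum>u\<in>I. ?g u D) / card I)" using int by simp
    qed (use I(4) C a_in in \<open>auto simp: space_mX\<close>)
    also have "\<dots> = (\<Sum>u\<in>I. avg (?g u) C) / card I"
      using int C by (intro avg_sum) (auto simp: space_mX)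
    also have "(\<Sum>u\<in>I. avg (?g u) C) = (\<Sum>u\<in>I. F (Suc i) C)"
    proof (rule sum.cong[OF refl])
      fix u assume "u \<in> I"
      then show "avg (?g u) C = F (Suc i) C"
        unfolding g F_def by (intro avg_act_U[OF w fa(1,2) C])
    qed
    finally show ?thesis using I(1,2) by simp
  qed
  have conv: "(\<lambda>i. F i C) \<longlonglongrightarrow> (\<integral>y. f y \<partial>m\<^sub>X)" if C: "C \<in> topspace X" for C
  proof -
    \<comment> \<open>The recursion is available only from \<open>k0\<close> on, so the convergence
      theorem is applied to the shifted sequence.\<close>
    have "(\<lambda>j. F (k0 + j) C) \<longlonglongrightarrow> (\<integral>y. F (k0 + 0) y \<partial>m\<^sub>X)"
    proof (rule iterated_averages_converge[where T = "act a" and F = "\<lambda>j. F (k0 + j)" and C = B])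
      show "act a \<in> measurable m\<^sub>X m\<^sub>X" "distr m\<^sub>X m\<^sub>X (act a) = m\<^sub>X"
        by (fact act_mX[OF a_in])+
      show "block_const (F (k0 + j))" for j unfolding F_def by (rule block_const_avg)
      show "\<bar>F (k0 + j) z\<bar> \<le> B" if "z \<in> space m\<^sub>X" for j z
        unfolding F_def using borel_measurable_integrable[OF smooth_integrable[OF fa(1,2)]] fa(2) that
        by (rule avg_bounded)
      show "F (k0 + Suc j) z = avg (\<lambda>y. F (k0 + j) (act a y)) z" if "z \<in> space m\<^sub>X" for j z
        using step[of "k0 + j" z] that by (simp add: space_mX)
      show "C \<in> space m\<^sub>X" using C by (simp add: space_mX)
      show "\<forall>y\<in>space m\<^sub>X. \<forall>z\<in>space m\<^sub>X. h 0 y = h 0 z"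
        if "\<And>j. block_const (h j)" "\<And>j z. z \<in> space m\<^sub>X \<Longrightarrow> h (j + 1) z = h j (act a z)"
        for h :: "int \<Rightarrow> ('v \<Rightarrow> 'v) set \<Rightarrow> real"
        unfolding space_mX
      proof (intro ballI)
        fix y z assume "y \<in> topspace X" "z \<in> topspace X"
        with that[unfolded space_mX] show "h 0 y = h 0 z" by (rule ergodic_axis[of h])
      qed
      fix z assume z: "z \<in> space m\<^sub>X"
      \<comment> \<open>An element fixing \<open>?D\<close> lies in \<open>U\<close> and so does its
        conjugate by \<open>a\<close>. Its orbits therefore preserve both block labels, and they
        have positive measure.\<close>
      let ?D = "{l 0, l 1, finv a (l 0), finv a (l 1)}"
      let ?S = "{y \<in> space m\<^sub>X. orbit_map y = orbit_map z \<and> orbit_map (act a y) = orbit_map (act a z)}"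
      have "{act v z |v. v \<in> fixer G ?D} \<subseteq> ?S"
      proof (rule subsetI)
        fix y assume "y \<in> {act v z |v. v \<in> fixer G ?D}"
        then obtain v where v: "v \<in> fixer G ?D" "y = act v z" by blast
        then have vG: "v \<in> G" by (simp add: fixer_def)
        have "v \<in> U" using v by (simp add: fixer_def)
        moreover have "a \<circ> v \<circ> finv a \<in> U" using v a_in by (auto simp: fixer_def)
        moreover have "act a y = act (a \<circ> v \<circ> finv a) (act a z)" using a_in v by (simp add: act_comp)
        ultimately show "y \<in> ?S" using v z vG orbit_map_eq by (auto simp: space_mX)
      qed
      moreover have "?S \<in> sets m\<^sub>X"
      proof -
        have "?S = block z \<inter> (act a -` block (act a z) \<inter> space m\<^sub>X)"
          using a_in by (auto simp: block_def space_mX)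
        then show ?thesis using block_in(2) measurable_sets[OF act_mX(1)[OF a_in]] by simp
      qed
      ultimately have "measure m\<^sub>X {act v z |v. v \<in> fixer G ?D} \<le> measure m\<^sub>X ?S"
        by (rule mX.finite_measure_mono)
      then show "measure m\<^sub>X ?S > 0"
        using invariant_orbit_pos[OF mX, of z ?D] z by (simp add: space_mX)
    qed
    moreover have "(\<integral>y. F k0 y \<partial>m\<^sub>X) = (\<integral>y. f y \<partial>m\<^sub>X)"
    proof -
      have "(\<integral>y. F k0 y \<partial>m\<^sub>X) = (\<integral>y. f (act (a ^^ k0) y) \<partial>m\<^sub>X)"
        using integral_avg[OF smooth_integrable[OF fa(1,2)]] by (simp add: F_def fa_def)
      also have "\<dots> = (\<integral>y. f y \<partial>distr m\<^sub>X m\<^sub>X (act (a ^^ k0)))"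
        using act_mX(1)[OF G_pow[OF a_in]] borel_measurable_integrable[OF smooth_integrable[OF f]]
        by (intro integral_distr[symmetric])
      finally show ?thesis using act_mX(2)[OF G_pow[OF a_in]] by simp
    qed
    ultimately have "(\<lambda>j. F (j + k0) C) \<longlonglongrightarrow> (\<integral>y. f y \<partial>m\<^sub>X)" by (simp add: add.commute)
    then show ?thesis by (rule LIMSEQ_offset)
  qed
  show thesis
    using that[of F k0] conv formula block_const_avg by (simp add: F_def fa_def)
qed

text \<open>At \<open>act (finv (a ^^ i)) y\<close>, the mean \<open>F i\<close> averages
  \<open>f\<close> over translates of \<open>y\<close> by \<open>w u\<close>, elements fixing
  \<open>Tp (int i * t)\<close> and hence in \<open>H\<close>. As \<open>\<mu> i\<close> is
  \<open>H\<close>-invariant, the integral of \<open>f\<close> equals that of \<open>F i\<close>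
  over the orbit pulled back by \<open>a ^^ i\<close>, where \<open>F i\<close> takes only its
  values on \<open>Z\<close>.\<close>

lemma smooth_equidistribution:
  fixes f :: "('v \<Rightarrow> 'v) set \<Rightarrow> real"
  assumes f: "smooth f" "\<And>C. \<bar>f C\<bar> \<le> B"
    and \<mu>: "\<And>i. invariant_borel_prob (tree_aut adj) H (subtopology X (Y i)) (\<mu> i)"
    and H: "\<And>n. fixer G (Tp n) \<subseteq> H" and Y: "\<And>i. Y i \<subseteq> topspace X"
    and Z: "finite Z" "Z \<subseteq> topspace X"
      "\<And>i y. y \<in> Y i \<Longrightarrow> \<exists>z\<in>Z. orbit_map (act (finv (a ^^ i)) y) = orbit_map z"
  shows "(\<lambda>i. \<integral>y. f y \<partial>\<mu> i) \<longlonglongrightarrow> (\<integral>y. f y \<partial>m\<^sub>X)"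
proof -
  obtain k0 F where conv: "\<And>C. C \<in> topspace X \<Longrightarrow> (\<lambda>i. F i C) \<longlonglongrightarrow> (\<integral>y. f y \<partial>m\<^sub>X)"
    and const: "\<And>i. block_const (F i)"
    and formula: "\<And>i. i \<ge> k0 \<Longrightarrow> \<exists>I r. finite I \<and> I \<noteq> {} \<and> (\<forall>u\<in>I. r u \<in> fixer G (Tp 0)) \<and>
      (\<forall>C\<in>topspace X. F i C = (\<Sum>u\<in>(I :: ('v \<Rightarrow> 'v) set). f (act (a ^^ i) (act (r u) C))) / card I)"
    by (rule smooth_averages_converge[OF f], rule that) assumption+
  let ?c = "\<integral>y. f y \<partial>m\<^sub>X"
  have close: "\<bar>(\<integral>y. f y \<partial>\<mu> i) - ?c\<bar> \<le> e"
    if i: "i \<ge> k0" and e: "\<forall>z\<in>Z. \<bar>F i z - ?c\<bar> \<le> e" for i e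
  proof -
    interpret \<mu>: prob_space "\<mu> i" using \<mu> by (simp add: invariant_borel_prob_def)
    have sets: "sets (\<mu> i) = sets (sigma (topspace (subtopology X (Y i))) {U. openin (subtopology X (Y i)) U})"
      using \<mu> by (simp add: invariant_borel_prob_def)
    have "{U. openin (subtopology X (Y i)) U} \<subseteq> Pow (topspace (subtopology X (Y i)))"
      using openin_subset by blast
    then have space: "space (\<mu> i) = Y i"
      using sets_eq_imp_space_eq[OF sets] Y[of i] by auto
    have meas: "g \<in> borel_measurable (\<mu> i)" if "smooth g" for g :: "_ \<Rightarrow> real"
      using smooth_measurable[OF sets that] by (rule measurable_compose[of g _ _ "\<lambda>x. x"]) simp
    let ?A = "a ^^ i"
    have A: "?A \<in> G" using a_in by blast
    obtain I r where I: "finite I" "I \<noteq> {}" "\<And>u. u \<in> I \<Longrightarrow> r u \<in> fixer G (Tp 0)"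
      "\<And>C. C \<in> topspace X \<Longrightarrow> F i C = (\<Sum>u\<in>(I :: ('v \<Rightarrow> 'v) set). f (act ?A (act (r u) C))) / card I"
      using formula[OF i] by blast
    define w where "w u = ?A \<circ> r u \<circ> finv ?A" for u
    have w: "w u \<in> fixer G (Tp (0 + int i * t))" if "u \<in> I" for u
      unfolding w_def using I(3)[OF that] by (rule fixer_half_tree_conj_pow)
    have wG: "w u \<in> G" if "u \<in> I" for u using w[OF that] by (simp add: fixer_def)
    have wH: "w u \<in> H" "finv (w u) \<in> H" if "u \<in> I" for u
      using H[of "0 + int i * t"] w[OF that] fixer_inv by blast+
    have int: "integrable (\<mu> i) (\<lambda>y. f (act (w u) y))" if "u \<in> I" for u
      using f(2) meas[OF smooth_act[OF f(1) wG[OF that]]] by (intro \<mu>.integrable_const_bound[of _ B]) auto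
    have "(\<integral>y. f (act (w u) y) \<partial>\<mu> i) = (\<integral>y. f y \<partial>\<mu> i)" if "u \<in> I" for u
      using integral_distr[OF invariant_act(1)[OF \<mu> wG wH] meas[OF f(1)]]
        invariant_act(2)[OF \<mu> wG wH] that by simp
    then have "(\<integral>y. f y \<partial>\<mu> i) = (\<integral>y. (\<Sum>u\<in>I. f (act (w u) y)) / card I \<partial>\<mu> i)"
      using int I(1,2) by simp
    also have "\<dots> - ?c = (\<integral>y. (\<Sum>u\<in>I. f (act (w u) y)) / card I - ?c \<partial>\<mu> i)"
      using int by (simp add: \<mu>.prob_space)
    also have "\<bar>\<dots>\<bar> \<le> (\<integral>y. e \<partial>\<mu> i)"
    proof (rule order_trans[OF integral_abs_bound], rule integral_mono)
      show "integrable (\<mu> i) (\<lambda>y. \<bar>(\<Sum>u\<in>I. f (act (w u) y)) / card I - ?c\<bar>)" using int by simp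
      fix y assume "y \<in> space (\<mu> i)"
      then have y: "y \<in> Y i" "y \<in> topspace X" using space Y by auto
      let ?y = "act (finv ?A) y"
      have y': "?y \<in> topspace X" using y(2) act_X[OF G_inv[OF A]] by simp
      obtain z where z: "z \<in> Z" "orbit_map ?y = orbit_map z" using Z(3)[OF y(1)] by blast
      then have "F i ?y = F i z"
        using const[of i] y' Z(2) unfolding block_const_def space_mX by blast
      moreover have "F i ?y = (\<Sum>u\<in>I. f (act (w u) y)) / card I"
        using I(4)[OF y'] by (simp add: w_def act_comp)
      ultimately show "\<bar>(\<Sum>u\<in>I. f (act (w u) y)) / card I - ?c\<bar> \<le> e" using e z(1) by metis
    qed simp
    finally show ?thesis by (simp add: \<mu>.prob_space)
  qed
  show ?thesis
  proof (rule tendstoI)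
    fix e :: real assume e: "e > 0"
    \<comment> \<open>Finiteness of \<open>Z\<close> makes the pointwise convergence uniform on the
      points that matter.\<close>
    have "\<forall>\<^sub>F i in sequentially. \<forall>z\<in>Z. \<bar>F i z - ?c\<bar> < e / 2"
    proof (rule eventually_ball_finite[OF Z(1)], rule ballI)
      fix z assume "z \<in> Z"
      then have "(\<lambda>i. F i z) \<longlonglongrightarrow> ?c" using conv Z(2) by blast
      then show "\<forall>\<^sub>F i in sequentially. \<bar>F i z - ?c\<bar> < e / 2"
        using tendstoD[of "\<lambda>i. F i z" ?c sequentially "e / 2"] e by (simp add: dist_real_def)
    qed
    then show "\<forall>\<^sub>F i in sequentially. dist (\<integral>y. f y \<partial>\<mu> i) ?c < e"
      using eventually_ge_at_top[of k0]
    proof eventually_elim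
      case (elim i)
      then have "\<bar>(\<integral>y. f y \<partial>\<mu> i) - ?c\<bar> \<le> e / 2" by (intro close) (auto intro: less_imp_le)
      then show ?case using e by (simp add: dist_real_def)
    qed
  qed
qed

text \<open>A smooth \<open>f\<close> within \<open>e / 3\<close> of \<open>\<theta>\<close> costs
  at most \<open>e / 3\<close> on each side, since all measures involved are probabilities. The real
  statement is applied to the real and imaginary parts of \<open>f\<close>.\<close>

lemma Cc_equidistribution:
  fixes \<theta> :: "('v \<Rightarrow> 'v) set \<Rightarrow> complex"
  assumes \<theta>: "\<theta> \<in> Cc X"
    and \<mu>: "\<And>i. invariant_borel_prob (tree_aut adj) H (subtopology X (Y i)) (\<mu> i)"
    and H: "\<And>n. fixer G (Tp n) \<subseteq> H" and Y: "\<And>i. Y i \<subseteq> topspace X"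
    and Z: "finite Z" "Z \<subseteq> topspace X"
      "\<And>i y. y \<in> Y i \<Longrightarrow> \<exists>z\<in>Z. orbit_map (act (finv (a ^^ i)) y) = orbit_map z"
  shows "(\<lambda>i. \<integral>y. \<theta> y \<partial>\<mu> i) \<longlonglongrightarrow> (\<integral>y. \<theta> y \<partial>m\<^sub>X)"
proof (rule tendstoI)
  fix e :: real assume e: "e > 0"
  obtain f B where f: "smooth f" "\<And>C. norm (f C) \<le> B"
    "\<And>C. C \<in> topspace X \<Longrightarrow> norm (f C - \<theta> C) \<le> e / 3"
    using Cc_approximation[OF \<theta>, of "e / 3"] e by auto
  obtain B' where B': "\<And>C. C \<in> topspace X \<Longrightarrow> norm (\<theta> C) \<le> B'" using Cc_bounded[OF \<theta>] by blast
  have cont: "continuous_map X euclidean \<theta>" using \<theta> by (simp add: Cc_def)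
  have approx: "integrable \<nu> f \<and> norm ((\<integral>y. f y \<partial>\<nu>) - (\<integral>y. \<theta> y \<partial>\<nu>)) \<le> e / 3"
    if \<nu>: "prob_space \<nu>" and W: "W \<subseteq> topspace X"
      and sets: "sets \<nu> = sets (sigma (topspace (subtopology X W)) {U. openin (subtopology X W) U})"
    for \<nu> W
  proof -
    interpret \<nu>: prob_space \<nu> by (rule \<nu>)
    have "{U. openin (subtopology X W) U} \<subseteq> Pow (topspace (subtopology X W))"
      using openin_subset by blast
    then have space: "space \<nu> = W" using sets_eq_imp_space_eq[OF sets] W by auto
    have "f \<in> borel_measurable \<nu>"
      using smooth_measurable[OF sets f(1)] by (rule measurable_compose[of f _ _ "\<lambda>x. x"]) simp
    then have int_f: "integrable \<nu> f" using f(2) by (intro \<nu>.integrable_const_bound[of _ B]) auto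
    have "\<theta> \<in> borel_measurable \<nu>"
      using borel_measurable_continuous_map[OF sets continuous_map_from_subtopology[OF cont]] .
    then have int_\<theta>: "integrable \<nu> \<theta>"
      using B' W by (intro \<nu>.integrable_const_bound[of _ B'] AE_I2) (auto simp: space)
    have "norm (\<integral>y. f y - \<theta> y \<partial>\<nu>) \<le> (\<integral>y. e / 3 \<partial>\<nu>)"
    proof (rule order_trans[OF integral_norm_bound], rule integral_mono)
      show "integrable \<nu> (\<lambda>y. norm (f y - \<theta> y))" using int_f int_\<theta> by simp
    qed (use f(3) W in \<open>auto simp: space\<close>)
    then show ?thesis using int_f int_\<theta> by (simp add: \<nu>.prob_space)
  qed
  have \<mu>_approx: "integrable (\<mu> i) f \<and> norm ((\<integral>y. f y \<partial>\<mu> i) - (\<integral>y. \<theta> y \<partial>\<mu> i)) \<le> e / 3" for i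
    using \<mu>[of i] Y[of i] by (intro approx[of "\<mu> i" "Y i"]) (auto simp: invariant_borel_prob_def)
  have mX_approx: "integrable m\<^sub>X f \<and> norm ((\<integral>y. f y \<partial>m\<^sub>X) - (\<integral>y. \<theta> y \<partial>m\<^sub>X)) \<le> e / 3"
    using sets_mX mX.prob_space_axioms by (intro approx[of "m\<^sub>X" "topspace X"]) auto
  have "(\<lambda>i. \<integral>y. Re (f y) \<partial>\<mu> i) \<longlonglongrightarrow> (\<integral>y. Re (f y) \<partial>m\<^sub>X)"
    using f(2) by (intro smooth_equidistribution[OF smooth_compose[OF f(1)] _ \<mu> H Y Z, of Re B])
      (auto intro: order_trans[OF abs_Re_le_cmod])
  moreover have "(\<lambda>i. \<integral>y. Im (f y) \<partial>\<mu> i) \<longlonglongrightarrow> (\<integral>y. Im (f y) \<partial>m\<^sub>X)"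
    using f(2) by (intro smooth_equidistribution[OF smooth_compose[OF f(1)] _ \<mu> H Y Z, of Im B])
      (auto intro: order_trans[OF abs_Im_le_cmod])
  ultimately have "(\<lambda>i. \<integral>y. f y \<partial>\<mu> i) \<longlonglongrightarrow> (\<integral>y. f y \<partial>m\<^sub>X)"
    using \<mu>_approx mX_approx by (simp add: tendsto_complex_iff)
  then have "\<forall>\<^sub>F i in sequentially. dist (\<integral>y. f y \<partial>\<mu> i) (\<integral>y. f y \<partial>m\<^sub>X) < e / 3"
    using e by (intro tendstoD) auto
  then show "\<forall>\<^sub>F i in sequentially. dist (\<integral>y. \<theta> y \<partial>\<mu> i) (\<integral>y. \<theta> y \<partial>m\<^sub>X) < e"
  proof eventually_elim
    case (elim i)
    have "dist (\<integral>y. \<theta> y \<partial>\<mu> i) (\<integral>y. \<theta> y \<partial>m\<^sub>X)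
        \<le> dist (\<integral>y. f y \<partial>\<mu> i) (\<integral>y. \<theta> y \<partial>\<mu> i) + dist (\<integral>y. f y \<partial>\<mu> i) (\<integral>y. f y \<partial>m\<^sub>X)
          + dist (\<integral>y. f y \<partial>m\<^sub>X) (\<integral>y. \<theta> y \<partial>m\<^sub>X)"
      by (metis (no_types, lifting) add_left_mono dist_commute dist_triangle dist_triangle2 order_trans
          add.assoc)
    then show ?case using elim \<mu>_approx[of i] mX_approx by (simp add: dist_norm)
  qed
qed

section \<open>The horospherical stabilizer and its compact orbit\<close>

text \<open>Such an element fixes a tail of the positive half-axis, hence its end, and fixes a
  vertex.\<close>

lemma fixer_Tp_horo_stabilizer:
  assumes "(\<lambda>n. l (int n)) \<in> \<xi>" "\<xi> \<in> tree_boundary adj"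
  shows "fixer G (Tp n) \<subseteq> horo_stabilizer G \<xi>"
proof
  fix g assume g: "g \<in> fixer G (Tp n)"
  then have gG: "g \<in> G" and tail: "\<And>m. m \<ge> n \<Longrightarrow> g (l m) = l m"
    using axis_in_Tp by (auto simp: fixer_def)
  let ?r = "\<lambda>n. l (int n)"
  have "(?r, g \<circ> ?r) \<in> cofinal_rays adj"
    using tree_boundaryD(2)[OF assms(2,1)] rays_image[OF gG] tail unfolding cofinal_rays_def
    by (auto intro!: exI[of _ "nat n"])
  then have "end_act g \<xi> = \<xi>"
    using tree_boundaryD(1)[OF assms(2,1)] end_act_class[OF gG, of ?r]
      equiv_class_eq[OF equiv_cofinal_rays] by metis
  then show "g \<in> horo_stabilizer G \<xi>"
    using gG tail[of n] by (auto simp: horo_stabilizer_def elliptic_def)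
qed

lemma end_act_id: "end_act id \<xi> = \<xi>"
  by (auto simp: end_act_def)

lemma end_act_comp: "end_act (g \<circ> h) \<xi> = end_act g (end_act h \<xi>)"
  by (auto simp: end_act_def image_image comp_assoc)

lemma end_act_translation:
  assumes "(\<lambda>n. l (int n)) \<in> \<xi>" "\<xi> \<in> tree_boundary adj"
  shows "end_act a \<xi> = \<xi>"
proof -
  let ?r = "\<lambda>n. l (int n)"
  have "\<forall>k. ?r (nat t + k) = (a \<circ> ?r) (0 + k)" using t_pos by (simp add: a_l add.commute)
  then have "(?r, a \<circ> ?r) \<in> cofinal_rays adj"
    using tree_boundaryD(2)[OF assms(2,1)] rays_image[OF a_in, of ?r] unfolding cofinal_rays_def by blast
  then show ?thesis
    using tree_boundaryD(1)[OF assms(2,1)] end_act_class[OF a_in, of ?r]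
      equiv_class_eq[OF equiv_cofinal_rays] by metis
qed

text \<open>\<open>a\<close> fixes the end, and conjugation carries a fixed vertex to a fixed
  vertex. This brings the orbit of \<open>act (a ^^ i) x\<close> back to the compact orbit of
  \<open>x\<close>.\<close>

lemma horo_stabilizer_conj:
  assumes "(\<lambda>n. l (int n)) \<in> \<xi>" "\<xi> \<in> tree_boundary adj" "g \<in> horo_stabilizer G \<xi>"
  shows "finv (a ^^ i) \<circ> g \<circ> (a ^^ i) \<in> horo_stabilizer G \<xi>"
proof -
  let ?A = "a ^^ i"
  have A: "?A \<in> G" using a_in by blast
  have g: "g \<in> G" "end_act g \<xi> = \<xi>" using assms(3) by (auto simp: horo_stabilizer_def)
  obtain v where v: "g v = v" using assms(3) by (auto simp: horo_stabilizer_def elliptic_def)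
  have fix_A: "end_act ?A \<xi> = \<xi>"
  proof (induction i)
    case (Suc i)
    then show ?case using end_act_translation[OF assms(1,2)] by (simp only: funpow.simps end_act_comp)
  qed (simp only: funpow.simps end_act_id)
  then have "end_act (finv ?A) \<xi> = end_act (finv ?A \<circ> ?A) \<xi>" by (simp only: end_act_comp)
  also have "\<dots> = \<xi>" by (simp only: inv_comp_id(1)[OF A] end_act_id)
  finally have "end_act (finv ?A \<circ> g \<circ> ?A) \<xi> = \<xi>" by (simp add: end_act_comp g fix_A)
  moreover have "(finv ?A \<circ> g \<circ> ?A) (finv ?A v) = finv ?A v" using A v by simp
  then have "elliptic (finv ?A \<circ> g \<circ> ?A)" unfolding elliptic_def by blast
  ultimately show ?thesis using A g by (auto simp: horo_stabilizer_def)
qed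

text \<open>The \<open>U\<close>-orbits are open, so finitely many of them cover
  \<open>K\<close>.\<close>

lemma compact_finitely_many_orbits:
  assumes "compactin X K"
  obtains Z where "finite Z" "Z \<subseteq> K" "\<And>y. y \<in> K \<Longrightarrow> \<exists>z\<in>Z. orbit_map y = orbit_map z"
proof -
  have K: "K \<subseteq> topspace X" using assms by (rule compactin_subset_topspace)
  have "\<exists>F. finite F \<and> F \<subseteq> orbit_map ` K \<and> K \<subseteq> \<Union> F"
  proof (rule compactinD[OF assms])
    show "openin X V" if "V \<in> orbit_map ` K" for V
      using that K orbit_open[of _ "{l 0, l 1}"] by (auto simp: orbit_map_def)
    show "K \<subseteq> \<Union> (orbit_map ` K)"
    proof
      fix y assume "y \<in> K"
      moreover have "act id y \<in> orbit_map y" unfolding orbit_map_def using fixer_id by blast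
      ultimately show "y \<in> \<Union> (orbit_map ` K)" by auto
    qed
  qed
  then obtain Z where Z: "finite Z" "Z \<subseteq> K" "K \<subseteq> \<Union> (orbit_map ` Z)"
    by (metis (no_types, lifting) finite_subset_image)
  have "\<exists>z\<in>Z. orbit_map y = orbit_map z" if "y \<in> K" for y
    using Z(3) that orbit_map_eq by (fastforce simp: orbit_map_def)
  then show thesis using that Z by blast
qed

end

theorem proposition1p6:
  fixes adj :: "'v \<Rightarrow> 'v \<Rightarrow> bool"
    and d0 d1 :: nat
    and G \<Gamma> :: "('v \<Rightarrow> 'v) set"
    and \<xi> :: "(nat \<Rightarrow> 'v) set"
    and a :: "'v \<Rightarrow> 'v"
    and x :: "('v \<Rightarrow> 'v) set"
    and m\<^sub>X :: "('v \<Rightarrow> 'v) set measure"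
    and m :: "nat \<Rightarrow> ('v \<Rightarrow> 'v) set measure"
  assumes "is_tree adj" and "biregular adj d0 d1" and "d0 \<ge> 3" and "d1 \<ge> 3"
    and "subgroup G (tree_aut adj)"
    and "closedin (aut_topology adj) G"
    and "\<not> compactin (aut_topology adj) G"
    and "topologically_simple (tree_aut adj) (aut_topology adj) G"
    and "transitive_on_boundary adj G"
    and "tits_independent adj G"
    and "lattice_in adj G \<Gamma>"
    and "invariant_borel_prob (tree_aut adj) G (coset_space adj G \<Gamma>) m\<^sub>X"
    and "\<xi> \<in> tree_boundary adj"
    and "a \<in> G" and "hyperbolic adj a" and "attracting_end adj a \<xi>"
    and "x \<in> topspace (coset_space adj G \<Gamma>)"
    and "compactin (coset_space adj G \<Gamma>) (coset_orbit (tree_aut adj) (horo_stabilizer G \<xi>) x)"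
    and "\<And>i. invariant_borel_prob (tree_aut adj) (horo_stabilizer G \<xi>)
               (subtopology (coset_space adj G \<Gamma>)
                  (coset_orbit (tree_aut adj) (horo_stabilizer G \<xi>)
                     ((a [^]\<^bsub>tree_aut adj\<^esub> i) <#\<^bsub>tree_aut adj\<^esub> x)))
               (m i)"
  shows "\<forall>\<theta>\<in>Cc (coset_space adj G \<Gamma>).
           (\<lambda>i. \<integral>y. \<theta> y \<partial>(m i)) \<longlonglongrightarrow> (\<integral>y. \<theta> y \<partial>m\<^sub>X)"
proof -
  obtain V0 where V0: "bipartition adj V0"
    "\<forall>v\<in>V0. finite {y. adj v y} \<and> card {y. adj v y} = d0"
    "\<forall>v\<in>- V0. finite {y. adj v y} \<and> card {y. adj v y} = d1"
    using assms(2) by (auto simp: biregular_def)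
  have degree: "finite {y. adj v y}" "card {y. adj v y} \<ge> 3" for v
    using V0(2,3) assms(3,4) by (cases "v \<in> V0"; force)+
  have three: "\<exists>y. adj v y \<and> y \<noteq> u \<and> y \<noteq> w" for v u w
  proof (rule ccontr)
    assume "\<not> ?thesis"
    then have "{y. adj v y} \<subseteq> {u, w}" by blast
    then have "card {y. adj v y} \<le> card {u, w}" by (intro card_mono) auto
    also have "\<dots> \<le> 2" by (simp add: card_insert_if)
    finally show False using degree(2)[of v] by simp
  qed
  obtain l where l: "translates_along adj a l" "(\<lambda>n. l (int n)) \<in> \<xi>"
    using assms(16) by (auto simp: attracting_end_def)
  then obtain t where t: "inj l" "\<And>i. adj (l i) (l (i + 1))" "t > 0" "\<And>i. a (l i) = l (i + t)"
    by (auto simp: translates_along_def)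
  interpret horospherical adj G \<Gamma> l a t m\<^sub>X V0
    by (intro horospherical.intro coset_action.intro translation.intro tree_group.intro
      tree_axis.intro tree.intro horospherical_axioms.intro coset_action_axioms.intro
      translation_axioms.intro tree_group_axioms.intro tree_axis_axioms.intro
      assms V0(1) degree(1) three t)
  let ?N = "horo_stabilizer G \<xi>"
  let ?O = "\<lambda>y. (\<lambda>g. act g y) ` ?N"
  have orbit: "coset_orbit (tree_aut adj) ?N y = ?O y" for y
    by (simp add: coset_orbit_def l_coset_eq_act)
  obtain Z where Z: "finite Z" "Z \<subseteq> ?O x" "\<And>y. y \<in> ?O x \<Longrightarrow> \<exists>z\<in>Z. orbit_map y = orbit_map z"
    using compact_finitely_many_orbits assms(18) unfolding orbit by blast
  have N_G: "g \<in> G" if "g \<in> ?N" for g using that by (simp add: horo_stabilizer_def)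
  show ?thesis
  proof
    fix \<theta> :: "('v \<Rightarrow> 'v) set \<Rightarrow> complex" assume \<theta>: "\<theta> \<in> Cc X"
    show "(\<lambda>i. \<integral>y. \<theta> y \<partial>(m i)) \<longlonglongrightarrow> (\<integral>y. \<theta> y \<partial>m\<^sub>X)"
    proof (rule Cc_equidistribution[OF \<theta>, where H = ?N and Y = "\<lambda>i. ?O (act (a ^^ i) x)" and Z = Z])
      show "invariant_borel_prob (tree_aut adj) ?N (subtopology X (?O (act (a ^^ i) x))) (m i)" for i
        using assms(19)[of i] by (simp add: orbit l_coset_eq_act tree_aut_pow)
      show "fixer G (Tp n) \<subseteq> ?N" for n using fixer_Tp_horo_stabilizer[OF l(2) assms(13)] .
      show "?O (act (a ^^ i) x) \<subseteq> topspace X" for i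
        using assms(17) N_G G_pow[OF a_in] by auto
      show "Z \<subseteq> topspace X" using Z(2) assms(17) N_G by auto
      \<comment> \<open>Pulling back by \<open>a ^^ i\<close> lands in the fixed orbit of
        \<open>x\<close>, so one finite \<open>Z\<close> serves all \<open>i\<close>.\<close>
      fix i y assume "y \<in> ?O (act (a ^^ i) x)"
      then obtain g where g: "g \<in> ?N" "y = act g (act (a ^^ i) x)" by blast
      have "act (finv (a ^^ i)) y = act (finv (a ^^ i) \<circ> g \<circ> (a ^^ i)) x"
        using g(2) by (simp add: act_comp)
      then have "act (finv (a ^^ i)) y \<in> ?O x"
        using horo_stabilizer_conj[OF l(2) assms(13) g(1), of i] by blast
      then show "\<exists>z\<in>Z. orbit_map (act (finv (a ^^ i)) y) = orbit_map z" by (rule Z(3))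
    qed (rule Z(1))
  qed
qed

end
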